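(* Let $0<\alpha,\lambda\leq 1$ be real numbers such that $\alpha$ is rational and $\lambda$ is irrational. Then, for any $\eta>0$, the Lerch zeta function $L(\lambda,\alpha,s)$ has infinitely many zeros $s=\sigma+it$ with $1<\sigma<1+\eta$.
   Context: For $0<\alpha,\lambda\le 1$ the Lerch zeta function is defined, for complex $s=\sigma+it$ with $\sigma>1$, by $$L(\lambda,\alpha,s)=\sum_{n=0}^\infty \frac{e(\lambda n)}{(n+\alpha)^s},\qquad e(z)=e^{2\pi i z}.$$ *)

theory Defs
  imports "HOL-Complex_Analysis.Complex_Analysis"
begin

definition e :: "complex \<Rightarrow> complex" where
  "e z = exp (2 * of_real pi * \<i> * z)"

(* Meaningful for 0 < \<alpha>, lam \<le> 1 and Re s > 1, where the series converges absolutely; there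
   the base n + \<alpha> is a positive real, so powr uses the real logarithm.  No analytic
   continuation is included: outside Re s > 1 the value is whatever suminf gives. *)
definition Lerch_zeta :: "real \<Rightarrow> real \<Rightarrow> complex \<Rightarrow> complex" where
  "Lerch_zeta lam \<alpha> s = (\<Sum>n. e (of_real lam * of_nat n) / (of_nat n + of_real \<alpha>) powr s)"

end

theory Submission
  imports Defs
begin

text \<open>
  For \<open>\<alpha> = a / q\<close> and \<open>\<beta> = lam / q\<close> the Lerch zeta function is, up to a nonvanishing factor,
  the Dirichlet series of \<open>c m = e (\<beta> * m)\<close> supported on \<open>m \<equiv> a (mod q)\<close>. Suppose it has no zero in a
  strip \<open>1 < Re s < 1 + \<eta>\<close>. By Kronecker's theorem (Bohr's correspondence) the twist of the series by any
  unimodular completely multiplicative function \<open>z\<close> has no zero for \<open>1 < \<sigma> \<le> \<sigma>0\<close> either, and the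
  maximum principle extends this to \<open>\<bar>z p\<bar> \<le> 1\<close> for all primes \<open>p > P0\<close>, with \<open>P0\<close> independent of \<open>\<sigma>\<close>.

  Let the variables \<open>z p\<close> with \<open>p\<close> in a finite set \<open>P\<close> of large primes be \<open>w * u p\<close> and let
  \<open>f w = f0 + f1 * w + f2 * w\<^sup>2 + \<dots>\<close> be the resulting zero-free function on the unit disc. With
  \<open>W = (\<Sum>p\<in>P. p powr -\<sigma>)\<close> one has \<open>ln (sup |f|) = O(W)\<close>, so the second coefficient of \<open>ln f\<close> is \<open>O(W)\<close>
  and \<open>|f1|\<^sup>2\<close> is at most \<open>2 * |f0 * f2| + O(W)\<close>. The coefficient \<open>f2\<close> is a bilinear form in \<open>e (\<beta> * k * p * p')\<close>,
  which is \<open>o(W\<^sup>2)\<close> for suitable \<open>P\<close> because \<open>\<beta>\<close> is irrational. Hence \<open>f1 = o(W)\<close> uniformly in \<open>u\<close> and in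
  the remaining variables \<open>z p\<close>, \<open>p \<le> P0\<close>, on the torus, and by the maximum principle also at \<open>z p = p powr -2\<close>.
  There, however, \<open>f1\<close> is a sum over \<open>P\<close> of Dirichlet series dominated by their first terms, and a suitable
  choice of \<open>u\<close> makes \<open>|f1|\<close> at least a constant times \<open>W\<close>.
\<close>

section \<open>Dirichlet series twisted by completely multiplicative functions\<close>

text \<open>The coefficients \<open>c m\<close> are not multiplicative, so the series has no Euler
  product. Freedom from zeros would make it imitate one: for h = ln (f / f0) one has
  \<open>f1^2 - 2 * f0 * f2 = - f0^2 * h''(0)\<close>, and h is of size O(W), so the terms of order
  \<open>W^2\<close> on the left must nearly cancel. The irrationality of \<beta> destroys this
  balance. At single primes the free phases \<open>u p\<close> can align all terms of f1; at
  products \<open>p * p'\<close> the phases \<open>u p * u p'\<close> cannot follow the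
  exponentials, and f2 falls below the order \<open>W^2\<close>.

  That P0 does not depend on \<sigma> is decisive for the order of choices. The set P must lie above
  P0 and have a large reciprocal sum, and the bilinear estimate must hold for it with every \<sigma>
  \<ge> 1. Only after P is fixed is \<sigma> moved towards 1, so that W comes close to that
  reciprocal sum. If P0 grew as \<sigma> decreases, W could not be made large against the constants
  that depend on P0.\<close>

definition cmul :: "(nat \<Rightarrow> complex) \<Rightarrow> nat \<Rightarrow> complex" where
  "cmul z m = prod_mset (image_mset z (prime_factorization m))"

lemma has_sum_minus:
  fixes f g :: "'a \<Rightarrow> 'b :: real_normed_vector"
  assumes "(f has_sum a) A" "(g has_sum b) A"
  shows "((\<lambda>x. f x - g x) has_sum (a - b)) A"
proof -
  have "((\<lambda>x. - g x) has_sum - b) A" using assms by (simp add: has_sum_uminus)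
  from has_sum_add[OF assms(1) this] show ?thesis by simp
qed

text \<open>The index \<open>m = 0\<close> contributes nothing, because \<open>0 powr x = 0\<close>.\<close>

definition dser :: "(nat \<Rightarrow> complex) \<Rightarrow> (nat \<Rightarrow> complex) \<Rightarrow> real \<Rightarrow> complex" where
  "dser c z \<sigma> = (\<Sum>\<^sub>\<infinity>m. c m * cmul z m * of_real (real m powr -\<sigma>))"

text \<open>The total degree of the monomial \<open>cmul z m\<close> in the variables
  \<open>z p\<close> with p in P.\<close>

definition Omega_in :: "nat set \<Rightarrow> nat \<Rightarrow> nat" where
  "Omega_in P m = size (filter_mset (\<lambda>p. p \<in> P) (prime_factorization m))"

lemma cmul_0 [simp]: "cmul z 0 = 1"
  and cmul_1 [simp]: "cmul z (Suc 0) = 1"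
  by (simp_all add: cmul_def)

lemma cmul_mult: "m \<noteq> 0 \<Longrightarrow> n \<noteq> 0 \<Longrightarrow> cmul z (m * n) = cmul z m * cmul z n"
  by (simp add: cmul_def prime_factorization_mult)

lemma cmul_prime [simp]: "prime p \<Longrightarrow> cmul z p = z p"
  by (simp add: cmul_def prime_factorization_prime)

lemma norm_cmul: "norm (cmul z m) = prod_mset (image_mset (\<lambda>p. norm (z p)) (prime_factorization m))"
proof -
  have "norm (prod_mset (image_mset z M)) = prod_mset (image_mset (\<lambda>p. norm (z p)) M)" for M
    by (induction M) (auto simp: norm_mult)
  thus ?thesis by (simp add: cmul_def)
qed

lemma norm_cmul_le_1:
  assumes "\<And>p. prime p \<Longrightarrow> norm (z p) \<le> 1"
  shows "norm (cmul z m) \<le> 1"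
proof -
  have "0 \<le> prod_mset (image_mset (\<lambda>p. norm (z p)) M) \<and> prod_mset (image_mset (\<lambda>p. norm (z p)) M) \<le> 1"
    if "\<And>p. p \<in># M \<Longrightarrow> norm (z p) \<le> 1" for M
    using that by (induction M) (simp_all add: mult_le_one)
  thus ?thesis unfolding norm_cmul using assms by (auto intro: in_prime_factors_imp_prime)
qed

lemma cmul_cong:
  assumes "\<And>p. p \<in> prime_factors m \<Longrightarrow> z p = z' p"
  shows "cmul z m = cmul z' m"
  unfolding cmul_def using assms by (intro arg_cong[where f = prod_mset] image_mset_cong) auto

lemma cmul_eq_0:
  assumes "p \<in> prime_factors m" "z p = 0"
  shows "cmul z m = 0"
  using assms by (auto simp: cmul_def)

lemma cmul_scale:
  "cmul (\<lambda>p. if p \<in> P then w * u p else y p) m =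
     cmul (\<lambda>p. if p \<in> P then u p else y p) m * w ^ Omega_in P m"
proof -
  have "prod_mset (image_mset (\<lambda>p. if p \<in> P then w * u p else y p) M) =
        prod_mset (image_mset (\<lambda>p. if p \<in> P then u p else y p) M) * w ^ size (filter_mset (\<lambda>p. p \<in> P) M)" for M
    by (induction M) (auto simp: mult_ac)
  thus ?thesis by (simp add: cmul_def Omega_in_def)
qed

lemma powr_summable_on: "\<sigma> > 1 \<Longrightarrow> (\<lambda>m::nat. real m powr -\<sigma>) summable_on UNIV"
  by (intro summable_nonneg_imp_summable_on) (auto simp: summable_real_powr_iff)

lemma dser_term_bound:
  assumes "norm (c m) \<le> C" "\<And>p. prime p \<Longrightarrow> norm (z p) \<le> 1"
  shows "norm (c m * cmul z m * of_real (real m powr -\<sigma>)) \<le> C * real m powr -\<sigma>"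
proof -
  have "C \<ge> 0" using assms(1) norm_ge_zero order_trans by blast
  have "norm (c m) * norm (cmul z m) \<le> C * 1"
    using assms \<open>C \<ge> 0\<close> by (intro mult_mono norm_cmul_le_1) auto
  thus ?thesis by (simp add: norm_mult mult_right_mono)
qed

lemma dser_abs_summable:
  assumes "\<And>m. norm (c m) \<le> C" "\<And>p. prime p \<Longrightarrow> norm (z p) \<le> 1" "\<sigma> > 1"
  shows "(\<lambda>m. norm (c m * cmul z m * of_real (real m powr -\<sigma>))) summable_on UNIV"
  by (rule Infinite_Sum.abs_summable_on_comparison_test'[OF summable_on_cmult_right[OF powr_summable_on[OF assms(3)], of C]])
     (use dser_term_bound assms in auto)

lemma dser_summable:
  assumes "\<And>m. norm (c m) \<le> C" "\<And>p. prime p \<Longrightarrow> norm (z p) \<le> 1" "\<sigma> > 1"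
  shows "(\<lambda>m. c m * cmul z m * of_real (real m powr -\<sigma>)) summable_on UNIV"
  using abs_summable_summable[OF dser_abs_summable[OF assms]] .

lemma nonneg_tail_small:
  fixes f :: "nat \<Rightarrow> real"
  assumes S: "f summable_on A" and nonneg: "\<And>m. m \<in> A \<Longrightarrow> f m \<ge> 0" and "\<epsilon> > 0"
  obtains N :: nat where "(\<Sum>\<^sub>\<infinity>m\<in>A \<inter> {N<..}. f m) < \<epsilon>"
proof -
  obtain F where F: "finite F" "F \<subseteq> A" "dist (sum f F) (infsum f A) \<le> \<epsilon> / 2"
    using infsum_finite_approximation[OF S, of "\<epsilon> / 2"] \<open>\<epsilon> > 0\<close> by auto
  define N where "N = Max (insert 0 F)"
  have "infsum f (F \<union> (A - F)) = infsum f F + infsum f (A - F)"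
    by (rule infsum_Un_disjoint) (use F summable_on_subset_banach[OF S] in auto)
  moreover have "F \<union> (A - F) = A" using F by auto
  ultimately have "infsum f (A - F) \<le> \<epsilon> / 2" using F by (simp add: dist_real_def)
  moreover have "F \<inter> {N<..} = {}" using F by (auto simp: N_def dest: Max_ge[of "insert 0 F", rotated])
  hence "infsum f (A \<inter> {N<..}) \<le> infsum f (A - F)"
    using nonneg by (intro infsum_mono2 summable_on_subset_banach[OF S]) auto
  ultimately show ?thesis using \<open>\<epsilon> > 0\<close> by (intro that[of N]) linarith
qed

lemma powr_tail_small:
  assumes "\<sigma> > 1" "\<epsilon> > 0"
  obtains N :: nat where "(\<Sum>\<^sub>\<infinity>m\<in>{N<..}. real m powr -\<sigma>) < \<epsilon>"
  using nonneg_tail_small[OF powr_summable_on[OF assms(1)] _ assms(2)] by auto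

text \<open>An index m with 0 < m \<le> N involves only primes up to N, so these terms cancel. The
  bound does not depend on the twists, which reduces questions about infinitely many variables to
  finitely many.\<close>

lemma dser_diff_bound:
  assumes c: "\<And>m. norm (c m) \<le> 1"
    and z: "\<And>p. prime p \<Longrightarrow> norm (z p) \<le> 1" "\<And>p. prime p \<Longrightarrow> norm (z' p) \<le> 1"
    and eq: "\<And>p. prime p \<Longrightarrow> p \<le> N \<Longrightarrow> z p = z' p" and "\<sigma> > 1"
  shows "norm (dser c z \<sigma> - dser c z' \<sigma>) \<le> 2 * (\<Sum>\<^sub>\<infinity>m\<in>{N<..}. real m powr -\<sigma>)"
proof -
  let ?t = "\<lambda>z m. c m * cmul z m * of_real (real m powr -\<sigma>)"
  let ?g = "\<lambda>m. if m > N then 2 * real m powr -\<sigma> else 0"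
  have g: "(?g has_sum (2 * (\<Sum>\<^sub>\<infinity>m\<in>{N<..}. real m powr -\<sigma>))) UNIV"
  proof -
    have "((\<lambda>m. real m powr -\<sigma>) has_sum (\<Sum>\<^sub>\<infinity>m\<in>{N<..}. real m powr -\<sigma>)) {N<..}"
      using summable_on_subset_banach[OF powr_summable_on[OF \<open>\<sigma> > 1\<close>]] by (intro has_sum_infsum) auto
    hence "((\<lambda>m. 2 * real m powr -\<sigma>) has_sum (2 * (\<Sum>\<^sub>\<infinity>m\<in>{N<..}. real m powr -\<sigma>))) {N<..}"
      by (rule has_sum_cmult_right)
    thus ?thesis by (subst has_sum_cong_neutral[where T = "{N<..}" and g = "\<lambda>m. 2 * real m powr -\<sigma>"]) auto
  qed
  have f: "((\<lambda>m. ?t z m - ?t z' m) has_sum (dser c z \<sigma> - dser c z' \<sigma>)) UNIV"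
    unfolding dser_def by (intro has_sum_minus has_sum_infsum dser_summable[OF c] z \<open>\<sigma> > 1\<close>)
  show ?thesis
  proof (rule norm_infsum_le[OF f g])
    fix m
    show "norm (?t z m - ?t z' m) \<le> ?g m"
    proof (cases "m > N")
      case True
      have "norm (?t z m - ?t z' m) \<le> norm (?t z m) + norm (?t z' m)" by (rule norm_triangle_ineq4)
      also have "\<dots> \<le> 1 * real m powr -\<sigma> + 1 * real m powr -\<sigma>"
        by (intro add_mono dser_term_bound c z)
      finally show ?thesis using True by simp
    next
      case False
      have "cmul z m = cmul z' m"
      proof (cases "m = 0")
        case False': False
        show ?thesis
        proof (rule cmul_cong, rule eq)
          fix p assume p: "p \<in> prime_factors m"
          thus "prime p" by (rule in_prime_factors_imp_prime)
          have "p \<le> m" using p False' by (intro dvd_imp_le in_prime_factors_imp_dvd) auto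
          thus "p \<le> N" using False by simp
        qed
      qed auto
      thus ?thesis using False by simp
    qed
  qed
qed

lemma weighted_power_sum:
  fixes a :: "nat \<Rightarrow> complex" and k :: "nat \<Rightarrow> nat"
  assumes "(\<lambda>m. norm (a m)) summable_on UNIV"
  defines "G \<equiv> \<lambda>w. \<Sum>\<^sub>\<infinity>m. a m * w ^ k m"
  shows "continuous_on (cball 0 1) G" "G holomorphic_on ball 0 1"
proof -
  have U: "uniform_limit (cball 0 1) (\<lambda>X w. \<Sum>m\<in>X. a m * w ^ k m) G (finite_subsets_at_top UNIV)"
    unfolding G_def
  proof (rule Weierstrass_m_test_general[where M = "\<lambda>m. norm (a m)"])
    fix m and w :: complex assume "w \<in> cball 0 1"
    hence "norm w ^ k m \<le> 1" by (auto intro: power_le_one)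
    thus "norm (a m * w ^ k m) \<le> norm (a m)"
      by (simp add: norm_mult norm_power mult_left_le)
  qed (use assms in auto)
  have *: "continuous_on (cball 0 1) G \<and> G holomorphic_on ball 0 1"
    by (rule holomorphic_uniform_limit[OF _ U]) (auto intro!: always_eventually continuous_intros holomorphic_intros)
  thus "continuous_on (cball 0 1) G" "G holomorphic_on ball 0 1" by auto
qed

text \<open>Many m share one exponent \<open>k m\<close>. Absolute convergence allows each fibre of
  k to be summed first, which turns G into an ordinary power series. In the application k is the
  degree \<open>Omega_in P\<close>.\<close>

lemma weighted_power_sum_derivs:
  fixes a :: "nat \<Rightarrow> complex" and k :: "nat \<Rightarrow> nat"
  assumes S: "(\<lambda>m. norm (a m)) summable_on UNIV"
  defines "G \<equiv> \<lambda>w. \<Sum>\<^sub>\<infinity>m. a m * w ^ k m"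
  defines "A \<equiv> \<lambda>j. \<Sum>\<^sub>\<infinity>m\<in>{m. k m = j}. a m"
  shows "(deriv ^^ j) G 0 = fact j * A j"
proof -
  have S': "a summable_on UNIV" by (rule abs_summable_summable[OF S])
  have sums: "(\<lambda>j. A j * w ^ j) sums G w" if w: "norm w < 1" for w
  proof -
    have "(\<lambda>m. norm (a m * w ^ k m)) summable_on UNIV"
    proof (rule Infinite_Sum.abs_summable_on_comparison_test'[OF S])
      fix m show "norm (a m * w ^ k m) \<le> norm (a m)"
        using w power_le_one[of "norm w" "k m"] by (simp add: norm_mult norm_power mult_left_le)
    qed
    hence "((\<lambda>m. a m * w ^ k m) has_sum G w) UNIV"
      unfolding G_def by (rule has_sum_infsum[OF abs_summable_summable])
    also have "?this \<longleftrightarrow> ((\<lambda>(j, m). a m * w ^ k m) has_sum G w) (SIGMA j:UNIV. {m. k m = j})"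
      by (rule has_sum_reindex_bij_witness[of _ snd "\<lambda>m. (k m, m)"]) auto
    finally have *: "((\<lambda>(j, m). a m * w ^ k m) has_sum G w) (SIGMA j:UNIV. {m. k m = j})" .
    have "((\<lambda>j. A j * w ^ j) has_sum G w) UNIV"
    proof (rule has_sum_SigmaD[OF *])
      fix j :: nat
      have "(a has_sum A j) {m. k m = j}"
        unfolding A_def by (intro has_sum_infsum summable_on_subset_banach[OF S']) auto
      hence "((\<lambda>m. a m * w ^ j) has_sum (A j * w ^ j)) {m. k m = j}"
        by (rule has_sum_cmult_left)
      thus "((\<lambda>y. case (j, y) of (j, m) \<Rightarrow> a m * w ^ k m) has_sum A j * w ^ j) {m. k m = j}"
        by (subst has_sum_cong[where g = "\<lambda>m. a m * w ^ j"]) auto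
    qed
    thus ?thesis by (rule has_sum_imp_sums)
  qed
  have "G has_fps_expansion Abs_fps A"
  proof (rule has_fps_expansionI)
    show "\<forall>\<^sub>F u in nhds 0. (\<lambda>n. fps_nth (Abs_fps A) n * u ^ n) sums G u"
      using sums by (auto simp: eventually_nhds_metric intro!: exI[of _ 1])
  qed
  from fps_nth_fps_expansion[OF this, of j] show ?thesis by (simp add: field_simps)
qed

section \<open>Vertical shifts and the torus of unimodular twists\<close>

lemma norm_cis_diff_le: "norm (cis x - cis y) \<le> \<bar>x - y\<bar>"
proof -
  have "cis x - cis y = cis y * (exp (\<i> * of_real (x - y)) - 1)"
    by (simp add: algebra_simps cis_conv_exp flip: exp_add)
  hence "norm (cis x - cis y) = 2 * \<bar>sin ((x - y) / 2)\<bar>"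
    by (simp only: norm_mult norm_cis dist_exp_i_1 mult_1)
  also have "\<dots> \<le> 2 * \<bar>(x - y) / 2\<bar>" by (rule mult_left_mono[OF abs_sin_x_le_abs_x]) auto
  finally show ?thesis by simp
qed

text \<open>Unique factorisation. Since \<open>nat\<close> truncates at 0, A collects the positive
  exponents and B the negative ones; equality of the logarithms gives A = B, and
  \<open>nat (u p) = nat (- u p)\<close> forces \<open>u p = 0\<close>.\<close>

lemma ln_primes_independent:
  fixes T :: "nat set" and u :: "nat \<Rightarrow> int"
  assumes T: "finite T" "\<And>p. p \<in> T \<Longrightarrow> prime p"
    and eq: "(\<Sum>p\<in>T. of_int (u p) * ln (real p)) = 0" and p: "p \<in> T"
  shows "u p = 0"
proof -
  define A B where "A = (\<Prod>p\<in>T. p ^ nat (u p))" and "B = (\<Prod>p\<in>T. p ^ nat (- u p))"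
  have pos: "p > 0" if "p \<in> T" for p using T(2)[OF that] prime_gt_0_nat by blast
  have "ln (real A) = (\<Sum>p\<in>T. real (nat (u p)) * ln (real p))"
    unfolding A_def using pos T(1) by (simp add: ln_prod ln_realpow)
  moreover have "ln (real B) = (\<Sum>p\<in>T. real (nat (- u p)) * ln (real p))"
    unfolding B_def using pos T(1) by (simp add: ln_prod ln_realpow)
  ultimately have "ln (real A) - ln (real B) = (\<Sum>p\<in>T. (real (nat (u p)) - real (nat (- u p))) * ln (real p))"
    by (simp add: sum_subtractf left_diff_distrib)
  also have "\<dots> = (\<Sum>p\<in>T. of_int (u p) * ln (real p))"
    by (intro sum.cong) (auto simp: of_nat_nat)
  finally have "ln (real A) = ln (real B)" using eq by simp
  moreover have "A > 0" "B > 0" unfolding A_def B_def using pos by (auto intro!: prod_pos)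
  ultimately have "A = B" by simp
  moreover have "multiplicity p A = nat (u p)" unfolding A_def
    using multiplicity_prod_prime_powers[of T p "\<lambda>p. nat (u p)"] T p by auto
  moreover have "multiplicity p B = nat (- u p)" unfolding B_def
    using multiplicity_prod_prime_powers[of T p "\<lambda>p. nat (- u p)"] T p by auto
  ultimately show ?thesis by auto
qed

text \<open>Kronecker's theorem for the frequencies \<open>ln p / (2 * pi)\<close>. The tolerance
  \<epsilon> / (2 * pi) modulo 1 becomes an arc of length \<epsilon>, which bounds the
  chord.\<close>

lemma prime_twist_approx:
  fixes z :: "nat \<Rightarrow> complex"
  assumes z: "\<And>p. prime p \<Longrightarrow> norm (z p) = 1" and "\<epsilon> > 0"
  obtains t where "\<And>p. prime p \<Longrightarrow> p \<le> N \<Longrightarrow> norm (of_nat p powr (-(\<i> * of_real t)) - z p) < \<epsilon>"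
proof -
  define T where "T = {p::nat. prime p \<and> p \<le> N}"
  have T: "finite T" "\<And>p. p \<in> T \<Longrightarrow> prime p" by (auto simp: T_def)
  obtain b where b: "bij_betw b {..<card T} T"
    using ex_bij_betw_nat_finite[OF T(1)] by (auto simp: atLeast0LessThan)
  define \<theta> where "\<theta> = (\<lambda>p::nat. ln (real p) / (2 * pi))"
  \<comment> \<open>Independence is a property of the set of frequencies, so distinct primes must
    give distinct elements of it.\<close>
  have inj: "inj_on \<theta> T"
  proof (rule inj_onI)
    fix p p' assume "p \<in> T" "p' \<in> T" "\<theta> p = \<theta> p'"
    thus "p = p'" using T(2)[of p] T(2)[of p'] by (auto simp: \<theta>_def prime_gt_0_nat)
  qed
  have img: "(\<theta> \<circ> b) ` {..<card T} = \<theta> ` T" using b by (metis bij_betw_imp_surj_on image_comp)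
  interpret Modules.module "(\<lambda>r. (*) (real_of_int r))"
    by (simp add: Modules.module.intro distrib_left mult.commute)
  have "independent (\<theta> ` T)"
    unfolding independent_explicit_module
  proof (intro allI impI)
    fix t u v assume t: "finite t" "t \<subseteq> \<theta> ` T" "(\<Sum>v\<in>t. real_of_int (u v) * v) = 0" "v \<in> t"
    then obtain T' where T': "T' \<subseteq> T" "t = \<theta> ` T'" by (meson subset_image_iff)
    then obtain p where p: "p \<in> T'" "v = \<theta> p" using t by auto
    have inj': "inj_on \<theta> T'" using inj T' inj_on_subset by blast
    have "(\<Sum>p\<in>T'. of_int (u (\<theta> p)) * ln (real p)) = 2 * pi * (\<Sum>v\<in>t. real_of_int (u v) * v)"
      unfolding T'(2) by (subst sum.reindex[OF inj']) (simp add: \<theta>_def sum_distrib_left)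
    hence "u (\<theta> p) = 0"
      by (intro ln_primes_independent[of T' "\<lambda>p. u (\<theta> p)"]) (use T T' t p finite_subset[OF T'(1)] in auto)
    thus "u v = 0" using p by simp
  qed
  hence ind: "independent ((\<theta> \<circ> b) ` {..<card T})" unfolding img .
  have "inj_on (\<theta> \<circ> b) {..<card T}"
    using b inj by (auto simp: bij_betw_def intro: comp_inj_on)
  from Kronecker_thm_1[OF ind this, of "\<epsilon> / (2 * pi)" "\<lambda>i. Arg (z (b i)) / (2 * pi)"] \<open>\<epsilon> > 0\<close>
  obtain t h where th: "\<And>i. i < card T \<Longrightarrow> \<bar>t * (\<theta> \<circ> b) i - of_int (h i) - Arg (z (b i)) / (2 * pi)\<bar> < \<epsilon> / (2 * pi)"
    by auto
  \<comment> \<open>Kronecker's theorem controls \<open>t * ln p\<close>, whereas the twist has the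
    phase \<open>- t * ln p\<close>.\<close>
  show ?thesis
  proof (rule that[of "-t"])
    fix p assume p: "prime p" "p \<le> N"
    hence "p \<in> b ` {..<card T}" using bij_betw_imp_surj_on[OF b] by (simp add: T_def)
    then obtain i where i: "i < card T" "b i = p" by auto
    have "of_nat p powr (-(\<i> * of_real (-t))) = cis (t * ln (real p))"
      using p prime_gt_0_nat[of p] by (simp add: powr_def cis_conv_exp mult_ac Ln_of_nat)
    also have "t * ln (real p) = (t * ln (real p) - 2 * pi * of_int (h i)) + 2 * pi * of_int (h i)" by simp
    also have "cis \<dots> = cis (t * ln (real p) - 2 * pi * of_int (h i))"
      by (simp only: cis_mult[symmetric] cis_multiple_2pi[OF Ints_of_int] mult_1_right)
    finally have 1: "of_nat p powr (-(\<i> * of_real (-t))) = cis (t * ln (real p) - 2 * pi * of_int (h i))" .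
    have 2: "z p = cis (Arg (z p))" using z[OF p(1)] rcis_cmod_Arg[of "z p"] by (simp add: rcis_def)
    have "norm (of_nat p powr (-(\<i> * of_real (-t))) - z p) \<le> \<bar>t * ln (real p) - 2 * pi * of_int (h i) - Arg (z p)\<bar>"
      by (subst 1, subst 2) (rule norm_cis_diff_le)
    also have "\<dots> = 2 * pi * \<bar>t * \<theta> p - of_int (h i) - Arg (z p) / (2 * pi)\<bar>"
    proof -
      have "t * ln (real p) - 2 * pi * of_int (h i) - Arg (z p) = 2 * pi * (t * \<theta> p - of_int (h i) - Arg (z p) / (2 * pi))"
        by (simp add: \<theta>_def field_simps)
      thus ?thesis by (simp add: abs_mult)
    qed
    also have "\<dots> < \<epsilon>" using th[OF i(1)] i(2) by (simp add: field_simps)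
    finally show "norm (of_nat p powr (-(\<i> * of_real (-t))) - z p) < \<epsilon>" .
  qed
qed

lemma cmul_powr:
  assumes "m > 0"
  shows "cmul (\<lambda>p. of_nat p powr s) m = of_nat m powr s"
proof -
  have "prod_mset (image_mset (\<lambda>p. of_nat p powr s) M) = of_nat (prod_mset M) powr s \<and> prod_mset M > 0"
    if "\<And>p. p \<in># M \<Longrightarrow> p > 0" for M :: "nat multiset"
    using that
  proof (induction M)
    case (add x M)
    hence IH: "prod_mset (image_mset (\<lambda>p. of_nat p powr s) M) = of_nat (prod_mset M) powr s" "prod_mset M > 0" "x > 0"
      by auto
    have "of_nat (x * prod_mset M) powr s = (of_real (real x) * of_real (real (prod_mset M))) powr s" by simp
    also have "\<dots> = of_nat x powr s * of_nat (prod_mset M) powr s"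
      by (subst powr_times_real) auto
    finally show ?case using IH by simp
  qed auto
  from this[of "prime_factorization m"] show ?thesis
    using assms by (auto simp: cmul_def in_prime_factors_iff prime_gt_0_nat prod_mset_prime_factorization_nat)
qed

section \<open>Dirichlet series as holomorphic functions on the half-plane Re s > 1\<close>

definition dirichlet :: "(nat \<Rightarrow> complex) \<Rightarrow> complex \<Rightarrow> complex" where
  "dirichlet c s = (\<Sum>\<^sub>\<infinity>m. c m * of_nat m powr (-s))"

lemma norm_nat_powr: "m > 0 \<Longrightarrow> norm (of_nat m powr s) = real m powr Re s"
  by (subst norm_powr_real_powr) auto

lemma norm_nat_powr_neg: "norm (of_nat m powr (-s)) = real m powr (- Re s)"
  by (cases "m = 0") (auto simp: norm_nat_powr)

lemma norm_imag_powr: "m > 0 \<Longrightarrow> norm (of_nat m powr (-(\<i> * of_real t))) = 1"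
  by (simp add: norm_nat_powr_neg)

text \<open>Bohr's correspondence: moving up the vertical line at abscissa \<sigma> traces a curve
  in the torus of unimodular twists.\<close>

lemma dser_twist:
  "dser c (\<lambda>p. of_nat p powr (-(\<i> * of_real t))) \<sigma> = dirichlet c (Complex \<sigma> t)"
  unfolding dser_def dirichlet_def
proof (rule infsum_cong)
  fix m :: nat
  show "c m * cmul (\<lambda>p. of_nat p powr - (\<i> * of_real t)) m * of_real (real m powr - \<sigma>)
     = c m * of_nat m powr (-Complex \<sigma> t)"
  proof (cases "m = 0")
    case False
    have "complex_of_real (real m powr -\<sigma>) = of_nat m powr of_real (-\<sigma>)" 
      by (subst powr_of_real[symmetric]) auto
    moreover have "-Complex \<sigma> t = -(\<i> * of_real t) + of_real (-\<sigma>)" by (simp add: complex_eq_iff)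
    ultimately show ?thesis using False by (simp only: cmul_powr powr_add) simp
  qed auto
qed

lemma dirichlet_summable: "(\<lambda>m. c m * of_nat m powr (-s)) summable_on UNIV"
  if "\<And>m. norm (c m) \<le> 1" "Re s > 1" for c :: "nat \<Rightarrow> complex"
proof -
  have "(\<lambda>m. norm (c m * of_nat m powr (-s))) summable_on UNIV"
    by (rule Infinite_Sum.abs_summable_on_comparison_test'[OF powr_summable_on[OF that(2)]])
       (use that in \<open>auto simp: norm_mult norm_nat_powr_neg intro!: mult_left_le_one_le\<close>)
  thus ?thesis by (rule abs_summable_summable)
qed

lemma norm_dirichlet_le:
  assumes "\<And>m. norm (c m) \<le> 1" "1 < x" "x \<le> Re s"
  shows "norm (dirichlet c s) \<le> (\<Sum>\<^sub>\<infinity>m::nat. real m powr -x)"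
  unfolding dirichlet_def
proof (rule norm_infsum_le[OF has_sum_infsum has_sum_infsum])
  fix m :: nat
  have "real m powr -Re s \<le> real m powr -x"
    using assms by (cases "m = 0") (auto intro!: powr_mono)
  thus "norm (c m * of_nat m powr (-s)) \<le> real m powr -x"
    using assms(1)[of m] mult_mono[OF assms(1)[of m], of "real m powr -Re s" "real m powr -x"]
    by (simp add: norm_mult norm_nat_powr_neg)
qed (use assms in \<open>auto intro!: dirichlet_summable powr_summable_on\<close>)

lemma dirichlet_holomorphic:
  assumes "\<And>m. norm (c m) \<le> 1"
  shows "dirichlet c holomorphic_on {s. Re s > 1}"
proof -
  have "\<exists>r>0. dirichlet c holomorphic_on ball s r" if s: "Re s > 1" for s
  proof -
    define r where "r = (Re s - 1) / 2"
    have r: "r > 0" using s by (simp add: r_def)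
    have Re: "Re w \<ge> 1 + r" if "w \<in> cball s r" for w
    proof -
      have "\<bar>Re s - Re w\<bar> \<le> r" using that abs_Re_le_cmod[of "s - w"] by (auto simp: dist_norm)
      thus ?thesis by (simp add: r_def field_simps abs_if split: if_splits)
    qed
    have U: "uniform_limit (cball s r) (\<lambda>X w. \<Sum>m\<in>X. c m * of_nat m powr (-w)) (dirichlet c) (finite_subsets_at_top UNIV)"
      unfolding dirichlet_def
    proof (rule Weierstrass_m_test_general)
      fix m :: nat and w assume "w \<in> cball s r"
      hence "real m powr -Re w \<le> real m powr -(1 + r)"
        using Re[of w] by (cases "m = 0") (auto intro!: powr_mono)
      thus "norm (c m * of_nat m powr (-w)) \<le> real m powr -(1 + r)"
        using mult_mono[OF assms[of m], of "real m powr -Re w" "real m powr -(1 + r)"]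
        by (simp add: norm_mult norm_nat_powr_neg)
    qed (rule powr_summable_on, use r in simp)
    have hol: "(\<lambda>w. c m * of_nat m powr (-w)) holomorphic_on A" for m A
      by (cases "m = 0") (auto intro!: holomorphic_intros)
    have "(\<lambda>w. \<Sum>m\<in>X. c m * of_nat m powr (-w)) holomorphic_on A" for X A
      by (intro holomorphic_on_sum hol)
    hence "\<forall>\<^sub>F X in finite_subsets_at_top UNIV. continuous_on (cball s r) (\<lambda>w. \<Sum>m\<in>X. c m * of_nat m powr (-w)) \<and>
        (\<lambda>w. \<Sum>m\<in>X. c m * of_nat m powr (-w)) holomorphic_on ball s r"
      by (auto intro!: always_eventually holomorphic_on_imp_continuous_on)
    from holomorphic_uniform_limit[OF this U] have "dirichlet c holomorphic_on ball s r" by auto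
    thus ?thesis using r by blast
  qed
  hence "\<forall>s\<in>{s. Re s > 1}. dirichlet c field_differentiable at s within {s. Re s > 1}"
    by (metis centre_in_ball field_differentiable_at_within holomorphic_on_imp_differentiable_at mem_Collect_eq open_ball)
  thus ?thesis by (simp add: holomorphic_on_def)
qed

text \<open>Because q \<ge> k, the progression k, k + q, k + 2 q, ... grows at least as fast as k, 2
  k, 3 k, ..., so far enough to the right the first term dominates. The locale serves both the Lerch
  coefficients and the inner sums over smooth numbers in \<open>Phi_lower_bound\<close>.\<close>

locale lacunary =
  fixes c :: "nat \<Rightarrow> complex" and k q :: nat
  assumes norm_c: "norm (c m) \<le> 1"
    and k: "1 \<le> k" "k \<le> q"
    and supp: "c m \<noteq> 0 \<Longrightarrow> \<exists>j. m = k + j * q"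
    and lead: "norm (c k) = 1"
begin

text \<open>Relative to the first term, the remaining ones are at most the sum of
  \<open>1 / (j + 2)^3\<close>. This is compared with
  \<open>1 / ((j + 1) * (j + 2) * (j + 3))\<close>, which telescopes to 1/4.\<close>

lemma norm_dirichlet_ge:
  assumes "Re s \<ge> 3"
  shows "norm (dirichlet c s) \<ge> real k powr (-Re s) / 2"
proof -
  let ?f = "\<lambda>m. c m * of_nat m powr (-s)"
  have S: "?f summable_on UNIV" using norm_c assms by (intro dirichlet_summable) auto
  define R where "R = infsum ?f (UNIV - {k})"
  have eq: "dirichlet c s = ?f k + R"
  proof -
    have "infsum ?f (insert k (UNIV - {k})) = ?f k + R"
      unfolding R_def by (subst infsum_insert) (auto intro: summable_on_subset_banach[OF S])
    thus ?thesis by (simp add: dirichlet_def insert_UNIV)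
  qed
  let ?h = "\<lambda>j. k + (j + 1) * q"
  have "norm R \<le> real k powr (-Re s) * (1 / 4)"
  proof (rule norm_infsum_le)
    have "(?f has_sum R) (UNIV - {k})"
      unfolding R_def by (intro has_sum_infsum summable_on_subset_banach[OF S]) auto
    also have "?this \<longleftrightarrow> (?f has_sum R) (range ?h)"
    proof (rule has_sum_cong_neutral)
      fix m assume m: "m \<in> UNIV - {k} - range ?h"
      show "?f m = 0"
      proof (rule ccontr)
        assume "?f m \<noteq> 0"
        then obtain j where j: "m = k + j * q" using supp by fastforce
        with m have "j \<noteq> 0" by (intro notI) auto
        with j have "m = ?h (j - 1)" by simp
        with m show False by blast
      qed
    qed (use k in auto)
    also have "\<dots> \<longleftrightarrow> ((?f \<circ> ?h) has_sum R) UNIV"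
      using k by (intro has_sum_reindex) (auto simp: inj_on_def)
    finally show "((?f \<circ> ?h) has_sum R) UNIV" .
  next
    have "(\<lambda>n. (1 / 2) / ((real n + 1) * (real n + 2))) \<longlonglongrightarrow> 0" by real_asymp
    from telescope_sums'[OF this]
    have "(\<lambda>n. (1 / 2) / ((real n + 1) * (real n + 2)) - (1 / 2) / ((real (Suc n) + 1) * (real (Suc n) + 2))) sums (1 / 4)"
      by simp
    also have "(\<lambda>n. (1 / 2) / ((real n + 1) * (real n + 2)) - (1 / 2) / ((real (Suc n) + 1) * (real (Suc n) + 2)))
       = (\<lambda>n. 1 / ((real n + 1) * (real n + 2) * (real n + 3)))"
    proof
      fix n
      have "real n + 1 > 0" "real n + 2 > 0" "real n + 3 > 0" by auto
      thus "(1 / 2) / ((real n + 1) * (real n + 2)) - (1 / 2) / ((real (Suc n) + 1) * (real (Suc n) + 2))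
         = 1 / ((real n + 1) * (real n + 2) * (real n + 3))"
        by (simp add: divide_simps add_ac)
    qed
    finally have "((\<lambda>n. 1 / ((real n + 1) * (real n + 2) * (real n + 3))) has_sum (1 / 4)) UNIV"
      by (intro sums_nonneg_imp_has_sum) auto
    thus "((\<lambda>n. real k powr (-Re s) * (1 / ((real n + 1) * (real n + 2) * (real n + 3)))) has_sum real k powr (-Re s) * (1 / 4)) UNIV"
      by (rule has_sum_cmult_right)
  next
    fix j :: nat
    have "k * (j + 2) \<le> ?h j" using k by (simp add: algebra_simps) (metis add_mono le_refl mult_le_mono1 mult.commute)
    hence *: "real k * real (j + 2) \<le> real (?h j)" by (metis of_nat_mult of_nat_mono)
    have "norm ((?f \<circ> ?h) j) \<le> 1 * real (?h j) powr (-Re s)"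
      unfolding o_def norm_mult norm_nat_powr_neg by (intro mult_mono norm_c) auto
    also have "\<dots> \<le> (real k * real (j + 2)) powr (-Re s)"
      using * k assms by (simp, intro powr_mono2') auto
    also have "\<dots> = real k powr (-Re s) * real (j + 2) powr (-Re s)" by (simp add: powr_mult)
    also have "\<dots> \<le> real k powr (-Re s) * real (j + 2) powr (-3)"
      using assms by (intro mult_left_mono powr_mono) auto
    also have "real (j + 2) powr (-3) = 1 / real (j + 2) ^ 3" by (simp add: powr_minus powr_numeral divide_simps)
    also have "\<dots> \<le> 1 / ((real j + 1) * (real j + 2) * (real j + 3))"
      by (intro divide_left_mono mult_pos_pos zero_less_power) (auto simp: power3_eq_cube algebra_simps)
    finally show "norm ((?f \<circ> ?h) j) \<le> real k powr (-Re s) * (1 / ((real j + 1) * (real j + 2) * (real j + 3)))"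
      by (simp add: mult_left_mono)
  qed
  moreover have "norm (?f k) = real k powr (-Re s)" by (simp add: norm_mult lead norm_nat_powr_neg)
  ultimately have "real k powr (-Re s) - real k powr (-Re s) * (1/4) \<le> norm (?f k) - norm R" by simp
  also have "\<dots> \<le> norm (dirichlet c s)" unfolding eq using norm_diff_ineq[of "?f k" R] by simp
  finally show ?thesis using powr_ge_zero[of "real k" "-Re s"] by linarith
qed

text \<open>
  Along a sequence of vertical shifts on which the series tends to zero, Montel yields a limit
  function with a zero; by Hurwitz it would have to vanish identically, which the leading term
  forbids at \<open>s = 3\<close>.
\<close>

lemma zero_free_lower_bound:
  assumes zf: "\<And>s. 1 < Re s \<Longrightarrow> Re s < 1 + \<eta> \<Longrightarrow> dirichlet c s \<noteq> 0"
    and \<sigma>: "1 < \<sigma>1" "\<sigma>1 \<le> \<sigma>0" "\<sigma>0 < 1 + \<eta>"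
  obtains \<delta> where "\<delta> > 0" "\<And>\<sigma> t. \<sigma>1 \<le> \<sigma> \<Longrightarrow> \<sigma> \<le> \<sigma>0 \<Longrightarrow> norm (dirichlet c (Complex \<sigma> t)) \<ge> \<delta>"
proof (rule ccontr)
  assume "\<not> thesis"
  hence "\<exists>\<sigma> t. \<sigma>1 \<le> \<sigma> \<and> \<sigma> \<le> \<sigma>0 \<and> norm (dirichlet c (Complex \<sigma> t)) < 1 / real (Suc n)" for n
    using that[of "1 / real (Suc n)"] by (force simp: not_le)
  then obtain x t where xt: "\<And>n. \<sigma>1 \<le> x n" "\<And>n. x n \<le> \<sigma>0"
    "\<And>n. norm (dirichlet c (Complex (x n) (t n))) < 1 / real (Suc n)" by metis
  define S where "S = {s. Re s > 1}"
  \<comment> \<open>Two domains are needed: the absence of zeros is given only in the strip, while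
    the leading term can be seen only further right, at 3. The limit function is therefore taken on
    the whole half-plane.\<close>
  define S' where "S' = {s. 1 < Re s \<and> Re s < 1 + \<eta>}"
  define F where "F = (\<lambda>n s. dirichlet c (s + \<i> * of_real (t n)))"
  have S: "open S" "connected S" unfolding S_def
    by (auto simp: open_halfspace_Re_gt intro: convex_connected convex_halfspace_Re_gt)
  have S': "open S'" "connected S'" "S' \<subseteq> S"
  proof -
    have "S' = {s. Re s > 1} \<inter> {s. Re s < 1 + \<eta>}" by (auto simp: S'_def)
    thus "open S'" "connected S'"
      by (auto intro!: open_Int open_halfspace_Re_gt open_halfspace_Re_lt convex_connected convex_Int
          convex_halfspace_Re_gt convex_halfspace_Re_lt)
  qed (auto simp: S'_def S_def)
  \<comment> \<open>A normal family containing all vertical shifts: the bound depends on the real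
    part alone.\<close>
  define H where "H = {h. h holomorphic_on S \<and> (\<forall>y>1. \<forall>s. Re s \<ge> y \<longrightarrow> norm (h s) \<le> (\<Sum>\<^sub>\<infinity>m::nat. real m powr -y))}"
  have FH: "F n \<in> H" for n
  proof -
    have "dirichlet c holomorphic_on (\<lambda>s. s + \<i> * of_real (t n)) ` S"
      by (rule holomorphic_on_subset[OF dirichlet_holomorphic]) (auto simp: S_def norm_c)
    hence "F n holomorphic_on S"
      unfolding F_def by (intro holomorphic_on_compose_gen[of "\<lambda>s. s + \<i> * of_real (t n)" S "dirichlet c", unfolded o_def])
        (auto intro!: holomorphic_intros)
    moreover have "norm (F n s) \<le> (\<Sum>\<^sub>\<infinity>m::nat. real m powr -y)" if "y > 1" "Re s \<ge> y" for y s
      unfolding F_def by (rule norm_dirichlet_le) (use that norm_c in auto)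
    ultimately show ?thesis by (auto simp: H_def)
  qed
  obtain g r where gr: "g holomorphic_on S" "strict_mono r"
      "\<And>x. x \<in> S \<Longrightarrow> (\<lambda>n. F (r n) x) \<longlonglongrightarrow> g x"
      "\<And>K. compact K \<Longrightarrow> K \<subseteq> S \<Longrightarrow> uniform_limit K (F \<circ> r) g sequentially"
  proof (rule Montel[of S H F])
    fix K assume K: "compact K" "K \<subseteq> S"
    show "\<exists>B. \<forall>h\<in>H. \<forall>z\<in>K. norm (h z) \<le> B"
    proof (cases "K = {}")
      case False
      then obtain s0 where s0: "s0 \<in> K" "\<And>s. s \<in> K \<Longrightarrow> Re s0 \<le> Re s"
        using continuous_attains_inf[OF K(1) False, of Re] continuous_on_Re[OF continuous_on_id, of K] by blast
      with K have "Re s0 > 1" by (auto simp: S_def)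
      with s0 show ?thesis by (intro exI[of _ "\<Sum>\<^sub>\<infinity>m::nat. real m powr -Re s0"]) (auto simp: H_def)
    qed auto
  qed (use S FH in \<open>auto simp: H_def\<close>)
  \<comment> \<open>The shift by \<open>t n\<close> moves the points with small values onto this
    fixed compact segment.\<close>
  define K where "K = complex_of_real ` {\<sigma>1..\<sigma>0}"
  have K: "compact K" "K \<subseteq> S'" "K \<subseteq> S" "K \<noteq> {}"
    using \<sigma> unfolding K_def S'_def S_def by (auto intro!: compact_continuous_image continuous_intros)
  have gnz: "g s \<noteq> 0" if "s \<in> K" for s
  proof (cases "g constant_on S'")
    case False
    show ?thesis
    proof (rule Hurwitz_no_zeros[OF S'(1,2), of "F \<circ> r" g])
      fix n show "(F \<circ> r) n holomorphic_on S'"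
        using FH[of "r n"] S'(3) by (auto simp: H_def intro: holomorphic_on_subset)
      show "(F \<circ> r) n z \<noteq> 0" if "z \<in> S'" for z
        using that zf by (auto simp: F_def S'_def)
    qed (use gr S' False K that holomorphic_on_subset in auto)
  next
    case True
    then obtain v where v: "\<And>s. s \<in> S' \<Longrightarrow> g s = v" by (auto simp: constant_on_def)
    have three: "(3::complex) \<in> S" by (simp add: S_def)
    have "g 3 = v"
      by (rule analytic_continuation_open[OF S'(1) S(1) _ S(2) S'(3) gr(1), of "\<lambda>_. v"])
         (use K v three in auto)
    moreover have "norm (g 3) \<ge> real k powr (-3) / 2"
    proof (rule tendsto_lowerbound)
      show "(\<lambda>n. norm (F (r n) 3)) \<longlonglongrightarrow> norm (g 3)"
        by (intro tendsto_norm gr(3) three)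
      show "\<forall>\<^sub>F n in sequentially. real k powr (-3) / 2 \<le> norm (F (r n) 3)"
        using norm_dirichlet_ge[of "3 + \<i> * of_real (t (r n))" for n] unfolding F_def by (intro always_eventually allI) simp
    qed auto
    moreover have "real k powr (-3) > 0" using k by simp
    ultimately show ?thesis using v that K by force
  qed
  have "continuous_on K (\<lambda>s. norm (g s))"
    using gr(1) K(3) by (intro continuous_intros holomorphic_on_imp_continuous_on) (auto intro: holomorphic_on_subset)
  then obtain s0 where s0: "s0 \<in> K" "\<And>s. s \<in> K \<Longrightarrow> norm (g s0) \<le> norm (g s)"
    using continuous_attains_inf[OF K(1,4)] by blast
  define d where "d = norm (g s0)"
  have d: "d > 0" using gnz s0 by (simp add: d_def)
  have "\<forall>\<^sub>F n in sequentially. \<forall>s\<in>K. dist ((F \<circ> r) n s) (g s) < d / 2"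
    using uniform_limitD[OF gr(4)[OF K(1,3)], of "d / 2"] d by simp
  moreover have "\<forall>\<^sub>F n in sequentially. 1 / real (Suc n) < d / 2"
    using order_tendstoD(2)[OF LIMSEQ_inverse_real_of_nat, of "d/2"] d by (simp add: inverse_eq_divide)
  ultimately have "\<forall>\<^sub>F n in sequentially. False"
  proof eventually_elim
    case (elim n)
    have xK: "of_real (x (r n)) \<in> K" using xt by (auto simp: K_def)
    have "n \<le> r n" using gr(2) by (rule strict_mono_imp_increasing)
    hence "1 / real (Suc (r n)) \<le> 1 / real (Suc n)" by (simp add: divide_simps)
    moreover have "(F \<circ> r) n (of_real (x (r n))) = dirichlet c (Complex (x (r n)) (t (r n)))"
      by (simp add: F_def Complex_eq)
    ultimately have "norm ((F \<circ> r) n (of_real (x (r n)))) < d / 2" using xt(3)[of "r n"] elim(2) by simp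
    moreover have "norm (g (of_real (x (r n)))) \<ge> d" using s0 xK by (auto simp: d_def)
    moreover have "dist ((F \<circ> r) n (of_real (x (r n)))) (g (of_real (x (r n)))) < d / 2" using elim(1) xK by blast
    ultimately show False by norm
  qed
  thus False by simp
qed

text \<open>Kronecker's theorem makes every unimodular z, prime by prime, a limit of vertical
  shifts. Tannery's theorem (dominated convergence) passes to the limit in the series, and the lower
  bound survives.\<close>

lemma torus_lower_bound:
  assumes "\<And>t. norm (dirichlet c (Complex \<sigma> t)) \<ge> \<delta>" "\<sigma> > 1"
    and z: "\<And>p. prime p \<Longrightarrow> norm (z p) = 1"
  shows "norm (dser c z \<sigma>) \<ge> \<delta>"
proof -
  have "\<exists>t. \<forall>p. prime p \<longrightarrow> p \<le> N \<longrightarrow> norm (of_nat p powr (-(\<i> * of_real t)) - z p) < 1 / real (Suc N)" for N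
    using prime_twist_approx[of z "1 / real (Suc N)" N] z by (metis divide_pos_pos of_nat_0_less_iff zero_less_Suc zero_less_one)
  then obtain t where t: "\<And>N p. prime p \<Longrightarrow> p \<le> N \<Longrightarrow> norm (of_nat p powr (-(\<i> * of_real (t N))) - z p) < 1 / real (Suc N)"
    by metis
  define y where "y = (\<lambda>N p. of_nat p powr (-(\<i> * of_real (t N))) :: complex)"
  have y: "norm (y N p) = 1" if "prime p" for N p
    using that prime_gt_0_nat unfolding y_def by (intro norm_imag_powr) auto
  have lim: "(\<lambda>N. y N p) \<longlonglongrightarrow> z p" if "prime p" for p
  proof (rule metric_tendsto_imp_tendsto[OF LIMSEQ_inverse_real_of_nat])
    show "\<forall>\<^sub>F N in sequentially. dist (y N p) (z p) \<le> dist (inverse (real (Suc N))) 0"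
      using eventually_ge_at_top[of p]
      by eventually_elim (use t[OF that] in \<open>simp add: y_def dist_norm inverse_eq_divide less_imp_le\<close>)
  qed
  have limc: "(\<lambda>N. cmul (y N) m) \<longlonglongrightarrow> cmul z m" for m
  proof -
    have "(\<lambda>N. prod_mset (image_mset (y N) M)) \<longlonglongrightarrow> prod_mset (image_mset z M)" if "\<And>p. p \<in># M \<Longrightarrow> prime p" for M
      using that by (induction M) (auto intro!: tendsto_mult lim)
    thus ?thesis unfolding cmul_def by (auto intro: in_prime_factors_imp_prime)
  qed
  have sums: "(\<Sum>m. c m * cmul w m * of_real (real m powr -\<sigma>)) = dser c w \<sigma>" if "\<And>p. prime p \<Longrightarrow> norm (w p) = 1" for w
    unfolding dser_def using dser_summable[of c 1 w \<sigma>] that assms(2) norm_c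
    by (intro sums_unique[symmetric] has_sum_imp_sums has_sum_infsum) (auto intro: order.refl)
  have "(\<lambda>N. \<Sum>m. c m * cmul (y N) m * of_real (real m powr -\<sigma>)) \<longlonglongrightarrow> (\<Sum>m. c m * cmul z m * of_real (real m powr -\<sigma>))"
  proof (rule conjunct2[OF conjunct2[OF tannerys_theorem]])
    show "(\<lambda>N. c m * cmul (y N) m * of_real (real m powr -\<sigma>)) \<longlonglongrightarrow> c m * cmul z m * of_real (real m powr -\<sigma>)" for m
      by (intro tendsto_intros limc)
    show "summable (\<lambda>m. real m powr -\<sigma>)" using assms(2) by (simp add: summable_real_powr_iff)
    show "\<forall>\<^sub>F (m, N) in at_top \<times>\<^sub>F sequentially. norm (c m * cmul (y N) m * of_real (real m powr -\<sigma>)) \<le> real m powr -\<sigma>"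
      using dser_term_bound[of c _ 1 "y _" \<sigma>] norm_c y by (intro always_eventually) (auto simp: less_imp_le)
  qed auto
  hence "(\<lambda>N. dser c (y N) \<sigma>) \<longlonglongrightarrow> dser c z \<sigma>" using sums y z by simp
  hence "(\<lambda>N. norm (dser c (y N) \<sigma>)) \<longlonglongrightarrow> norm (dser c z \<sigma>)" by (rule tendsto_norm)
  moreover have "\<forall>\<^sub>F N in sequentially. norm (dser c (y N) \<sigma>) \<ge> \<delta>"
    unfolding y_def dser_twist using assms(1) by auto
  ultimately show ?thesis by (rule tendsto_lowerbound) auto
qed

end

section \<open>From the torus to the polydisc\<close>

lemma max_modulus_disc:
  fixes f :: "complex \<Rightarrow> complex"
  assumes "continuous_on (cball 0 1) f" "f holomorphic_on ball 0 1" "norm w \<le> 1"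
  obtains v where "norm v = 1" "norm (f w) \<le> norm (f v)"
proof -
  have "continuous_on (sphere 0 1) (\<lambda>v. norm (f v))"
    by (intro continuous_intros continuous_on_subset[OF assms(1)]) auto
  moreover have "sphere (0::complex) 1 \<noteq> {}" using norm_one by (metis empty_iff mem_sphere_0)
  ultimately obtain v where v: "v \<in> sphere 0 1" "\<And>u. u \<in> sphere 0 1 \<Longrightarrow> norm (f u) \<le> norm (f v)"
    using continuous_attains_sup[of "sphere 0 1" "\<lambda>v. norm (f v)"] compact_sphere by blast
  have "norm (f w) \<le> norm (f v)"
    by (rule maximum_modulus_frontier[of f "cball 0 1"]) (use assms v in auto)
  thus ?thesis using v that by auto
qed

text \<open>The coordinates in T are moved to the unit circle one at a time, each by the
  one-variable maximum principle. Z is the domain within which G stays holomorphic in each of these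
  variables; for a reciprocal this is where the series does not vanish.\<close>

lemma max_modulus_polydisc:
  fixes G :: "(nat \<Rightarrow> complex) \<Rightarrow> complex"
  assumes "finite T"
    and upd: "\<And>z p w. z \<in> Z \<Longrightarrow> p \<in> T \<Longrightarrow> norm w \<le> 1 \<Longrightarrow> z(p := w) \<in> Z"
    and cont: "\<And>z p. z \<in> Z \<Longrightarrow> p \<in> T \<Longrightarrow> continuous_on (cball 0 1) (\<lambda>w. G (z(p := w)))"
    and hol: "\<And>z p. z \<in> Z \<Longrightarrow> p \<in> T \<Longrightarrow> (\<lambda>w. G (z(p := w))) holomorphic_on ball 0 1"
    and z: "z \<in> Z" "\<And>p. p \<in> T \<Longrightarrow> norm (z p) \<le> 1"
  obtains z' where "z' \<in> Z" "\<And>p. p \<in> T \<Longrightarrow> norm (z' p) = 1" "\<And>p. p \<notin> T \<Longrightarrow> z' p = z p"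
    "norm (G z) \<le> norm (G z')"
proof -
  have "\<exists>z'\<in>Z. (\<forall>p\<in>T. norm (z' p) = 1) \<and> (\<forall>p. p \<notin> T \<longrightarrow> z' p = z p) \<and> norm (G z) \<le> norm (G z')"
    using assms
  proof (induction T arbitrary: z rule: finite_induct)
    case (insert p T)
    have "\<exists>z'\<in>Z. (\<forall>p\<in>T. norm (z' p) = 1) \<and> (\<forall>p. p \<notin> T \<longrightarrow> z' p = z p) \<and> norm (G z) \<le> norm (G z')"
      using insert.prems by (intro insert.IH) auto
    then obtain z' where z': "z' \<in> Z" "\<And>p. p \<in> T \<Longrightarrow> norm (z' p) = 1" "\<And>p. p \<notin> T \<Longrightarrow> z' p = z p"
      "norm (G z) \<le> norm (G z')" by blast
    have "norm (z' p) \<le> 1" using z'(3)[OF insert.hyps(2)] insert.prems by simp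
    then obtain v where v: "norm v = 1" "norm (G (z'(p := z' p))) \<le> norm (G (z'(p := v)))"
      using max_modulus_disc[of "\<lambda>w. G (z'(p := w))" "z' p"] insert.prems z'(1) by blast
    show ?case
    proof (intro bexI conjI ballI allI impI)
      show "z'(p := v) \<in> Z" by (rule insert.prems(1)) (use z' v in auto)
      show "norm (G z) \<le> norm (G (z'(p := v)))" using v z'(4) by simp
      show "norm ((z'(p := v)) p') = 1" if "p' \<in> insert p T" for p' using that v z' by auto
      show "(z'(p := v)) p' = z p'" if "p' \<notin> insert p T" for p' using that z' by auto
    qed
  qed auto
  thus ?thesis using that by blast
qed

lemma dser_scale:
  "dser c (\<lambda>p. if p \<in> P then w * u p else y p) \<sigma> =
     (\<Sum>\<^sub>\<infinity>m. (c m * cmul (\<lambda>p. if p \<in> P then u p else y p) m * of_real (real m powr -\<sigma>)) * w ^ Omega_in P m)"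
  unfolding dser_def cmul_scale by (intro infsum_cong) (simp add: mult_ac)

lemma dser_disc:
  assumes "\<And>m. norm (c m) \<le> C" "\<And>p. prime p \<Longrightarrow> p \<notin> P \<Longrightarrow> norm (y p) \<le> 1"
    "\<And>p. prime p \<Longrightarrow> p \<in> P \<Longrightarrow> norm (u p) \<le> 1" "\<sigma> > 1"
  shows "continuous_on (cball 0 1) (\<lambda>w. dser c (\<lambda>p. if p \<in> P then w * u p else y p) \<sigma>)"
    and "(\<lambda>w. dser c (\<lambda>p. if p \<in> P then w * u p else y p) \<sigma>) holomorphic_on ball 0 1"
    and "(deriv ^^ j) (\<lambda>w. dser c (\<lambda>p. if p \<in> P then w * u p else y p) \<sigma>) 0 = fact j *
      (\<Sum>\<^sub>\<infinity>m\<in>{m. Omega_in P m = j}. c m * cmul (\<lambda>p. if p \<in> P then u p else y p) m * of_real (real m powr -\<sigma>))"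
proof -
  have S: "(\<lambda>m. norm (c m * cmul (\<lambda>p. if p \<in> P then u p else y p) m * of_real (real m powr -\<sigma>))) summable_on UNIV"
    by (rule dser_abs_summable) (use assms in auto)
  show "continuous_on (cball 0 1) (\<lambda>w. dser c (\<lambda>p. if p \<in> P then w * u p else y p) \<sigma>)"
    "(\<lambda>w. dser c (\<lambda>p. if p \<in> P then w * u p else y p) \<sigma>) holomorphic_on ball 0 1"
    "(deriv ^^ j) (\<lambda>w. dser c (\<lambda>p. if p \<in> P then w * u p else y p) \<sigma>) 0 = fact j *
      (\<Sum>\<^sub>\<infinity>m\<in>{m. Omega_in P m = j}. c m * cmul (\<lambda>p. if p \<in> P then u p else y p) m * of_real (real m powr -\<sigma>))"
    unfolding dser_scale by (rule weighted_power_sum[OF S] weighted_power_sum_derivs[OF S])+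
qed

text \<open>The bound C is kept general because the lemma is also applied to coefficients of size
  \<open>weight \<sigma>\<close>.\<close>

lemma dser_fun_upd:
  assumes "\<And>m. norm (c m) \<le> C" "\<And>p. prime p \<Longrightarrow> norm (z p) \<le> 1" "\<sigma> > 1"
  shows "continuous_on (cball 0 1) (\<lambda>w. dser c (z(p := w)) \<sigma>)"
    and "(\<lambda>w. dser c (z(p := w)) \<sigma>) holomorphic_on ball 0 1"
proof -
  have eq: "z(p := w) = (\<lambda>q. if q \<in> {p} then w * (\<lambda>_. 1) q else z q)" for w by auto
  show "continuous_on (cball 0 1) (\<lambda>w. dser c (z(p := w)) \<sigma>)"
    "(\<lambda>w. dser c (z(p := w)) \<sigma>) holomorphic_on ball 0 1"
    unfolding eq by (rule dser_disc[of c C]; use assms in auto)+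
qed

text \<open>The constant is uniform in c and z, so one step length in \<sigma> works for the whole
  polydisc.\<close>

lemma dser_lipschitz:
  assumes "1 < x"
  obtains \<Lambda> where "\<Lambda> \<ge> 0" "\<And>c z \<sigma> \<sigma>'. (\<And>m. norm (c m) \<le> 1) \<Longrightarrow> (\<And>p. prime p \<Longrightarrow> norm (z p) \<le> 1) \<Longrightarrow>
     x \<le> \<sigma> \<Longrightarrow> x \<le> \<sigma>' \<Longrightarrow> norm (dser c z \<sigma> - dser c z \<sigma>') \<le> \<Lambda> * \<bar>\<sigma> - \<sigma>'\<bar>"
proof -
  \<comment> \<open>The derivative in \<sigma> brings in a factor \<open>ln m\<close>, which is
    absorbed by \<open>m powr \<kappa> / \<kappa>\<close>; half the distance from x to 1 leaves the
    exponent x - \<kappa> above 1.\<close>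
  define \<kappa> where "\<kappa> = (x - 1) / 2"
  have \<kappa>: "\<kappa> > 0" "x - \<kappa> > 1" using assms by (auto simp: \<kappa>_def field_simps)
  define \<Lambda> where "\<Lambda> = (\<Sum>\<^sub>\<infinity>m::nat. real m powr -(x - \<kappa>)) / \<kappa>"
  have aux: "real m powr -\<sigma> - real m powr -\<sigma>' \<le> (\<sigma>' - \<sigma>) * (real m powr -(x - \<kappa>) / \<kappa>)"
    if "x \<le> \<sigma>" "\<sigma> \<le> \<sigma>'" for m \<sigma> \<sigma>'
  proof (cases "m = 0")
    case False
    have "ln (real m powr \<kappa>) \<le> real m powr \<kappa>" using False ln_le_minus_one[of "real m powr \<kappa>"] by simp
    hence ln: "ln (real m) \<le> real m powr \<kappa> / \<kappa>" using False \<kappa> by (simp add: ln_powr field_simps)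
    have "real m powr -\<sigma> - real m powr -\<sigma>' = real m powr -\<sigma> * (1 - real m powr -(\<sigma>' - \<sigma>))"
      using False by (simp add: algebra_simps flip: powr_add)
    also have "1 - real m powr -(\<sigma>' - \<sigma>) \<le> (\<sigma>' - \<sigma>) * ln (real m)"
      using False exp_ge_add_one_self[of "-(\<sigma>' - \<sigma>) * ln (real m)"] by (simp add: powr_def algebra_simps)
    also have "\<dots> \<le> (\<sigma>' - \<sigma>) * (real m powr \<kappa> / \<kappa>)" using ln that by (intro mult_left_mono) auto
    also have "real m powr -\<sigma> * \<dots> \<le> real m powr -x * \<dots>"
      using that False \<kappa> by (intro mult_right_mono powr_mono) auto
    also have "\<dots> = (\<sigma>' - \<sigma>) * (real m powr -(x - \<kappa>) / \<kappa>)"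
      using False by (simp add: field_simps flip: powr_add)
    finally show ?thesis by (simp add: mult_left_mono)
  qed auto
  show ?thesis
  proof (rule that[of \<Lambda>])
    show "\<Lambda> \<ge> 0" unfolding \<Lambda>_def using \<kappa> by (auto intro!: divide_nonneg_pos infsum_nonneg)
    fix c z :: "nat \<Rightarrow> complex" and \<sigma> \<sigma>' :: real
    assume a: "\<And>m::nat. norm (c m :: complex) \<le> 1" "\<And>p. prime p \<Longrightarrow> norm (z p :: complex) \<le> 1" "x \<le> \<sigma>" "x \<le> \<sigma>'"
    show "norm (dser c z \<sigma> - dser c z \<sigma>') \<le> \<Lambda> * \<bar>\<sigma> - \<sigma>'\<bar>"
    proof (rule norm_infsum_le)
      let ?t = "\<lambda>\<sigma> m. c m * cmul z m * of_real (real m powr -\<sigma>)"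
      show "((\<lambda>m. ?t \<sigma> m - ?t \<sigma>' m) has_sum (dser c z \<sigma> - dser c z \<sigma>')) UNIV"
        unfolding dser_def using a assms
        by (intro has_sum_minus has_sum_infsum dser_summable[of c 1 z]) auto
      have "((\<lambda>m::nat. real m powr -(x - \<kappa>)) has_sum (\<Lambda> * \<kappa>)) UNIV"
        unfolding \<Lambda>_def using \<kappa> powr_summable_on[OF \<kappa>(2)] by (auto intro!: has_sum_infsum)
      hence "((\<lambda>m::nat. \<bar>\<sigma> - \<sigma>'\<bar> / \<kappa> * real m powr -(x - \<kappa>)) has_sum (\<bar>\<sigma> - \<sigma>'\<bar> / \<kappa> * (\<Lambda> * \<kappa>))) UNIV"
        by (rule has_sum_cmult_right)
      thus "((\<lambda>m::nat. \<bar>\<sigma> - \<sigma>'\<bar> / \<kappa> * real m powr -(x - \<kappa>)) has_sum (\<Lambda> * \<bar>\<sigma> - \<sigma>'\<bar>)) UNIV"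
        using \<kappa> by (simp add: mult_ac)
      fix m
      have "norm (?t \<sigma> m - ?t \<sigma>' m) = norm (c m) * norm (cmul z m) * \<bar>real m powr -\<sigma> - real m powr -\<sigma>'\<bar>"
        by (simp flip: of_real_diff right_diff_distrib add: norm_mult)
      also have "\<dots> \<le> 1 * 1 * \<bar>real m powr -\<sigma> - real m powr -\<sigma>'\<bar>"
        using a norm_cmul_le_1[of z m] by (intro mult_mono) auto
      also have "\<dots> \<le> \<bar>\<sigma> - \<sigma>'\<bar> / \<kappa> * real m powr -(x - \<kappa>)"
      proof (cases "\<sigma> \<le> \<sigma>'")
        case True
        have "real m powr -\<sigma> \<ge> real m powr -\<sigma>'" using True by (cases "m = 0") (auto intro!: powr_mono)
        thus ?thesis using aux[OF a(3) True, of m] True by (simp add: algebra_simps)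
      next
        case False
        have "real m powr -\<sigma> \<le> real m powr -\<sigma>'" using False by (cases "m = 0") (auto intro!: powr_mono)
        thus ?thesis using aux[OF a(4), of \<sigma> m] False by (simp add: algebra_simps)
      qed
      finally show "norm (?t \<sigma> m - ?t \<sigma>' m) \<le> \<bar>\<sigma> - \<sigma>'\<bar> / \<kappa> * real m powr -(x - \<kappa>)" .
    qed
  qed
qed

text \<open>
  Only finitely many primes, those up to \<open>P0\<close>, have to stay on the unit circle, uniformly in \<open>\<sigma>\<close>.
  At \<open>\<sigma>0\<close> this holds because the tail of the series is small. If the series has no zero on the
  polydisc for some \<open>\<sigma>\<close>, the maximum principle for its reciprocal improves this to the lower
  bound \<open>\<delta>\<close> known on the torus, so that \<open>\<sigma>\<close> can be decreased by a fixed step.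
\<close>

lemma polydisc_zero_free:
  assumes c: "\<And>m. norm (c m) \<le> 1"
    and \<sigma>0: "1 < \<sigma>0"
    and low: "\<And>\<sigma>1. 1 < \<sigma>1 \<Longrightarrow> \<sigma>1 \<le> \<sigma>0 \<Longrightarrow> \<exists>\<delta>>0. \<forall>\<sigma> z. \<sigma>1 \<le> \<sigma> \<longrightarrow> \<sigma> \<le> \<sigma>0 \<longrightarrow>
       (\<forall>p. prime p \<longrightarrow> norm (z p) = 1) \<longrightarrow> norm (dser c z \<sigma>) \<ge> \<delta>"
  obtains P0 where "P0 \<ge> q" "\<And>\<sigma> z. 1 < \<sigma> \<Longrightarrow> \<sigma> \<le> \<sigma>0 \<Longrightarrow> (\<And>p. prime p \<Longrightarrow> p \<le> P0 \<Longrightarrow> norm (z p) = 1) \<Longrightarrow>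
    (\<And>p. prime p \<Longrightarrow> p > P0 \<Longrightarrow> norm (z p) \<le> 1) \<Longrightarrow> dser c z \<sigma> \<noteq> 0"
proof -
  obtain \<delta>0 where \<delta>0: "\<delta>0 > 0" "\<And>z. (\<And>p. prime p \<Longrightarrow> norm (z p) = 1) \<Longrightarrow> norm (dser c z \<sigma>0) \<ge> \<delta>0"
    using low[OF \<sigma>0 order.refl] by auto
  obtain N where N: "(\<Sum>\<^sub>\<infinity>m\<in>{N<..}. real m powr -\<sigma>0) < \<delta>0 / 4"
    using powr_tail_small[OF \<sigma>0, of "\<delta>0 / 4"] \<delta>0 by auto
  define P0 where "P0 = max N q"
  define Z where "Z = {z :: nat \<Rightarrow> complex. (\<forall>p. prime p \<longrightarrow> p \<le> P0 \<longrightarrow> norm (z p) = 1) \<and> (\<forall>p. prime p \<longrightarrow> p > P0 \<longrightarrow> norm (z p) \<le> 1)}"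
  have Z1: "norm (z p) \<le> 1" if "z \<in> Z" "prime p" for z p
    using that by (cases "p \<le> P0") (auto simp: Z_def)
  have start: "norm (dser c z \<sigma>0) \<ge> \<delta>0 / 2" if z: "z \<in> Z" for z
  proof -
    \<comment> \<open>Changing the coordinates beyond N costs less than 2 * (\<delta>0 / 4). The
      result lies on the torus because N \<le> P0, so the coordinates up to N are already
      unimodular.\<close>
    define y where "y = (\<lambda>p. if p \<le> N then z p else 1)"
    have "norm (dser c z \<sigma>0 - dser c y \<sigma>0) \<le> 2 * (\<Sum>\<^sub>\<infinity>m\<in>{N<..}. real m powr -\<sigma>0)"
      by (rule dser_diff_bound) (use c Z1[OF z] \<sigma>0 in \<open>auto simp: y_def\<close>)
    moreover have "norm (dser c y \<sigma>0) \<ge> \<delta>0"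
      by (rule \<delta>0) (use z in \<open>auto simp: y_def Z_def P0_def\<close>)
    ultimately show ?thesis using N norm_triangle_ineq2[of "dser c y \<sigma>0" "dser c z \<sigma>0"] by (simp add: norm_minus_commute)
  qed
  have good: "\<forall>z\<in>Z. dser c z \<sigma>1 \<noteq> 0" if \<sigma>1: "1 < \<sigma>1" "\<sigma>1 \<le> \<sigma>0" for \<sigma>1
  proof -
    obtain \<delta> where \<delta>: "\<delta> > 0" "\<And>\<sigma> z. \<sigma>1 \<le> \<sigma> \<Longrightarrow> \<sigma> \<le> \<sigma>0 \<Longrightarrow>
       (\<And>p. prime p \<Longrightarrow> norm (z p) = 1) \<Longrightarrow> norm (dser c z \<sigma>) \<ge> \<delta>"
      using low[OF \<sigma>1] by blast
    have improve: "norm (dser c z \<sigma>) \<ge> \<delta>"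
      if \<sigma>: "\<sigma>1 \<le> \<sigma>" "\<sigma> \<le> \<sigma>0" and nz: "\<forall>z\<in>Z. dser c z \<sigma> \<noteq> 0" and z: "z \<in> Z" for \<sigma> z
    proof (rule field_le_epsilon)
      fix \<epsilon> :: real assume "\<epsilon> > 0"
      have "\<sigma> > 1" using \<sigma> \<sigma>1 by simp
      then obtain M where M: "(\<Sum>\<^sub>\<infinity>m\<in>{M<..}. real m powr -\<sigma>) < \<epsilon> / 2"
        using powr_tail_small[of \<sigma> "\<epsilon> / 2"] \<open>\<epsilon> > 0\<close> by auto
      \<comment> \<open>Setting the coordinates beyond M to 1 leaves only the finitely many primes
        of T off the torus, at a cost below \<epsilon>.\<close>
      define y where "y = (\<lambda>p. if p \<le> M then z p else 1)"
      have y: "y \<in> Z" using z by (auto simp: y_def Z_def)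
      define T where "T = {p. prime p \<and> P0 < p \<and> p \<le> M}"
      obtain y' where y': "y' \<in> Z" "\<And>p. p \<in> T \<Longrightarrow> norm (y' p) = 1" "\<And>p. p \<notin> T \<Longrightarrow> y' p = y p"
          "norm (inverse (dser c y \<sigma>)) \<le> norm (inverse (dser c y' \<sigma>))"
      proof (rule max_modulus_polydisc[of T Z "\<lambda>z. inverse (dser c z \<sigma>)" y])
        show "finite T" by (auto simp: T_def)
        show upd: "z(p := w) \<in> Z" if "z \<in> Z" "p \<in> T" "norm w \<le> 1" for z p w
          using that by (auto simp: Z_def T_def)
        show "continuous_on (cball 0 1) (\<lambda>w. inverse (dser c (z(p := w)) \<sigma>))" if "z \<in> Z" "p \<in> T" for z p
          by (intro continuous_on_inverse dser_fun_upd[OF c]) (use that Z1 \<open>\<sigma> > 1\<close> nz upd in auto)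
        show "(\<lambda>w. inverse (dser c (z(p := w)) \<sigma>)) holomorphic_on ball 0 1" if "z \<in> Z" "p \<in> T" for z p
          by (intro holomorphic_on_inverse dser_fun_upd[OF c]) (use that Z1 \<open>\<sigma> > 1\<close> nz upd in auto)
      qed (use y in \<open>auto simp: T_def Z_def\<close>)
      have "norm (dser c y' \<sigma>) \<ge> \<delta>"
      proof (rule \<delta>(2)[OF \<sigma>])
        fix p :: nat assume p: "prime p"
        show "norm (y' p) = 1"
        proof (cases "p \<in> T")
          case False
          thus ?thesis using y'(3)[OF False] p y by (auto simp: T_def y_def Z_def)
        qed (use y' in auto)
      qed
      moreover have "norm (dser c y' \<sigma>) \<le> norm (dser c y \<sigma>)"
        using y'(4) nz y y'(1) by (simp add: norm_inverse)
      moreover have "norm (dser c z \<sigma> - dser c y \<sigma>) \<le> 2 * (\<Sum>\<^sub>\<infinity>m\<in>{M<..}. real m powr -\<sigma>)"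
        by (rule dser_diff_bound) (use c Z1[OF z] Z1[OF y] \<open>\<sigma> > 1\<close> in \<open>auto simp: y_def\<close>)
      ultimately show "\<delta> \<le> norm (dser c z \<sigma>) + \<epsilon>"
        using M norm_triangle_ineq2[of "dser c y \<sigma>" "dser c z \<sigma>"] by (simp add: norm_minus_commute)
    qed
    obtain \<Lambda> where \<Lambda>: "\<Lambda> \<ge> 0" "\<And>z \<sigma> \<sigma>'. (\<And>p. prime p \<Longrightarrow> norm (z p) \<le> 1) \<Longrightarrow>
     \<sigma>1 \<le> \<sigma> \<Longrightarrow> \<sigma>1 \<le> \<sigma>' \<Longrightarrow> norm (dser c z \<sigma> - dser c z \<sigma>') \<le> \<Lambda> * \<bar>\<sigma> - \<sigma>'\<bar>"
      using dser_lipschitz[OF \<sigma>1(1)] c by metis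
    \<comment> \<open>A step of length \<rho> changes the series by less than \<delta>. The summand
      1 covers the case \<Lambda> = 0.\<close>
    define \<rho> where "\<rho> = \<delta> / (2 * (\<Lambda> + 1))"
    have \<rho>: "\<rho> > 0" "\<Lambda> * \<rho> < \<delta>" 
    proof -
      have "\<Lambda> * \<delta> \<ge> 0" using \<delta>(1) \<Lambda>(1) by simp
      hence "\<Lambda> * \<delta> + \<delta> * 2 > 0" using \<delta>(1) by linarith
      thus "\<rho> > 0" "\<Lambda> * \<rho> < \<delta>" using \<delta>(1) \<Lambda>(1) by (auto simp: \<rho>_def field_simps)
    qed
    have step: "\<forall>z\<in>Z. dser c z \<sigma> \<noteq> 0" if "\<sigma>1 \<le> \<sigma>" "\<sigma> \<le> \<sigma>0" "\<sigma>0 - real n * \<rho> \<le> \<sigma>" for n \<sigma>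
      using that
    proof (induction n arbitrary: \<sigma>)
      case 0
      hence "\<sigma> = \<sigma>0" by simp
      thus ?case using start \<delta>0(1) by force
    next
      case (Suc n)
      define \<tau> where "\<tau> = min \<sigma>0 (\<sigma> + \<rho>)"
      have \<tau>: "\<sigma>1 \<le> \<tau>" "\<tau> \<le> \<sigma>0" "\<sigma>0 - real n * \<rho> \<le> \<tau>" "\<bar>\<sigma> - \<tau>\<bar> \<le> \<rho>"
        using Suc.prems \<rho> by (auto simp: \<tau>_def algebra_simps)
      show ?case
      proof
        fix z assume z: "z \<in> Z"
        have "norm (dser c z \<tau>) \<ge> \<delta>" using improve Suc.IH \<tau> z by blast
        moreover have "norm (dser c z \<sigma> - dser c z \<tau>) \<le> \<Lambda> * \<bar>\<sigma> - \<tau>\<bar>"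
          using Z1[OF z] Suc.prems \<tau> by (intro \<Lambda>) auto
        moreover have "\<Lambda> * \<bar>\<sigma> - \<tau>\<bar> \<le> \<Lambda> * \<rho>" using \<Lambda> \<tau> by (intro mult_left_mono) auto
        ultimately show "dser c z \<sigma> \<noteq> 0" using \<rho> by (intro notI) simp
      qed
    qed
    obtain n :: nat where "(\<sigma>0 - \<sigma>1) / \<rho> \<le> real n" using real_arch_simple by blast
    thus ?thesis using step[of \<sigma>1 n] \<sigma>1 \<rho> by (simp add: field_simps)
  qed
  show ?thesis
    by (rule that[of P0]) (use good in \<open>auto simp: P0_def Z_def\<close>)
qed

section \<open>Zero-free functions and smooth numbers\<close>

text \<open>
  Borel--Caratheodory for \<open>h = ln (f / f 0)\<close>.
\<close>

lemma second_coefficient_bound: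
  fixes f :: "complex \<Rightarrow> complex"
  assumes hol: "f holomorphic_on ball 0 1" and nz: "\<And>w. w \<in> ball 0 1 \<Longrightarrow> f w \<noteq> 0"
    and bound: "\<And>w. w \<in> ball 0 1 \<Longrightarrow> norm (f w) \<le> norm (f 0) * exp K" and K: "K > 0"
  shows "norm (deriv f 0) ^ 2 \<le> norm (f 0) * norm (deriv (deriv f) 0) + 32 * K * norm (f 0) ^ 2"
proof -
  let ?B = "ball (0::complex) 1"
  have f0: "f 0 \<noteq> 0" using nz by simp
  have "(\<lambda>w. f w / f 0) holomorphic_on ?B" using hol f0 by (intro holomorphic_intros) auto
  moreover have "f w / f 0 \<noteq> 0" if "w \<in> ?B" for w using nz[OF that] f0 by simp
  ultimately obtain h0 where h0: "h0 holomorphic_on ?B" "\<And>w. w \<in> ?B \<Longrightarrow> f w / f 0 = exp (h0 w)"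
    using contractible_imp_holomorphic_log[OF _ convex_imp_contractible[OF convex_ball], of "\<lambda>w. f w / f 0" 0 1] by blast
  define h where "h = (\<lambda>w. h0 w - h0 0)"
  have h: "h holomorphic_on ?B" "h 0 = 0" unfolding h_def using h0 by (auto intro!: holomorphic_intros)
  have "exp (h0 0) = 1" using h0(2)[of 0] f0 by simp
  hence fh: "f w = f 0 * exp (h w)" if "w \<in> ?B" for w
    using h0(2)[OF that] f0 by (simp add: h_def exp_diff field_simps)
  have Re: "Re (h w) \<le> K" if w: "w \<in> ?B" for w
  proof -
    have "norm (f 0) * exp (Re (h w)) \<le> norm (f 0) * exp K" using bound[OF w] fh[OF w] by (simp add: norm_mult)
    thus ?thesis using f0 by simp
  qed
  \<comment> \<open>Only the real part of h is bounded. This Moebius map fixes 0 and sends the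
    half-plane Re \<le> K into the closed unit disc, so that Cauchy's inequality applies to
    g.\<close>
  define g where "g = (\<lambda>w. h w / (2 * of_real K - h w))"
  have den: "2 * of_real K - h w \<noteq> 0" if "w \<in> ?B" for w
  proof
    assume "2 * of_real K - h w = 0"
    hence "Re (h w) = 2 * K" by (metis Re_complex_of_real eq_iff_diff_eq_0 of_real_mult of_real_numeral)
    thus False using Re[OF that] K by simp
  qed
  have g: "g holomorphic_on ?B" unfolding g_def using h den by (intro holomorphic_intros) auto
  have g1: "norm (g w) \<le> 1" if w: "w \<in> ?B" for w
  proof -
    have "norm (h w) ^ 2 \<le> norm (2 * of_real K - h w) ^ 2"
    proof -
      have "norm (2 * of_real K - h w) ^ 2 - norm (h w) ^ 2 = 4 * K * (K - Re (h w))"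
        by (simp only: cmod_power2) (simp add: power2_eq_square algebra_simps)
      moreover have "4 * K * (K - Re (h w)) \<ge> 0" using Re[OF w] K by (intro mult_nonneg_nonneg) auto
      ultimately show ?thesis by linarith
    qed
    hence "norm (h w) \<le> norm (2 * of_real K - h w)" by (rule power2_le_imp_le) simp
    thus ?thesis unfolding g_def using den[OF w] by (simp add: norm_divide)
  qed
  have g0: "g 0 = 0" by (simp add: g_def h)
  \<comment> \<open>The relation between h and g is kept as a product and differentiated twice, so
    no quotient has to be differentiated.\<close>
  have hg: "h w * (1 + g w) = 2 * of_real K * g w" if "w \<in> ?B" for w
    using den[OF that] unfolding g_def by (simp add: field_simps)
  have cauchy: "norm ((deriv ^^ n) g 0) \<le> fact n * 1 / (1/2) ^ n" for n
  proof (rule Cauchy_inequality)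
    show "g holomorphic_on ball 0 (1/2)" using g by (rule holomorphic_on_subset) auto
    show "continuous_on (cball 0 (1/2)) g"
      using holomorphic_on_imp_continuous_on[OF g] by (rule continuous_on_subset) (auto simp: subset_eq)
  qed (use g1 in auto)
  have g'1: "norm (deriv g 0) \<le> 2" using cauchy[of 1] by simp
  have g'2: "norm (deriv (deriv g) 0) \<le> 8" using cauchy[of 2] by (simp add: numeral_2_eq_2)
  note holder = holomorphic_deriv[OF _ open_ball]
  have at: "(F has_field_derivative deriv F w) (at w)" if "F holomorphic_on ?B" "w \<in> ?B" for F w
    using that by (intro holomorphic_derivI[of F ?B]) auto
  have deq: "deriv F w = deriv G w" if "\<And>w. w \<in> ?B \<Longrightarrow> F w = G w" "w \<in> ?B" for F G w
    by (intro deriv_cong_ev refl eventually_mono[OF eventually_nhds_in_open[of ?B w]]) (use that in auto)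
  have zero: "(0::complex) \<in> ?B" by simp
  have h1: "deriv h w * (1 + g w) + h w * deriv g w = 2 * of_real K * deriv g w" if w: "w \<in> ?B" for w
  proof -
    have "deriv (\<lambda>w. h w * (1 + g w)) w = deriv h w * (1 + g w) + h w * deriv g w"
      by (rule DERIV_imp_deriv) (auto intro!: derivative_eq_intros at h g w)
    moreover have "deriv (\<lambda>w. 2 * of_real K * g w) w = 2 * of_real K * deriv g w"
      by (rule DERIV_imp_deriv) (auto intro!: derivative_eq_intros at h g w)
    ultimately show ?thesis using deq[of "\<lambda>w. h w * (1 + g w)" "\<lambda>w. 2 * of_real K * g w", OF hg w] by simp
  qed
  have h'0: "deriv h 0 = 2 * of_real K * deriv g 0" using h1[OF zero] g0 h by simp
  have h2: "deriv (deriv h) 0 + 2 * deriv h 0 * deriv g 0 = 2 * of_real K * deriv (deriv g) 0"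
  proof -
    have "deriv (\<lambda>w. deriv h w * (1 + g w) + h w * deriv g w) 0
        = deriv (deriv h) 0 * (1 + g 0) + deriv h 0 * deriv g 0 + (deriv h 0 * deriv g 0 + h 0 * deriv (deriv g) 0)"
      by (rule DERIV_imp_deriv) (auto intro!: derivative_eq_intros at h g zero holder)
    moreover have "deriv (\<lambda>w. 2 * of_real K * deriv g w) 0 = 2 * of_real K * deriv (deriv g) 0"
      by (rule DERIV_imp_deriv) (auto intro!: derivative_eq_intros at h g zero holder)
    ultimately show ?thesis
      using deq[of "\<lambda>w. deriv h w * (1 + g w) + h w * deriv g w" "\<lambda>w. 2 * of_real K * deriv g w", OF h1 zero] g0 h(2) by (simp add: algebra_simps)
  qed
  \<comment> \<open>The constant is 2 * K * (8 + 2 * \<open>2^2\<close>), from the Cauchy estimates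
    on the disc of radius 1/2.\<close>
  have h''0: "norm (deriv (deriv h) 0) \<le> 32 * K"
  proof -
    have "deriv (deriv h) 0 = 2 * of_real K * (deriv (deriv g) 0 - 2 * deriv g 0 ^ 2)"
      using h2 unfolding h'0 by (simp add: algebra_simps power2_eq_square)
    hence "norm (deriv (deriv h) 0) = 2 * K * norm (deriv (deriv g) 0 - 2 * deriv g 0 ^ 2)"
      using K by (simp add: norm_mult)
    also have "norm (deriv (deriv g) 0 - 2 * deriv g 0 ^ 2) \<le> norm (deriv (deriv g) 0) + norm (2 * deriv g 0 ^ 2)"
      by (rule norm_triangle_ineq4)
    also have "norm (2 * deriv g 0 ^ 2) \<le> 2 * 2 ^ 2"
      unfolding norm_mult norm_power by (intro mult_mono power_mono g'1) auto
    also have "norm (deriv (deriv g) 0) \<le> 8" by (rule g'2)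
    finally show ?thesis using K by (simp add: mult_left_mono)
  qed
  have f1: "deriv f w = f w * deriv h w" if w: "w \<in> ?B" for w
  proof -
    have "deriv (\<lambda>w. f 0 * exp (h w)) w = f 0 * exp (h w) * deriv h w"
      by (rule DERIV_imp_deriv) (auto intro!: derivative_eq_intros at h w)
    thus ?thesis using deq[of f "\<lambda>w. f 0 * exp (h w)", OF fh w] fh[OF w] by simp
  qed
  have "deriv (\<lambda>w. f w * deriv h w) 0 = deriv f 0 * deriv h 0 + f 0 * deriv (deriv h) 0"
    by (rule DERIV_imp_deriv) (auto intro!: derivative_eq_intros at h hol zero holder)
  hence f2: "deriv (deriv f) 0 = deriv f 0 * deriv h 0 + f 0 * deriv (deriv h) 0"
    using deq[of "deriv f" "\<lambda>w. f w * deriv h w", OF f1 zero] by simp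
  \<comment> \<open>This is the identity \<open>(ln f)'' = f'' / f - (f' / f)^2\<close> with
    denominators cleared.\<close>
  have "deriv f 0 ^ 2 = f 0 * deriv (deriv f) 0 - f 0 ^ 2 * deriv (deriv h) 0"
    unfolding f2 f1[OF zero] by (simp add: algebra_simps power2_eq_square)
  hence "norm (deriv f 0) ^ 2 = norm (f 0 * deriv (deriv f) 0 - f 0 ^ 2 * deriv (deriv h) 0)"
    by (metis norm_power)
  also have "\<dots> \<le> norm (f 0 * deriv (deriv f) 0) + norm (f 0 ^ 2 * deriv (deriv h) 0)"
    by (rule norm_triangle_ineq4)
  also have "\<dots> \<le> norm (f 0) * norm (deriv (deriv f) 0) + norm (f 0) ^ 2 * (32 * K)"
    unfolding norm_mult norm_power using h''0 by (intro add_mono mult_left_mono) auto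
  finally show ?thesis by (simp add: algebra_simps)
qed

section \<open>Finite Euler products and integers with restricted prime factors\<close>

definition smooth_over :: "nat set \<Rightarrow> nat set" where
  "smooth_over T = {m. m > 0 \<and> prime_factors m \<subseteq> T}"

text \<open>Half of the Euler product. The exponent vectors inject A into the finite box of
  functions from T to {0..J}, and the sum over the box factors into partial geometric
  series.\<close>

lemma sum_smooth_le_prod:
  assumes T: "finite T" "\<And>p. p \<in> T \<Longrightarrow> prime p" and A: "finite A" "A \<subseteq> smooth_over T" and x: "x > 0"
  shows "(\<Sum>m\<in>A. real m powr -x) \<le> (\<Prod>p\<in>T. 1 / (1 - real p powr -x))"
proof -
  define J where "J = Max (insert 0 ((\<lambda>m. Max (insert 0 ((\<lambda>p. multiplicity p m) ` T))) ` A))"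
  have J: "multiplicity p m \<le> J" if "p \<in> T" "m \<in> A" for p m
  proof -
    have "multiplicity p m \<le> Max (insert 0 ((\<lambda>p. multiplicity p m) ` T))" using that T by (intro Max_ge) auto
    also have "\<dots> \<le> J" unfolding J_def using that A by (intro Max_ge) auto
    finally show ?thesis .
  qed
  have p: "real p powr -x < 1" "real p powr -x \<ge> 0" if "p \<in> T" for p
    using powr_less_mono2_neg[of "-x" 1 "real p"] T(2)[OF that] x prime_gt_1_nat[of p] by auto
  define \<phi> where "\<phi> = (\<lambda>m. restrict (\<lambda>p. multiplicity p m) T)"
  have val: "m = (\<Prod>p\<in>T. p ^ multiplicity p m)" if "m \<in> A" for m
  proof -
    have m: "m > 0" "prime_factors m \<subseteq> T" using that A by (auto simp: smooth_over_def)
    have "m = (\<Prod>p\<in>prime_factors m. p ^ multiplicity p m)"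
      using m(1) prime_factorization_nat by blast
    also have "\<dots> = (\<Prod>p\<in>T. p ^ multiplicity p m)"
      using T m by (intro prod.mono_neutral_left) (auto simp: prime_factors_multiplicity)
    finally show ?thesis .
  qed
  have inj: "inj_on \<phi> A"
  proof (rule inj_onI)
    fix m n assume mn: "m \<in> A" "n \<in> A" "\<phi> m = \<phi> n"
    have "multiplicity p m = multiplicity p n" if "p \<in> T" for p
      using fun_cong[OF mn(3), of p] that by (simp add: \<phi>_def)
    thus "m = n" using val[OF mn(1)] val[OF mn(2)] by (metis (no_types, lifting) prod.cong)
  qed
  have pow: "real m powr -x = (\<Prod>p\<in>T. (real p powr -x) ^ \<phi> m p)" if "m \<in> A" for m
  proof -
    have "real m powr -x = (\<Prod>p\<in>T. real p ^ multiplicity p m) powr -x"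
      using val[OF that] by (metis (no_types, lifting) of_nat_power of_nat_prod prod.cong)
    also have "\<dots> = (\<Prod>p\<in>T. (real p ^ multiplicity p m) powr -x)"
      by (rule prod_powr_distrib)
    also have "\<dots> = (\<Prod>p\<in>T. (real p powr -x) ^ \<phi> m p)"
    proof (rule prod.cong)
      fix p assume "p \<in> T"
      hence "p > 0" using T(2) prime_gt_0_nat by blast
      thus "(real p ^ multiplicity p m) powr -x = (real p powr -x) ^ \<phi> m p"
        using \<open>p \<in> T\<close> by (simp add: \<phi>_def powr_powr mult_ac flip: powr_realpow)
    qed auto
    finally show ?thesis .
  qed
  have "(\<Sum>m\<in>A. real m powr -x) = (\<Sum>m\<in>A. \<Prod>p\<in>T. (real p powr -x) ^ \<phi> m p)"
    by (intro sum.cong refl pow)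
  also have "\<dots> = (\<Sum>g\<in>\<phi> ` A. \<Prod>p\<in>T. (real p powr -x) ^ g p)"
    by (subst sum.reindex[OF inj]) simp
  also have "\<dots> \<le> (\<Sum>g\<in>PiE T (\<lambda>_. {..J}). \<Prod>p\<in>T. (real p powr -x) ^ g p)"
    using T J by (intro sum_mono2 finite_PiE prod_nonneg) (auto simp: \<phi>_def)
  also have "\<dots> = (\<Prod>p\<in>T. \<Sum>j\<le>J. (real p powr -x) ^ j)"
    by (rule prod_sum_PiE[symmetric]) (use T in auto)
  also have "\<dots> \<le> (\<Prod>p\<in>T. 1 / (1 - real p powr -x))"
  proof (intro prod_mono conjI sum_nonneg)
    fix q assume "q \<in> T"
    note q = p[OF this]
    have "(\<Sum>j\<le>J. (real q powr -x) ^ j) \<le> (\<Sum>j. (real q powr -x) ^ j)"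
      using q by (intro sum_le_suminf summable_geometric) auto
    also have "\<dots> = 1 / (1 - real q powr -x)" using q by (intro suminf_geometric) auto
    finally show "(\<Sum>j\<le>J. (real q powr -x) ^ j) \<le> 1 / (1 - real q powr -x)" .
  qed auto
  finally show ?thesis .
qed

text \<open>As T is finite, convergence holds for every positive exponent. Exponent 1 is the
  important one: it gives majorants that are uniform in \<sigma> > 1.\<close>

lemma smooth_summable:
  assumes T: "finite T" "\<And>p. p \<in> T \<Longrightarrow> prime p" and x: "x > 0"
  shows "(\<lambda>m. real m powr -x) summable_on smooth_over T"
    and "(\<Sum>\<^sub>\<infinity>m\<in>smooth_over T. real m powr -x) \<le> (\<Prod>p\<in>T. 1 / (1 - real p powr -x))"
proof -
  show S: "(\<lambda>m. real m powr -x) summable_on smooth_over T"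
    by (rule nonneg_bdd_above_summable_on)
       (auto intro!: bdd_aboveI2[where M = "\<Prod>p\<in>T. 1 / (1 - real p powr -x)"] sum_smooth_le_prod T x)
  show "(\<Sum>\<^sub>\<infinity>m\<in>smooth_over T. real m powr -x) \<le> (\<Prod>p\<in>T. 1 / (1 - real p powr -x))"
    using sum_smooth_le_prod[OF T _ _ x] by (intro infsum_le_finite_sums S) auto
qed

lemma inverse_one_minus_le_exp:
  assumes "0 \<le> y" "y \<le> 1 / 2"
  shows "1 / (1 - y) \<le> exp (2 * (y::real))"
proof -
  have "1 / (1 - y) \<le> 1 + 2 * y"
  proof -
    have "1 \<le> (1 + 2 * y) * (1 - y)"
    proof -
      have "y * (1 - 2 * y) \<ge> 0" using assms by (intro mult_nonneg_nonneg) auto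
      thus ?thesis by (simp add: algebra_simps)
    qed
    thus ?thesis using assms by (simp add: field_simps)
  qed
  also have "\<dots> \<le> exp (2 * y)" by (rule exp_ge_add_one_self)
  finally show ?thesis .
qed

lemma euler_factors_le_exp:
  assumes "finite T" "\<And>p. p \<in> T \<Longrightarrow> prime p" "x \<ge> 1"
  shows "(\<Prod>p\<in>T. 1 / (1 - real p powr -x)) \<le> exp (2 * (\<Sum>p\<in>T. real p powr -x))"
proof -
  have "(\<Prod>p\<in>T. 1 / (1 - real p powr -x)) \<le> (\<Prod>p\<in>T. exp (2 * real p powr -x))"
  proof (intro prod_mono conjI)
    fix p assume "p \<in> T"
    hence p: "real p \<ge> 2" using assms(2) prime_ge_2_nat by fastforce
    have "real p powr -x \<le> real p powr -1" using p assms(3) by (intro powr_mono) auto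
    also have "\<dots> \<le> 1 / 2" using p by (simp add: powr_minus field_simps)
    finally have *: "real p powr -x \<le> 1 / 2" .
    thus "0 \<le> 1 / (1 - real p powr -x)" by simp
    show "1 / (1 - real p powr -x) \<le> exp (2 * real p powr -x)"
      by (rule inverse_one_minus_le_exp) (use * in auto)
  qed
  also have "\<dots> = exp (2 * (\<Sum>p\<in>T. real p powr -x))"
    using assms(1) by (simp add: exp_sum sum_distrib_left)
  finally show ?thesis .
qed

section \<open>Bilinear exponential sums over primes\<close>

text \<open>Summation by parts. Multiplication by 1 - x leaves two boundary terms and the
  differences \<open>a n - a (Suc n)\<close>, which are non-negative and telescope to
  \<open>a Y - a Z\<close>.\<close>

lemma abel_power_sum_bound:
  fixes a :: "nat \<Rightarrow> real" and x :: complex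
  assumes x: "norm x = 1" "x \<noteq> 1" and "Y \<le> Z"
    and a: "\<And>n. Y \<le> n \<Longrightarrow> a n \<ge> 0" "\<And>n. Y \<le> n \<Longrightarrow> a (Suc n) \<le> a n"
  shows "norm (\<Sum>n\<in>{Y..Z}. of_real (a n) * x ^ n) \<le> 2 * a Y / norm (1 - x)"
proof -
  have eq: "(1 - x) * (\<Sum>n\<in>{Y..Z}. of_real (a n) * x ^ n)
       = of_real (a Y) * x ^ Y - of_real (a Z) * x ^ Suc Z - (\<Sum>n\<in>{Y..<Z}. of_real (a n - a (Suc n)) * x ^ Suc n)"
    using \<open>Y \<le> Z\<close>
  proof (induction Z rule: dec_induct)
    case (step Z)
    have "{Y..Suc Z} = insert (Suc Z) {Y..Z}" "{Y..<Suc Z} = insert Z {Y..<Z}" using step by auto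
    thus ?case using step.IH by (simp add: algebra_simps)
  qed (simp add: algebra_simps)
  have tel: "(\<Sum>n\<in>{Y..<Z}. a n - a (Suc n)) = a Y - a Z"
    using sum_Suc_diff'[OF \<open>Y \<le> Z\<close>, of a] by (simp add: sum_subtractf)
  have "norm (1 - x) * norm (\<Sum>n\<in>{Y..Z}. of_real (a n) * x ^ n)
       \<le> norm (of_real (a Y) * x ^ Y) + norm (of_real (a Z) * x ^ Suc Z) + norm (\<Sum>n\<in>{Y..<Z}. of_real (a n - a (Suc n)) * x ^ Suc n)"
    unfolding norm_mult[symmetric] eq by (metis (no_types, lifting) add_right_mono norm_triangle_ineq4 order_trans)
  also have "norm (\<Sum>n\<in>{Y..<Z}. of_real (a n - a (Suc n)) * x ^ Suc n) \<le> (\<Sum>n\<in>{Y..<Z}. a n - a (Suc n))"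
    by (rule sum_norm_le) (use a x in \<open>auto simp: norm_mult norm_power simp flip: of_real_diff\<close>)
  also have "norm (of_real (a Y) * x ^ Y) = a Y" using a(1)[of Y] x by (simp add: norm_mult norm_power)
  also have "norm (of_real (a Z) * x ^ Suc Z) = a Z" using a(1)[of Z] x \<open>Y \<le> Z\<close> by (simp add: norm_mult norm_power)
  finally show ?thesis using x tel by (simp add: field_simps)
qed

lemma harm_eq_sum: "harm n = (\<Sum>k\<in>{1..n}. 1 / real k)"
  by (simp add: harm_def inverse_eq_divide)

text \<open>Separation makes \<open>n div W\<close> injective on B, and
  \<open>n \<ge> W * (n div W)\<close>, so the sum is 1 / W times a sum of reciprocals of distinct
  positive integers. W \<le> n keeps these quotients positive.\<close>

lemma separated_reciprocal_sum:
  fixes B :: "nat set"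
  assumes "W \<ge> 1" "B \<subseteq> {W..Z}" and sep: "\<And>m n. m \<in> B \<Longrightarrow> n \<in> B \<Longrightarrow> m < n \<Longrightarrow> W \<le> n - m"
  shows "(\<Sum>n\<in>B. 1 / real n) \<le> harm Z / real W"
proof -
  have fin: "finite B" using assms(2) finite_subset by blast
  have inj: "inj_on (\<lambda>n. n div W) B"
  proof (rule linorder_inj_onI)
    fix m n assume mn: "m < n" "m \<in> B" "n \<in> B"
    hence "m + W \<le> n" using sep by fastforce
    hence "(m + W) div W \<le> n div W" by (rule div_le_mono)
    thus "m div W \<noteq> n div W" using \<open>W \<ge> 1\<close> by simp
  qed auto
  have "(\<Sum>n\<in>B. 1 / real n) \<le> (\<Sum>n\<in>B. 1 / real W * (1 / real (n div W)))"
  proof (rule sum_mono)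
    fix n assume "n \<in> B"
    hence n: "W \<le> n" using assms(2) by auto
    hence "n div W \<ge> 1" using \<open>W \<ge> 1\<close> by (simp add: div_greater_zero_iff Suc_le_eq)
    moreover have "W * (n div W) \<le> n" by simp
    hence "real W * real (n div W) \<le> real n" by (metis of_nat_le_iff of_nat_mult)
    ultimately show "1 / real n \<le> 1 / real W * (1 / real (n div W))"
      using \<open>W \<ge> 1\<close> by (simp add: frac_le)
  qed
  also have "\<dots> = 1 / real W * (\<Sum>n\<in>(\<lambda>n. n div W) ` B. 1 / real n)"
    by (subst sum.reindex[OF inj]) (simp add: sum_distrib_left)
  also have "(\<Sum>n\<in>(\<lambda>n. n div W) ` B. 1 / real n) \<le> (\<Sum>n\<in>{1..Z}. 1 / real n)"
  proof (rule sum_mono2)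
    show "(\<lambda>n. n div W) ` B \<subseteq> {1..Z}"
    proof safe
      fix n assume "n \<in> B"
      hence "W \<le> n" "n \<le> Z" using assms(2) by auto
      thus "n div W \<in> {1..Z}" using \<open>W \<ge> 1\<close> by (auto simp: div_greater_zero_iff Suc_le_eq intro: order_trans[OF div_le_dividend])
    qed
  qed auto
  finally show ?thesis using \<open>W \<ge> 1\<close> by (simp add: harm_eq_sum divide_right_mono)
qed

definition unit_exp :: "real \<Rightarrow> complex" where
  "unit_exp x = cis (2 * pi * x)"

lemma norm_unit_exp [simp]: "norm (unit_exp x) = 1"
  by (simp add: unit_exp_def)

lemma unit_exp_add: "unit_exp (x + y) = unit_exp x * unit_exp y"
  by (simp add: unit_exp_def cis_mult distrib_left)

lemma unit_exp_minus: "unit_exp (-x) = cnj (unit_exp x)"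
  by (simp add: unit_exp_def cis_cnj)

lemma unit_exp_of_int [simp]: "unit_exp (of_int n) = 1"
  unfolding unit_exp_def by (rule cis_multiple_2pi) auto

lemma unit_exp_power: "unit_exp x ^ n = unit_exp (real n * x)"
  by (induction n) (simp_all add: unit_exp_add distrib_right, simp add: unit_exp_def)

lemma norm_unit_exp_diff: "norm (unit_exp x - unit_exp y) = norm (1 - unit_exp (y - x))"
proof -
  have "unit_exp x - unit_exp y = unit_exp x * (1 - unit_exp (y - x))"
    by (simp add: algebra_simps flip: unit_exp_add)
  thus ?thesis by (simp add: norm_mult)
qed

text \<open>
  After Cauchy--Schwarz the outer prime variable is extended to all integers of \<open>{Y..Z}\<close>. This loses only
  logarithms, while a factor \<open>W\<close> is saved: for fixed \<open>p''\<close>, those \<open>p'\<close> for which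
  \<open>unit_exp (\<gamma> * p')\<close> is close to \<open>unit_exp (\<gamma> * p'')\<close> are \<open>W\<close>-separated.
\<close>

lemma bilinear_bound:
  fixes P :: "nat set" and u :: "nat \<Rightarrow> complex"
  assumes sep: "\<And>d. 0 < d \<Longrightarrow> d < W \<Longrightarrow> norm (1 - unit_exp (\<gamma> * real d)) \<ge> 2 * \<tau>"
    and pos: "\<tau> > 0" "1 \<le> W" "W \<le> Y"
    and P: "P \<subseteq> {Y..Z}" and u: "\<And>p. p \<in> P \<Longrightarrow> norm (u p) \<le> 1" and \<sigma>: "\<sigma> \<ge> 1"
  shows "norm (\<Sum>p\<in>P. \<Sum>p'\<in>P. u p * u p' * of_real (real (p * p') powr -\<sigma>) * unit_exp (\<gamma> * real (p * p'))) ^ 2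
      \<le> harm Z ^ 4 * (1 / real W + 2 / (real Y * \<tau>))"
proof (cases "Y \<le> Z")
  case False
  hence "P = {}" using P by auto
  thus ?thesis using pos harm_nonneg[where ?'a = real, of Z] by simp
next
  case True
  have fin: "finite P" using P finite_subset by blast
  define H where "H = (harm Z :: real)"
  have H0: "H \<ge> 0" unfolding H_def by (rule harm_nonneg)
  have H1: "H \<ge> 1"
  proof -
    have "harm 1 \<le> (harm Z :: real)" using True pos by (intro harm_mono) auto
    thus ?thesis by (simp add: H_def harm_expand)
  qed
  define a where "a = (\<lambda>n::nat. real n powr -\<sigma>)"
  have a0: "a n \<ge> 0" for n by (simp add: a_def)
  have a1: "a n \<le> 1 / real n" if "n \<ge> 1" for n
    using that \<sigma> powr_mono[of "-\<sigma>" "-1" "real n"] by (simp add: a_def powr_minus inverse_eq_divide)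
  have sub: "P \<subseteq> {1..Z}" "{Y..Z} \<subseteq> {1..Z}" using P pos by auto
  have sumH: "(\<Sum>n\<in>A. a n) \<le> H" if "A \<subseteq> {1..Z}" for A
  proof -
    have "(\<Sum>n\<in>A. a n) \<le> (\<Sum>n\<in>{1..Z}. a n)" using that a0 by (intro sum_mono2) auto
    also have "\<dots> \<le> (\<Sum>n\<in>{1..Z}. 1 / real n)" by (intro sum_mono a1) auto
    finally show ?thesis by (simp add: H_def harm_eq_sum)
  qed
  define V where "V = (\<lambda>n. \<Sum>p'\<in>P. u p' * of_real (a p') * unit_exp (\<gamma> * real (n * p')))"
  define \<epsilon> where "\<epsilon> = 1 / real W + 2 / (real Y * \<tau>)"
  have eq: "(\<Sum>p\<in>P. \<Sum>p'\<in>P. u p * u p' * of_real (real (p * p') powr -\<sigma>) * unit_exp (\<gamma> * real (p * p')))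
      = (\<Sum>p\<in>P. u p * of_real (a p) * V p)"
    unfolding V_def sum_distrib_left a_def by (intro sum.cong refl) (simp add: powr_mult mult_ac)
  \<comment> \<open>Expanding \<open>V n * cnj (V n)\<close> produces the powers
    \<open>x p' p'' ^ n\<close>, so for each pair of primes the sum over n is a monotonically
    weighted geometric sum.\<close>
  define x where "x = (\<lambda>p' p''. unit_exp (\<gamma> * real p') * cnj (unit_exp (\<gamma> * real p'')))"
  have x1: "norm (1 - x p' p'') = norm (unit_exp (\<gamma> * real p') - unit_exp (\<gamma> * real p''))" for p' p''
    unfolding norm_unit_exp_diff unit_exp_minus[symmetric] x_def
    by (simp add: norm_minus_commute flip: unit_exp_add) (metis complex_cnj_diff complex_cnj_one complex_mod_cnj minus_diff_eq unit_exp_minus)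
  define E where "E = (\<lambda>p' p''. norm (\<Sum>n\<in>{Y..Z}. of_real (a n) * x p' p'' ^ n))"
  have dec: "a (Suc n) \<le> a n" if "n \<ge> Y" for n
    using that pos \<sigma> unfolding a_def by (intro powr_mono2') auto
  have E_triv: "E p' p'' \<le> H" for p' p''
  proof -
    have "E p' p'' \<le> (\<Sum>n\<in>{Y..Z}. a n)" unfolding E_def
      by (rule sum_norm_le) (simp add: norm_mult norm_power x_def a0)
    also have "\<dots> \<le> H" by (rule sumH) (use pos in auto)
    finally show ?thesis .
  qed
  have E_good: "E p' p'' \<le> 2 / (real Y * \<tau>)" if "norm (1 - x p' p'') \<ge> \<tau>" for p' p''
  proof -
    have "E p' p'' \<le> 2 * a Y / norm (1 - x p' p'')"
      unfolding E_def by (rule abel_power_sum_bound) (use True that pos a0 dec in \<open>auto simp: x_def norm_mult\<close>)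
    also have "\<dots> \<le> 2 * (1 / real Y) / \<tau>"
      using that pos a1[of Y] a0[of Y] by (intro frac_le mult_left_mono) auto
    finally show ?thesis by (simp add: field_simps)
  qed
  have inner: "(\<Sum>p'\<in>P. a p' * E p' p'') \<le> H ^ 2 * \<epsilon>" for p''
  proof -
    define B where "B = {p'\<in>P. norm (1 - x p' p'') < \<tau>}"
    have B: "(\<Sum>n\<in>B. 1 / real n) \<le> H / real W" unfolding H_def
    proof (rule separated_reciprocal_sum)
      show "B \<subseteq> {W..Z}" using P pos by (auto simp: B_def)
      fix m n assume mn: "m \<in> B" "n \<in> B" "m < n"
      show "W \<le> n - m"
      proof (rule ccontr)
        assume "\<not> W \<le> n - m"
        hence "2 * \<tau> \<le> norm (1 - unit_exp (\<gamma> * real (n - m)))" using mn by (intro sep) auto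
        also have "\<dots> = norm (unit_exp (\<gamma> * real m) - unit_exp (\<gamma> * real n))"
          using mn by (simp add: norm_unit_exp_diff of_nat_diff algebra_simps)
        \<comment> \<open>Both phases are within \<tau> of the phase of p'', hence within 2 * \<tau>
          of each other, which the separation hypothesis forbids for small differences.\<close>
        also have "\<dots> \<le> norm (unit_exp (\<gamma> * real m) - unit_exp (\<gamma> * real p'')) + norm (unit_exp (\<gamma> * real n) - unit_exp (\<gamma> * real p''))"
          using norm_triangle_ineq4[of "unit_exp (\<gamma> * real m) - unit_exp (\<gamma> * real p'')" "unit_exp (\<gamma> * real n) - unit_exp (\<gamma> * real p'')"] by simp
        also have "\<dots> < 2 * \<tau>" using mn by (simp add: B_def x1)
        finally show False by simp
      qed
    qed (use pos in auto)
    have "(\<Sum>p'\<in>P. a p' * E p' p'') \<le> (\<Sum>p'\<in>P. a p' * (2 / (real Y * \<tau>)) + (if p' \<in> B then 1 / real p' * H else 0))"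
    proof (rule sum_mono)
      fix p' assume p': "p' \<in> P"
      hence "p' \<ge> 1" using sub by auto
      show "a p' * E p' p'' \<le> a p' * (2 / (real Y * \<tau>)) + (if p' \<in> B then 1 / real p' * H else 0)"
      proof (cases "p' \<in> B")
        case True
        have "a p' * E p' p'' \<le> 1 / real p' * H"
          by (intro mult_mono a1 E_triv \<open>p' \<ge> 1\<close>) (auto simp: E_def)
        moreover have "a p' * (2 / (real Y * \<tau>)) \<ge> 0" using a0 pos by simp
        ultimately show ?thesis using True by simp
      next
        case False
        hence "E p' p'' \<le> 2 / (real Y * \<tau>)" using p' by (intro E_good) (auto simp: B_def)
        from mult_left_mono[OF this a0[of p']] show ?thesis using False by simp
      qed
    qed
    also have "\<dots> = (\<Sum>p'\<in>P. a p') * (2 / (real Y * \<tau>)) + (\<Sum>n\<in>B. 1 / real n) * H"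
    proof -
      have "P \<inter> {p'. p' \<in> B} = B" by (auto simp: B_def)
      hence "(\<Sum>p'\<in>P. if p' \<in> B then 1 / real p' * H else 0) = (\<Sum>n\<in>B. 1 / real n) * H"
        using fin by (simp only: sum.If_cases sum_distrib_right) simp
      thus ?thesis by (simp only: sum.distrib sum_distrib_right)
    qed
    also have "\<dots> \<le> H * (2 / (real Y * \<tau>)) + H / real W * H"
      using B sumH[OF sub(1)] H0 pos by (intro add_mono mult_right_mono) auto
    also have "\<dots> \<le> H ^ 2 * (2 / (real Y * \<tau>)) + H ^ 2 * (1 / real W)"
      using H1 pos by (intro add_mono mult_right_mono) (auto simp: power2_eq_square)
    finally show ?thesis by (simp add: \<epsilon>_def algebra_simps)
  qed
  have "norm (\<Sum>p\<in>P. u p * of_real (a p) * V p) \<le> (\<Sum>p\<in>P. a p * norm (V p))"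
    by (rule sum_norm_le) (use u a0 in \<open>auto simp: norm_mult intro!: mult_right_mono mult_left_le_one_le\<close>)
  hence "norm (\<Sum>p\<in>P. u p * of_real (a p) * V p) ^ 2 \<le> (\<Sum>p\<in>P. sqrt (a p) * (sqrt (a p) * norm (V p))) ^ 2"
    using a0 by (intro power_mono) (auto simp flip: mult.assoc)
  also have "\<dots> \<le> (\<Sum>p\<in>P. sqrt (a p) ^ 2) * (\<Sum>p\<in>P. (sqrt (a p) * norm (V p)) ^ 2)"
    by (rule Cauchy_Schwarz_ineq_sum)
  also have "\<dots> = (\<Sum>p\<in>P. a p) * (\<Sum>p\<in>P. a p * norm (V p) ^ 2)"
    using a0 by (simp add: power_mult_distrib)
  \<comment> \<open>One factor H comes from the first Cauchy-Schwarz factor, one from the sum over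
    p'', and two from \<open>inner\<close>.\<close>
  also have "\<dots> \<le> H * (H ^ 3 * \<epsilon>)"
  proof (rule mult_mono)
    have "(\<Sum>p\<in>P. a p * norm (V p) ^ 2) \<le> (\<Sum>n\<in>{Y..Z}. a n * norm (V n) ^ 2)"
      using P a0 by (intro sum_mono2) auto
    also have "\<dots> = norm (\<Sum>n\<in>{Y..Z}. of_real (a n) * (V n * cnj (V n)))"
    proof -
      have "(\<Sum>n\<in>{Y..Z}. of_real (a n) * (V n * cnj (V n))) = of_real (\<Sum>n\<in>{Y..Z}. a n * norm (V n) ^ 2)"
        by (simp add: complex_norm_square flip: of_real_power)
      moreover have "(\<Sum>n\<in>{Y..Z}. a n * norm (V n) ^ 2) \<ge> 0" using a0 by (intro sum_nonneg) auto
      ultimately show ?thesis by (simp only: norm_of_real abs_of_nonneg)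
    qed
    also have "(\<Sum>n\<in>{Y..Z}. of_real (a n) * (V n * cnj (V n))) = (\<Sum>p''\<in>P. \<Sum>p'\<in>P. (u p' * cnj (u p'') * of_real (a p') * of_real (a p'')) *
        (\<Sum>n\<in>{Y..Z}. of_real (a n) * x p' p'' ^ n))"
    proof -
      have "V n * cnj (V n) = (\<Sum>p''\<in>P. \<Sum>p'\<in>P. (u p' * cnj (u p'') * of_real (a p') * of_real (a p'')) * x p' p'' ^ n)" for n
      proof -
        have "x p' p'' ^ n = unit_exp (\<gamma> * real (n * p')) * cnj (unit_exp (\<gamma> * real (n * p'')))" for p' p''
          unfolding x_def power_mult_distrib complex_cnj_power[symmetric] unit_exp_power by (simp add: mult_ac)
        thus ?thesis unfolding V_def cnj_sum sum_product
          by (subst sum.swap) (intro sum.cong refl, simp add: mult_ac)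
      qed
      hence "(\<Sum>n\<in>{Y..Z}. of_real (a n) * (V n * cnj (V n))) = (\<Sum>n\<in>{Y..Z}. \<Sum>p''\<in>P. \<Sum>p'\<in>P.
          (u p' * cnj (u p'') * of_real (a p') * of_real (a p'')) * (of_real (a n) * x p' p'' ^ n))"
        by (simp add: sum_distrib_left mult_ac)
      also have "\<dots> = (\<Sum>p''\<in>P. \<Sum>n\<in>{Y..Z}. \<Sum>p'\<in>P.
          (u p' * cnj (u p'') * of_real (a p') * of_real (a p'')) * (of_real (a n) * x p' p'' ^ n))"
        by (rule sum.swap)
      also have "\<dots> = (\<Sum>p''\<in>P. \<Sum>p'\<in>P. \<Sum>n\<in>{Y..Z}.
          (u p' * cnj (u p'') * of_real (a p') * of_real (a p'')) * (of_real (a n) * x p' p'' ^ n))"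
        by (intro sum.cong refl sum.swap)
      finally show ?thesis by (simp add: sum_distrib_left)
    qed
    also have "norm \<dots> \<le> (\<Sum>p''\<in>P. \<Sum>p'\<in>P. a p'' * (a p' * E p' p''))"
    proof (intro sum_norm_le)
      fix p' p'' assume p: "p' \<in> P" "p'' \<in> P"
      have "norm (u p') * norm (u p'') \<le> 1 * 1" using p u by (intro mult_mono) auto
      hence "(norm (u p') * norm (u p'')) * (a p'' * (a p' * E p' p'')) \<le> 1 * (a p'' * (a p' * E p' p''))"
        using a0 by (intro mult_right_mono) (auto simp: E_def)
      thus "norm ((u p' * cnj (u p'') * of_real (a p') * of_real (a p'')) * (\<Sum>n\<in>{Y..Z}. of_real (a n) * x p' p'' ^ n))
          \<le> a p'' * (a p' * E p' p'')"
        using a0 by (simp add: norm_mult E_def mult_ac)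
    qed
    also have "\<dots> = (\<Sum>p''\<in>P. a p'' * (\<Sum>p'\<in>P. a p' * E p' p''))" by (simp add: sum_distrib_left)
    also have "\<dots> \<le> (\<Sum>p''\<in>P. a p'' * (H ^ 2 * \<epsilon>))" by (intro sum_mono mult_left_mono inner a0)
    also have "\<dots> = (\<Sum>p''\<in>P. a p'') * (H ^ 2 * \<epsilon>)" by (simp add: sum_distrib_right)
    also have "\<dots> \<le> H * (H ^ 2 * \<epsilon>)" using sumH[OF sub(1)] pos by (intro mult_right_mono) (auto simp: \<epsilon>_def)
    finally show "(\<Sum>p\<in>P. a p * norm (V p) ^ 2) \<le> H ^ 3 * \<epsilon>" by (simp add: power_numeral_reduce mult_ac)
  qed (use sumH[OF sub(1)] H0 a0 in \<open>auto intro!: sum_nonneg\<close>)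
  also have "\<dots> = H ^ 4 * \<epsilon>" by (simp add: power_numeral_reduce mult_ac)
  finally show ?thesis unfolding eq \<epsilon>_def H_def .
qed

section \<open>Distances of multiples of an irrational number from the integers\<close>

lemma sin_ge_half:
  assumes "0 \<le> x" "x \<le> pi / 2"
  shows "sin x \<ge> x / 2"
proof -
  \<comment> \<open>This is tan y \<ge> y. At y = x / 2 it gives
    \<open>sin x \<ge> x * cos (x / 2) ^ 2\<close>, and the square is at least 1/2 because cos x
    \<ge> 0.\<close>
  have tan: "sin y \<ge> y * cos y" if y: "0 \<le> y" "y \<le> pi / 2" for y :: real
  proof -
    have "sin 0 - 0 * cos 0 \<le> sin y - y * cos y"
    proof (rule DERIV_nonneg_imp_nondecreasing[of 0 y "\<lambda>y. sin y - y * cos y"])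
      fix t assume t: "0 \<le> t" "t \<le> y"
      have "((\<lambda>y. sin y - y * cos y) has_real_derivative t * sin t) (at t)"
        by (auto intro!: derivative_eq_intros)
      moreover have "t * sin t \<ge> 0" using t y by (intro mult_nonneg_nonneg sin_ge_zero) auto
      ultimately show "\<exists>d. ((\<lambda>y. sin y - y * cos y) has_real_derivative d) (at t) \<and> 0 \<le> d" by blast
    qed (use y in auto)
    thus ?thesis by simp
  qed
  have c: "cos (x / 2) \<ge> 0" using assms by (intro cos_ge_zero) auto
  have "cos x \<ge> 0" using assms by (intro cos_ge_zero) auto
  hence "cos (x / 2) ^ 2 \<ge> 1 / 2" using cos_double_cos[of "x / 2"] by simp
  hence "x / 2 \<le> x * cos (x / 2) ^ 2" using assms mult_left_mono[of "1/2" "cos (x / 2) ^ 2" x] by simp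
  also have "\<dots> = 2 * (x / 2 * cos (x / 2)) * cos (x / 2)" by (simp add: power2_eq_square)
  also have "\<dots> \<le> 2 * sin (x / 2) * cos (x / 2)"
    using tan[of "x / 2"] assms c by (intro mult_right_mono) auto
  also have "\<dots> = sin x" using sin_double[of "x / 2"] by simp
  finally show ?thesis .
qed

text \<open>The chord has length 2 * |sin (pi * y)|, where y is the offset of x from the nearest
  integer. The factor 2 results from sin t \<ge> t / 2 and pi \<ge> 2.\<close>

lemma norm_one_minus_unit_exp_ge:
  assumes "\<And>m::int. \<delta> \<le> \<bar>x - of_int m\<bar>"
  shows "norm (1 - unit_exp x) \<ge> 2 * \<delta>"
proof -
  define y where "y = x - of_int (round x)"
  have y: "\<bar>y\<bar> \<le> 1 / 2" unfolding y_def using of_int_round_abs_le[of x] by (simp add: abs_minus_commute)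
  have "unit_exp x = unit_exp (y + of_int (round x))" by (simp add: y_def)
  hence "unit_exp x = unit_exp y" by (simp only: unit_exp_add unit_exp_of_int mult_1_right)
  hence "norm (1 - unit_exp x) = norm (exp (\<i> * of_real (2 * pi * y)) - 1)"
    by (simp add: unit_exp_def cis_conv_exp norm_minus_commute)
  also have "\<dots> = 2 * \<bar>sin (pi * y)\<bar>" unfolding dist_exp_i_1 by simp
  finally have "norm (1 - unit_exp x) = 2 * \<bar>sin (pi * y)\<bar>" .
  moreover have "\<bar>sin (pi * y)\<bar> \<ge> sin (pi * \<bar>y\<bar>)" by (cases "y \<ge> 0") auto
  moreover have "sin (pi * \<bar>y\<bar>) \<ge> pi * \<bar>y\<bar> / 2"
    using y by (intro sin_ge_half) (auto simp: field_simps)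
  ultimately have "norm (1 - unit_exp x) \<ge> pi * \<bar>y\<bar>" by simp
  moreover have "pi * \<bar>y\<bar> \<ge> 2 * \<bar>y\<bar>" using pi_ge_two by (intro mult_right_mono) auto
  ultimately show ?thesis using assms[of "round x"] by (simp add: y_def)
qed

text \<open>Q is the denominator of a reduced fraction h / Q within \<open>1 / Q^2\<close> of
  \<beta>; irrationality provides arbitrarily large ones. For 0 < d \<le> Q / 2, the number h * d /
  Q is at least 1 / Q away from the integers since Q does not divide d, and replacing h / Q by
  \<beta> shifts it by at most half of that.\<close>

lemma irrational_denominator:
  assumes "\<beta> \<notin> \<rat>"
  obtains Q :: nat where "Q > M" "\<And>d. 0 < d \<Longrightarrow> 2 * d \<le> Q \<Longrightarrow> norm (1 - unit_exp (\<beta> * real d)) \<ge> 1 / real Q"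
proof -
  have "infinite (approx_set \<beta>)" using assms rational_iff_finite_approx_set by blast
  then obtain h k where hk: "(h, k) \<in> approx_set \<beta>" "k > int M" using infinite_approx_set by blast
  hence cop: "coprime h k" "\<bar>\<beta> - of_int h / of_int k\<bar> < 1 / of_int k ^ 2" "k > 0" by (auto simp: approx_set_def)
  show ?thesis
  proof (rule that[of "nat k"])
    show "nat k > M" using hk by simp
    fix d :: nat assume d: "0 < d" "2 * d \<le> nat k"
    have "norm (1 - unit_exp (\<beta> * real d)) \<ge> 2 * (1 / (2 * of_int k))"
    proof (rule norm_one_minus_unit_exp_ge)
      fix m :: int
      have "h * int d - m * k \<noteq> 0"
      proof
        assume "h * int d - m * k = 0"
        hence "k dvd h * int d" by (metis dvd_triv_right eq_iff_diff_eq_0)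
        hence "k dvd int d" using cop by (simp add: coprime_dvd_mult_right_iff coprime_commute)
        thus False using d zdvd_imp_le[of k "int d"] by simp
      qed
      hence "\<bar>h * int d - m * k\<bar> \<ge> 1" by linarith
      hence "real_of_int \<bar>h * int d - m * k\<bar> \<ge> 1" by linarith
      hence 1: "\<bar>of_int h / of_int k * real d - of_int m\<bar> \<ge> 1 / of_int k"
      proof -
        have "of_int h / of_int k * real d - of_int m = of_int (h * int d - m * k) / of_int k"
          using cop(3) by (simp add: field_simps)
        thus ?thesis using \<open>real_of_int \<bar>h * int d - m * k\<bar> \<ge> 1\<close> cop(3) by (simp add: abs_divide divide_right_mono)
      qed
      have "\<bar>\<beta> * real d - of_int h / of_int k * real d\<bar> = real d * \<bar>\<beta> - of_int h / of_int k\<bar>"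
        by (simp only: left_diff_distrib[symmetric] abs_mult) simp
      also have "\<dots> \<le> real d * (1 / of_int k ^ 2)" using cop by (intro mult_left_mono) auto
      also have "\<dots> \<le> of_int k / 2 * (1 / of_int k ^ 2)"
      proof (rule mult_right_mono)
        have "2 * int d \<le> k" using d by linarith
        hence "real_of_int (2 * int d) \<le> real_of_int k" by (rule of_int_le_iff[THEN iffD2])
        thus "real d \<le> of_int k / 2" by simp
      qed auto
      also have "\<dots> = 1 / (2 * of_int k)" using cop by (simp add: power2_eq_square field_simps)
      finally have 2: "\<bar>\<beta> * real d - of_int h / of_int k * real d\<bar> \<le> 1 / (2 * of_int k)" .
      have "1 / of_int k = 1 / (2 * of_int k) + 1 / (2 * real_of_int k)" using cop(3) by (simp add: field_simps)
      thus "1 / (2 * of_int k) \<le> \<bar>\<beta> * real d - of_int m\<bar>" using 1 2 by linarith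
    qed
    thus "norm (1 - unit_exp (\<beta> * real d)) \<ge> 1 / real (nat k)" using cop(3) by simp
  qed
qed

section \<open>Reciprocal sums over primes\<close>

lemma sum_ordered_pairs:
  fixes f :: "nat \<Rightarrow> nat \<Rightarrow> 'a :: comm_ring_1"
  assumes "finite T" and sym: "\<And>p q. f p q = f q p"
  shows "2 * (\<Sum>(p, q)\<in>{(p, q)\<in>T \<times> T. p \<le> q}. f p q) = (\<Sum>p\<in>T. \<Sum>q\<in>T. f p q) + (\<Sum>p\<in>T. f p p)"
proof -
  let ?L = "{(p, q)\<in>T \<times> T. p \<le> q}" and ?U = "{(p, q)\<in>T \<times> T. q \<le> p}" and ?D = "(\<lambda>p. (p, p)) ` T"
  let ?f = "\<lambda>(p, q). f p q"
  have fin: "finite ?L" "finite ?U" using assms(1) by (auto intro: finite_subset[of _ "T \<times> T"])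
  have "sum ?f ?U = sum ?f ?L"
    by (rule sum.reindex_bij_witness[of _ "\<lambda>(p, q). (q, p)" "\<lambda>(p, q). (q, p)"]) (auto simp: sym)
  hence "2 * sum ?f ?L = sum ?f ?L + sum ?f ?U" by simp
  also have "\<dots> = sum ?f (?L \<union> ?U) + sum ?f (?L \<inter> ?U)" using fin by (rule sum.union_inter[symmetric])
  also have "?L \<union> ?U = T \<times> T" by auto
  also have "?L \<inter> ?U = ?D" by auto
  also have "sum ?f ?D = (\<Sum>p\<in>T. f p p)" by (subst sum.reindex) (auto simp: inj_on_def)
  also have "sum ?f (T \<times> T) = (\<Sum>p\<in>T. \<Sum>q\<in>T. f p q)" by (rule sum.cartesian_product[symmetric])
  finally show ?thesis .
qed

lemma inj_on_prime_pair_product: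
  "inj_on (\<lambda>(p, q). p * q) {(p, q). prime (p::nat) \<and> prime q \<and> p \<le> q}"
proof (rule inj_onI, clarify)
  fix p q p' q' :: nat
  assume a: "prime p" "prime q" "p \<le> q" "prime p'" "prime q'" "p' \<le> q'" "p * q = p' * q'"
  have pf: "prime_factors (x * y) = {x, y}" if "prime x" "prime y" for x y :: nat
    using that by (auto simp: prime_factorization_mult prime_factorization_prime)
  have "prime_factors (p * q) = {p, q}" "prime_factors (p' * q') = {p', q'}" using a pf by blast+
  moreover have "prime_factors (p * q) = prime_factors (p' * q')" using a(7) by simp
  ultimately have "{p, q} = {p', q'}" by simp
  thus "p = p' \<and> q = q'" using a(3,6) by (auto simp: doubleton_eq_iff)
qed

text \<open>Products p * q of primes p \<le> q up to n are distinct integers up to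
  \<open>n^2\<close>. The resulting bound of order \<open>sqrt (ln n)\<close> for the prime sum
  suffices: at the lower end of the window n is polynomial in N, so the bound is of order
  \<open>sqrt (ln N)\<close>, whereas at the upper end \<open>2 ^ N\<close> the sum is at least
  about \<open>ln N / 2\<close>.\<close>

lemma prime_reciprocals_upper:
  "(\<Sum>p\<in>{p. prime p \<and> p \<le> n}. 1 / real p) ^ 2 \<le> 2 * harm (n ^ 2)"
proof -
  let ?T = "{p. prime p \<and> p \<le> n}" and ?L = "{(p, q)\<in>{p. prime p \<and> p \<le> n} \<times> {p. prime p \<and> p \<le> n}. p \<le> q}"
  have fin: "finite ?T" "finite ?L" by (auto intro: finite_subset[of _ "?T \<times> ?T"])
  have "(\<Sum>p\<in>?T. 1 / real p) ^ 2 = (\<Sum>p\<in>?T. \<Sum>q\<in>?T. 1 / real (p * q))"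
    by (simp add: power2_eq_square sum_product)
  also have "\<dots> \<le> 2 * (\<Sum>(p, q)\<in>?L. 1 / real (p * q))"
    by (subst sum_ordered_pairs[OF fin(1)]) (auto simp: mult.commute intro!: sum_nonneg)
  also have "(\<Sum>(p, q)\<in>?L. 1 / real (p * q)) = (\<Sum>m\<in>(\<lambda>(p, q). p * q) ` ?L. 1 / real m)"
  proof -
    have "inj_on (\<lambda>(p, q). p * q) ?L" by (rule inj_on_subset[OF inj_on_prime_pair_product]) auto
    thus ?thesis by (subst sum.reindex) (auto simp: case_prod_unfold)
  qed
  also have "\<dots> \<le> (\<Sum>m\<in>{1..n^2}. 1 / real m)"
    by (intro sum_mono2) (auto simp: power2_eq_square mult_le_mono Suc_le_eq prime_gt_0_nat)
  finally show ?thesis by (simp add: harm_eq_sum)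
qed

text \<open>Euler's argument: every positive integer up to n is composed of primes up to n, so the
  Euler product bounds the harmonic sum.\<close>

lemma prime_reciprocals_lower:
  assumes "n \<ge> 1"
  shows "ln (harm n) \<le> 2 * (\<Sum>p\<in>{p. prime p \<and> p \<le> n}. 1 / real p)"
proof -
  let ?T = "{p. prime p \<and> p \<le> n}"
  have fin: "finite ?T" by auto
  have powr1: "real m powr -1 = 1 / real m" for m by (simp add: powr_minus inverse_eq_divide)
  have "harm n = (\<Sum>m\<in>{1..n}. real m powr -1)" unfolding harm_eq_sum powr1 ..
  also have "\<dots> \<le> (\<Prod>p\<in>?T. 1 / (1 - real p powr -1))"
  proof (rule sum_smooth_le_prod)
    show "{1..n} \<subseteq> smooth_over ?T"
      by (auto simp: smooth_over_def in_prime_factors_iff dest!: dvd_imp_le)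
  qed auto
  also have "\<dots> \<le> exp (2 * (\<Sum>p\<in>?T. real p powr -1))" by (rule euler_factors_le_exp) auto
  finally have "harm n \<le> exp (2 * (\<Sum>p\<in>?T. 1 / real p))" unfolding powr1 .
  thus ?thesis using assms by (metis harm_pos_iff ln_exp ln_le_cancel_iff exp_gt_zero less_eq_Suc_le One_nat_def)
qed

lemma harm_le_ln: "n \<ge> 1 \<Longrightarrow> harm n \<le> 1 + ln (real n)"
proof -
  assume "n \<ge> 1"
  then obtain m where m: "n = Suc m" by (cases n) auto
  have "harm (Suc m) - ln (real (Suc m)) \<le> harm (Suc 0) - ln (real (Suc 0))"
    using decseqD[OF decseq_harm_diff_ln, of 0 m] by simp
  thus ?thesis using m by (simp add: harm_expand)
qed

text \<open>
  With \<open>Q\<close> a denominator of a good rational approximation to \<open>\<beta>\<close> and \<open>N\<close> about \<open>Q powr (1/5)\<close>, the set \<open>P\<close>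
  consists of the primes between \<open>Q\<^sup>2\<close> and \<open>2 ^ N\<close>.
\<close>

lemma prime_window:
  fixes \<beta> :: real and q K0 P0 :: nat and T0 :: real
  assumes "\<beta> \<notin> \<rat>" "q \<ge> 1"
  obtains P where "finite P" "\<And>p. p \<in> P \<Longrightarrow> prime p \<and> p > P0" "(\<Sum>p\<in>P. 1 / real p) \<ge> T0"
    "\<And>u \<sigma> k j. (\<And>p. p \<in> P \<Longrightarrow> norm (u p) \<le> 1) \<Longrightarrow> \<sigma> \<ge> 1 \<Longrightarrow> 1 \<le> k \<Longrightarrow> k \<le> K0 \<Longrightarrow>
      norm (\<Sum>p\<in>P. \<Sum>p'\<in>P. u p * u p' * of_real (real (p * p') powr -\<sigma>) *
        unit_exp (real k * (\<beta> + real j / real q) * real (p * p'))) \<le> 1"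
proof -
  define K where "K = max K0 1"
  \<comment> \<open>The final error is \<open>(1 + N)^4 * C / Q\<close>, the fourth power coming
    from the harmonic sum up to \<open>2 ^ N\<close>. With \<open>Q \<ge> N^5\<close> one power of N
    is to spare. The summands of C belong to 1 / W and to \<open>2 / (Q^2 * \<tau>)\<close>.\<close>
  define C where "C = real (4 * K * q + 4 * q)"
  have C: "C > 0" using assms by (simp add: C_def add_nonneg_pos)
  have "\<forall>\<^sub>F N in sequentially. (1 + real N) ^ 4 * C \<le> real N ^ 5"
    using C by real_asymp
  moreover have "\<forall>\<^sub>F N in sequentially. ln (real N / 2) / 2 - sqrt (2 * (1 + 20 * ln (real N + 1))) \<ge> T0"
    by real_asymp
  moreover have "\<forall>\<^sub>F N in sequentially. real N ^ 5 \<ge> real (P0 + 2 * K * q + 2)"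
    by real_asymp
  ultimately have "\<forall>\<^sub>F N in sequentially. (1 + real N) ^ 4 * C \<le> real N ^ 5 \<and>
     ln (real N / 2) / 2 - sqrt (2 * (1 + 20 * ln (real N + 1))) \<ge> T0 \<and> real N ^ 5 \<ge> real (P0 + 2 * K * q + 2)"
    by eventually_elim simp
  then obtain N0 where N0: "\<And>N. N \<ge> N0 \<Longrightarrow> (1 + real N) ^ 4 * C \<le> real N ^ 5 \<and>
     ln (real N / 2) / 2 - sqrt (2 * (1 + 20 * ln (real N + 1))) \<ge> T0 \<and> real N ^ 5 \<ge> real (P0 + 2 * K * q + 2)"
    by (auto simp: eventually_at_top_linorder)
  obtain Q where Q: "Q > N0 ^ 5" "\<And>d. 0 < d \<Longrightarrow> 2 * d \<le> Q \<Longrightarrow> norm (1 - unit_exp (\<beta> * real d)) \<ge> 1 / real Q"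
    using irrational_denominator[OF assms(1)] by metis
  have Q0: "Q > 0" using Q(1) by simp
  obtain N where N: "N ^ 5 \<le> Q" "Q < (N + 1) ^ 5"
  proof -
    have "Q < (Q + 1) ^ 5" using self_le_power[of "Q + 1" 5] by linarith
    hence ex: "\<exists>M. Q < M ^ 5" by blast
    define M where "M = (LEAST M. Q < M ^ 5)"
    have M: "Q < M ^ 5" unfolding M_def using ex by (rule LeastI_ex)
    hence "M \<noteq> 0" by (intro notI) simp
    hence "\<not> Q < (M - 1) ^ 5" unfolding M_def using not_less_Least[of "M - 1" "\<lambda>M. Q < M ^ 5"] M_def by auto
    with M \<open>M \<noteq> 0\<close> show ?thesis by (intro that[of "M - 1"]) auto
  qed
  have "N0 ^ 5 < (N + 1) ^ 5" using Q(1) N(2) by linarith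
  hence "N0 < N + 1" by (rule power_less_imp_less_base) simp
  hence NN0: "N \<ge> N0" by simp
  note N1 = N0[OF NN0]
  have NQ: "real N ^ 5 \<le> real Q" using N(1) by (metis of_nat_le_iff of_nat_power)
  have QK: "Q \<ge> P0 + 2 * K * q + 2" using N1 NQ by (metis of_nat_le_iff order_trans)
  have Npos: "N > 0" 
  proof (rule gr0I)
    assume "N = 0"
    with N1 have "real (P0 + 2 * K * q + 2) \<le> 0" by simp
    thus False by linarith
  qed
  \<comment> \<open>As 1 / \<tau> is of order Q, cutting at \<open>Q^2\<close> makes the error term
    \<open>2 / (Q^2 * \<tau>)\<close> of order 1 / Q.\<close>
  define P where "P = {p. prime p \<and> p \<le> 2 ^ N} - {p. prime p \<and> p \<le> Q ^ 2}"
  have P: "finite P" "P \<subseteq> {Q ^ 2..2 ^ N}" by (auto simp: P_def)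
  have QQ: "Q \<le> Q ^ 2" using Q0 by (simp add: power2_eq_square)
  have harmN: "harm (2 ^ N) \<le> 1 + real N"
  proof -
    have "harm (2 ^ N) \<le> 1 + ln (real (2 ^ N))" by (rule harm_le_ln) simp
    also have "ln (real (2 ^ N)) = real N * ln 2" by (simp add: ln_realpow)
    also have "\<dots> \<le> real N * 1" using ln_le_minus_one[of "2::real"] by (intro mult_left_mono) auto
    finally show ?thesis by simp
  qed
  show ?thesis
  proof (rule that[of P])
    show "finite P" by fact
    show "prime p \<and> p > P0" if "p \<in> P" for p using that QQ QK by (auto simp: P_def)
    have A: "(\<Sum>p\<in>{p. prime p \<and> p \<le> 2 ^ N}. 1 / real p) \<ge> ln (real N / 2) / 2"
    proof -
      have "real N / 2 \<le> harm (2 ^ N)"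
      proof -
        have "real N * (1 / 2) \<le> real N * ln 2" using ln2_ge_two_thirds by (intro mult_left_mono) auto
        also have "\<dots> = ln (real (2 ^ N))" by (simp add: ln_realpow)
        also have "\<dots> \<le> ln (real (2 ^ N) + 1)" by (rule ln_le_cancel_iff[THEN iffD2]) (simp_all add: add_pos_pos)
        also have "\<dots> \<le> harm (2 ^ N)" by (rule harm_ge_ln)
        finally show ?thesis by simp
      qed
      hence "ln (real N / 2) \<le> ln (harm (2 ^ N))" using Npos by simp
      also have "\<dots> \<le> 2 * (\<Sum>p\<in>{p. prime p \<and> p \<le> 2 ^ N}. 1 / real p)" by (rule prime_reciprocals_lower) simp
      finally show ?thesis by simp
    qed
    have B: "(\<Sum>p\<in>{p. prime p \<and> p \<le> Q ^ 2}. 1 / real p) \<le> sqrt (2 * (1 + 20 * ln (real N + 1)))"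
    proof (rule real_le_rsqrt)
      have "(\<Sum>p\<in>{p. prime p \<and> p \<le> Q ^ 2}. 1 / real p) ^ 2 \<le> 2 * harm ((Q ^ 2) ^ 2)"
        by (rule prime_reciprocals_upper)
      also have "harm ((Q ^ 2) ^ 2) \<le> 1 + ln (real ((Q ^ 2) ^ 2))" using Q0 by (intro harm_le_ln) simp
      also have "ln (real ((Q ^ 2) ^ 2)) = 4 * ln (real Q)" using Q0 by (simp add: ln_realpow)
      also have "ln (real Q) \<le> ln (real ((N + 1) ^ 5))" 
      proof -
        have "real Q \<le> real ((N + 1) ^ 5)" using N(2) by (metis less_imp_le of_nat_le_iff)
        thus ?thesis using Q0 by simp
      qed
      also have "\<dots> = 5 * ln (real N + 1)" by (simp add: ln_realpow add.commute)
      finally show "(\<Sum>p\<in>{p. prime p \<and> p \<le> Q ^ 2}. 1 / real p) ^ 2 \<le> 2 * (1 + 20 * ln (real N + 1))" by simp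
    qed
    show "(\<Sum>p\<in>P. 1 / real p) \<ge> T0"
    proof -
      have "(\<Sum>p\<in>{p. prime p \<and> p \<le> 2 ^ N}. 1 / real p) \<le> (\<Sum>p\<in>P \<union> {p. prime p \<and> p \<le> Q ^ 2}. 1 / real p)"
        by (intro sum_mono2) (auto simp: P_def)
      also have "\<dots> \<le> (\<Sum>p\<in>P. 1 / real p) + (\<Sum>p\<in>{p. prime p \<and> p \<le> Q ^ 2}. 1 / real p)"
        by (subst sum.union_disjoint) (auto simp: P_def)
      finally show ?thesis using A B N1 by linarith
    qed
    fix u :: "nat \<Rightarrow> complex" and \<sigma> :: real and k j :: nat
    assume u: "\<And>p. p \<in> P \<Longrightarrow> norm (u p) \<le> 1" and \<sigma>: "\<sigma> \<ge> 1" and k: "1 \<le> k" "k \<le> K0"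
    define \<gamma> where "\<gamma> = real k * (\<beta> + real j / real q)"
    \<comment> \<open>Chosen so that k * q * d \<le> Q / 2 for all d < W and k \<le> K, the range in
      which Q controls the multiples of \<beta>.\<close>
    define W where "W = Q div (2 * K * q)"
    define \<tau> where "\<tau> = 1 / (2 * real q * real Q)"
    have Kq: "K \<ge> 1" "q \<ge> 1" "k \<le> K" using assms k by (auto simp: K_def)
    have W1: "W \<ge> 1" using QK Kq by (auto simp: W_def div_greater_zero_iff Suc_le_eq)
    have WQ: "W \<le> Q ^ 2" using QQ unfolding W_def by (meson div_le_dividend order_trans)
    have Wlow: "real Q \<le> real W * real (4 * K * q)"
    proof -
      have "Q < 2 * K * q * (W + 1)"
        unfolding W_def using Kq by (metis Suc_eq_plus1 dividend_less_times_div mult_Suc_right nat_0_less_mult_iff not_one_le_zero zero_less_numeral gr0I add.commute)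
      also have "\<dots> \<le> 2 * K * q * (2 * W)" using W1 by (intro mult_left_mono) auto
      finally have "Q \<le> W * (4 * K * q)" by (simp add: mult_ac)
      thus ?thesis by (metis of_nat_le_iff of_nat_mult)
    qed
    have "norm (\<Sum>p\<in>P. \<Sum>p'\<in>P. u p * u p' * of_real (real (p * p') powr -\<sigma>) * unit_exp (\<gamma> * real (p * p'))) ^ 2
      \<le> harm (2 ^ N) ^ 4 * (1 / real W + 2 / (real (Q ^ 2) * \<tau>))"
    proof (rule bilinear_bound)
      show "\<tau> > 0" using Q0 Kq by (simp add: \<tau>_def)
      fix d :: nat assume d: "0 < d" "d < W"
      define D where "D = k * q * d"
      have "2 * D \<le> 2 * K * q * W" unfolding D_def using Kq d by (simp add: mult_mono)
      also have "\<dots> \<le> Q" unfolding W_def by simp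
      finally have D: "2 * D \<le> Q" .
      have "D > 0" using d Kq k by (simp add: D_def)
      \<comment> \<open>The q-th power removes the shift j / q, since k * j * d is an integer, and
        leaves a multiple of \<beta> alone. Returning from the q-th power costs a factor q, which
        accounts for the q in \<tau>.\<close>
      have "unit_exp (\<gamma> * real d) ^ q = unit_exp (\<beta> * real D + of_int (int (k * j * d)))"
      proof -
        have "real q * (\<gamma> * real d) = \<beta> * real D + of_int (int (k * j * d))"
          unfolding \<gamma>_def D_def using Kq by (simp add: field_simps)
        thus ?thesis unfolding unit_exp_power by (simp only:)
      qed
      also have "\<dots> = unit_exp (\<beta> * real D)" by (simp only: unit_exp_add unit_exp_of_int mult_1_right)
      finally have "norm (1 - unit_exp (\<gamma> * real d) ^ q) \<ge> 1 / real Q" using Q(2)[OF \<open>D > 0\<close> D] by simp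
      moreover have "norm (1 ^ q - unit_exp (\<gamma> * real d) ^ q) \<le> q * norm (1 - unit_exp (\<gamma> * real d))"
        by (rule norm_power_diff) auto
      ultimately show "norm (1 - unit_exp (\<gamma> * real d)) \<ge> 2 * \<tau>" 
      proof -
        assume "1 / real Q \<le> norm (1 - unit_exp (\<gamma> * real d) ^ q)"
          "norm (1 ^ q - unit_exp (\<gamma> * real d) ^ q) \<le> q * norm (1 - unit_exp (\<gamma> * real d))"
        hence "1 / real Q \<le> real q * norm (1 - unit_exp (\<gamma> * real d))" by simp
        thus ?thesis using Q0 Kq by (simp add: \<tau>_def field_simps)
      qed
    qed (use P u \<sigma> W1 WQ in auto)
    also have "\<dots> \<le> (1 + real N) ^ 4 * (C / real Q)"
    proof (rule mult_mono)
      have "1 / real W \<le> real (4 * K * q) / real Q" using Wlow W1 Q0 by (simp add: field_simps)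
      moreover have "2 / (real (Q ^ 2) * \<tau>) = real (4 * q) / real Q"
        using Q0 Kq by (simp add: \<tau>_def power2_eq_square field_simps)
      ultimately show "1 / real W + 2 / (real (Q ^ 2) * \<tau>) \<le> C / real Q" by (simp add: C_def add_divide_distrib)
    qed (use harmN harm_nonneg[where ?'a = real, of "2 ^ N"] Q0 in \<open>auto simp: \<tau>_def intro!: power_mono\<close>)
    also have "\<dots> \<le> 1"
    proof -
      have "(1 + real N) ^ 4 * C \<le> real Q" using N1 NQ by linarith
      thus ?thesis using Q0 by simp
    qed
    finally show "norm (\<Sum>p\<in>P. \<Sum>p'\<in>P. u p * u p' * of_real (real (p * p') powr -\<sigma>) *
        unit_exp (real k * (\<beta> + real j / real q) * real (p * p'))) \<le> 1"
      unfolding \<gamma>_def using power2_le_imp_le[of _ 1] by simp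
  qed
qed

section \<open>Separating a finite set of large primes\<close>

locale prime_split =
  fixes P0 :: nat and P :: "nat set"
  assumes P: "finite P" "\<And>p. p \<in> P \<Longrightarrow> prime p" "\<And>p. p \<in> P \<Longrightarrow> P0 < p"
begin

definition S :: "nat set" where "S = {p. prime p \<and> p \<le> P0}"

abbreviation Sm :: "nat set" where "Sm \<equiv> smooth_over S"

lemma P_pos: "p \<in> P \<Longrightarrow> p > 0"
  using P(2) prime_gt_0_nat by blast

lemma S: "finite S" "\<And>p. p \<in> S \<Longrightarrow> prime p" "S \<inter> P = {}"
proof -
  show "finite S" unfolding S_def by (rule finite_subset[of _ "{..P0}"]) auto
  show "prime p" if "p \<in> S" for p using that by (simp add: S_def)
  show "S \<inter> P = {}"
  proof (rule ccontr)
    assume "S \<inter> P \<noteq> {}"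
    then obtain p where "p \<in> S" "p \<in> P" by blast
    thus False using P(3)[of p] by (simp add: S_def)
  qed
qed

text \<open>The indices that contribute to the coefficient of \<open>w ^ j\<close> along
  \<open>ray\<close>.\<close>

definition layer :: "nat \<Rightarrow> nat set" where
  "layer j = {m \<in> smooth_over (S \<union> P). Omega_in P m = j}"

lemma layer_0: "layer 0 = Sm"
proof -
  have "Omega_in P m = 0 \<longleftrightarrow> prime_factors m \<inter> P = {}" for m
  proof -
    have "set_mset (filter_mset (\<lambda>p. p \<in> P) (prime_factorization m)) = prime_factors m \<inter> P" by auto
    thus ?thesis unfolding Omega_in_def by (metis set_mset_eq_empty_iff size_eq_0_iff_empty)
  qed
  thus ?thesis using S(3) unfolding layer_def smooth_over_def by blast
qed

lemma Omega_in_mult: "m > 0 \<Longrightarrow> n > 0 \<Longrightarrow> Omega_in P (m * n) = Omega_in P m + Omega_in P n"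
  by (simp add: Omega_in_def prime_factorization_mult)

lemma Omega_in_prime: "p \<in> P \<Longrightarrow> Omega_in P p = 1"
  using P(2) by (simp add: Omega_in_def prime_factorization_prime)

lemma layer_Suc: "layer (Suc j) = {p * k |p k. p \<in> P \<and> k \<in> layer j}"
proof (intro equalityI subsetI)
  fix m assume m: "m \<in> layer (Suc j)"
  hence m0: "m > 0" "prime_factors m \<subseteq> S \<union> P" "Omega_in P m = Suc j"
    by (auto simp: layer_def smooth_over_def)
  have "\<exists>p\<in>prime_factors m. p \<in> P"
  proof (rule ccontr)
    assume "\<not> ?thesis"
    hence "filter_mset (\<lambda>p. p \<in> P) (prime_factorization m) = {#}" by (auto simp: filter_mset_eq_conv)
    hence "Omega_in P m = 0" unfolding Omega_in_def by (simp only: size_empty)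
    thus False using m0(3) by simp
  qed
  then obtain p where p: "p \<in> P" "p \<in> prime_factors m" by blast
  then obtain k where k: "m = p * k" using in_prime_factors_imp_dvd by blast
  have pos: "p > 0" "k > 0" using k m0 by auto
  have "Omega_in P k = j" using Omega_in_mult[OF pos] Omega_in_prime[OF p(1)] m0(3) k by simp
  moreover have "prime_factors k \<subseteq> S \<union> P" using m0(2) k pos by (auto simp: prime_factorization_mult)
  ultimately show "m \<in> {p * k |p k. p \<in> P \<and> k \<in> layer j}" using k p pos by (auto simp: layer_def smooth_over_def)
next
  fix m assume "m \<in> {p * k |p k. p \<in> P \<and> k \<in> layer j}"
  then obtain p k where m: "m = p * k" "p \<in> P" "k \<in> layer j" by blast
  hence p: "prime p" and k: "k > 0" "prime_factors k \<subseteq> S \<union> P" "Omega_in P k = j"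
    using P(2) by (auto simp: layer_def smooth_over_def)
  have "p > 0" using p by (rule prime_gt_0_nat)
  hence "prime_factors m = insert p (prime_factors k)" "Omega_in P m = Suc j"
    using k m(2) p Omega_in_mult[of p k] Omega_in_prime[OF m(2)]
    by (simp_all add: m(1) prime_factorization_mult prime_factorization_prime)
  thus "m \<in> layer (Suc j)" using m(1,2) k \<open>p > 0\<close> by (simp add: layer_def smooth_over_def)
qed

definition pairs :: "(nat \<times> nat) set" where
  "pairs = {(p, p') \<in> P \<times> P. p \<le> p'}"

lemma finite_pairs: "finite pairs"
  using P(1) by (auto simp: pairs_def intro: finite_subset[of _ "P \<times> P"])

lemma prime_factors_in_P:
  assumes "p \<in> P" "p' \<in> P" "k \<in> Sm"
  shows "prime_factors (p * k) \<inter> P = {p}" "prime_factors (p * p' * k) \<inter> P = {p, p'}"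
proof -
  have "p > 0" "p' > 0" "k > 0" "prime_factors k \<inter> P = {}"
    using assms P_pos[of p] P_pos[of p'] S(3) by (auto simp: smooth_over_def)
  thus "prime_factors (p * k) \<inter> P = {p}" "prime_factors (p * p' * k) \<inter> P = {p, p'}"
    using assms P(2)[of p] P(2)[of p'] by (auto simp: prime_factorization_mult prime_factorization_prime)
qed

lemma bij_layer_1: "bij_betw (\<lambda>(p, k). p * k) (P \<times> Sm) (layer 1)"
proof (rule bij_betw_imageI)
  show "inj_on (\<lambda>(p, k). p * k) (P \<times> Sm)"
  proof (rule inj_onI, clarify)
    fix p k p' k' assume a: "p \<in> P" "k \<in> Sm" "p' \<in> P" "k' \<in> Sm" "p * k = p' * k'"
    have "{p} = {p'}" using prime_factors_in_P(1)[of p p k] prime_factors_in_P(1)[of p' p' k'] a by metis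
    thus "p = p' \<and> k = k'" using a P_pos[of p] by auto
  qed
  show "(\<lambda>(p, k). p * k) ` (P \<times> Sm) = layer 1"
    unfolding One_nat_def layer_Suc layer_0 by auto
qed

text \<open>The primes of P dividing p * p' * k are exactly p and p', because k has none; the
  ordering p \<le> p' then fixes the pair. Squares p = p' are included.\<close>

lemma bij_layer_2: "bij_betw (\<lambda>((p, p'), k). p * p' * k) (pairs \<times> Sm) (layer 2)"
proof (rule bij_betw_imageI)
  show "inj_on (\<lambda>((p, p'), k). p * p' * k) (pairs \<times> Sm)"
  proof (rule inj_onI, goal_cases)
    case (1 x x')
    obtain p1 p2 k q1 q2 l where x: "x = ((p1, p2), k)" "x' = ((q1, q2), l)" by (metis surj_pair)
    have a: "(p1, p2) \<in> pairs" "k \<in> Sm" "(q1, q2) \<in> pairs" "l \<in> Sm" "p1 * p2 * k = q1 * q2 * l"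
      using 1 by (auto simp: x)
    have "{p1, p2} = {q1, q2}"
      using prime_factors_in_P(2)[of p1 p2 k] prime_factors_in_P(2)[of q1 q2 l] a by (simp add: pairs_def)
    hence *: "p1 = q1" "p2 = q2" using a(1,3) by (auto simp: pairs_def doubleton_eq_iff)
    moreover have "p1 > 0" "p2 > 0" using a(1) P_pos[of p1] P_pos[of p2] by (auto simp: pairs_def)
    ultimately show ?case using a(5) by (simp add: x)
  qed
  have "layer 2 = {p * (p' * k) |p p' k. p \<in> P \<and> p' \<in> P \<and> k \<in> Sm}"
    unfolding numeral_2_eq_2 layer_Suc layer_0 by blast
  also have "\<dots> = (\<lambda>((p, p'), k). p * p' * k) ` (pairs \<times> Sm)"
  proof (intro equalityI subsetI)
    fix m assume "m \<in> {p * (p' * k) |p p' k. p \<in> P \<and> p' \<in> P \<and> k \<in> Sm}"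
    then obtain p p' k where m: "m = p * (p' * k)" "p \<in> P" "p' \<in> P" "k \<in> Sm" by blast
    show "m \<in> (\<lambda>((p, p'), k). p * p' * k) ` (pairs \<times> Sm)"
    proof (cases "p \<le> p'")
      case True
      thus ?thesis using m by (intro image_eqI[of _ _ "((p, p'), k)"]) (auto simp: pairs_def)
    next
      case False
      thus ?thesis using m by (intro image_eqI[of _ _ "((p', p), k)"]) (auto simp: pairs_def)
    qed
  next
    fix m assume "m \<in> (\<lambda>((p, p'), k). p * p' * k) ` (pairs \<times> Sm)"
    then obtain p p' k where m: "(p, p') \<in> pairs" "k \<in> Sm" "m = p * p' * k" by auto
    thus "m \<in> {p * (p' * k) |p p' k. p \<in> P \<and> p' \<in> P \<and> k \<in> Sm}"
      unfolding pairs_def mult.assoc by blast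
  qed
  finally show "(\<lambda>((p, p'), k). p * p' * k) ` (pairs \<times> Sm) = layer 2" by simp
qed

section \<open>Taylor coefficients along a ray in the prime variables\<close>

lemma infsum_finite_times:
  fixes f :: "'a \<Rightarrow> 'b \<Rightarrow> complex"
  assumes "finite A" "(\<lambda>(x, y). f x y) summable_on A \<times> B"
  shows "infsum (\<lambda>(x, y). f x y) (A \<times> B) = (\<Sum>x\<in>A. infsum (f x) B)"
proof -
  have "infsum (\<lambda>(x, y). f x y) (A \<times> B) = infsum (\<lambda>x. infsum (f x) B) A"
    by (rule infsum_Sigma'_banach[OF assms(2), symmetric])
  also have "\<dots> = (\<Sum>x\<in>A. infsum (f x) B)" by (rule infsum_finite[OF assms(1)])
  finally show ?thesis .
qed

text \<open>The inner sums over smooth numbers: along \<open>ray\<close> the constant coefficient is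
  the value at l = 1, and the linear coefficient is a linear form in the values at l in P.\<close>

definition Phi :: "(nat \<Rightarrow> complex) \<Rightarrow> (nat \<Rightarrow> complex) \<Rightarrow> real \<Rightarrow> nat \<Rightarrow> complex" where
  "Phi c y \<sigma> l = (\<Sum>\<^sub>\<infinity>k\<in>Sm. c (k * l) * cmul y k * of_real (real k powr -\<sigma>))"

text \<open>All primes outside P above P0 are set to 0, which the polydisc permits. The series then
  lives on integers composed of finitely many primes and is bounded by a finite Euler
  product.\<close>

definition ray :: "(nat \<Rightarrow> complex) \<Rightarrow> (nat \<Rightarrow> complex) \<Rightarrow> complex \<Rightarrow> nat \<Rightarrow> complex" where
  "ray y u w p = (if p \<in> P then w * u p else if p \<le> P0 then y p else 0)"

lemma cmul_S_cong:
  assumes "k \<in> Sm" "\<And>p. prime p \<Longrightarrow> p \<le> P0 \<Longrightarrow> y p = y' p"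
  shows "cmul y k = cmul y' k"
proof (rule cmul_cong, rule assms(2))
  fix p assume "p \<in> prime_factors k"
  hence "p \<in> S" using assms(1) by (auto simp: smooth_over_def)
  thus "prime p" "p \<le> P0" by (simp_all add: S_def)
qed

context
  fixes c y u :: "nat \<Rightarrow> complex" and \<sigma> :: real
  assumes c: "\<And>m. norm (c m) \<le> 1" and y: "\<And>p. prime p \<Longrightarrow> p \<le> P0 \<Longrightarrow> norm (y p) \<le> 1"
    and u: "\<And>p. p \<in> P \<Longrightarrow> norm (u p) \<le> 1" and \<sigma>: "\<sigma> > 1"
begin

lemma ray_le_1: "norm w \<le> 1 \<Longrightarrow> prime p \<Longrightarrow> norm (ray y u w p) \<le> 1"
proof -
  assume w: "norm w \<le> 1" and p: "prime p"
  consider "p \<in> P" | "p \<notin> P" "p \<le> P0" | "p \<notin> P" "p > P0" by linarith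
  thus ?thesis
  proof cases
    case 1
    thus ?thesis using w u by (simp add: ray_def norm_mult mult_le_one)
  next
    case 2
    thus ?thesis using y[OF p] by (simp add: ray_def)
  qed (simp add: ray_def)
qed

abbreviation (input) "ray_term \<equiv> \<lambda>m. c m * cmul (ray y u 1) m * of_real (real m powr -\<sigma>)"

lemma ray_alt: "ray y u w = (\<lambda>p. if p \<in> P then w * u p else if p \<le> P0 then y p else 0)"
  by (rule ext) (rule ray_def)

lemma ray_term_eq_0: "m \<notin> smooth_over (S \<union> P) \<Longrightarrow> ray_term m = 0"
proof (cases "m = 0")
  case False
  assume "m \<notin> smooth_over (S \<union> P)"
  then obtain p where p: "p \<in> prime_factors m" "p \<notin> S" "p \<notin> P" using False by (auto simp: smooth_over_def)
  hence "ray y u 1 p = 0" by (auto simp: ray_def S_def intro: in_prime_factors_imp_prime)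
  thus ?thesis using cmul_eq_0[OF p(1), of "ray y u 1"] by simp
qed auto

lemma ray_term_summable: "ray_term summable_on A"
proof -
  have "norm (ray y u 1 p) \<le> 1" if "prime p" for p by (rule ray_le_1) (simp_all add: that)
  from dser_summable[of c 1 "ray y u 1" \<sigma>, OF c this \<sigma>] have "ray_term summable_on UNIV" .
  thus ?thesis by (rule summable_on_subset_banach) simp
qed

lemma layer_sum: "(\<Sum>\<^sub>\<infinity>m\<in>{m. Omega_in P m = j}. ray_term m) = (\<Sum>\<^sub>\<infinity>m\<in>layer j. ray_term m)"
proof (rule infsum_cong_neutral)
  fix m assume "m \<in> {m. Omega_in P m = j} - layer j"
  hence "m \<notin> smooth_over (S \<union> P)" by (auto simp: layer_def)
  thus "ray_term m = 0" by (rule ray_term_eq_0)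
qed (auto simp: layer_def)

lemma cmul_ray_S: "k \<in> Sm \<Longrightarrow> cmul (ray y u 1) k = cmul y k"
proof (erule cmul_S_cong)
  fix p :: nat assume "p \<le> P0"
  moreover from this have "p \<notin> P" using P(3)[of p] by linarith
  ultimately show "ray y u 1 p = y p" by (simp add: ray_def)
qed

lemma sum_layer_0: "(\<Sum>\<^sub>\<infinity>m\<in>layer 0. ray_term m) = Phi c y \<sigma> 1"
  unfolding layer_0 Phi_def by (intro infsum_cong) (simp add: cmul_ray_S)

lemma sum_layer_1: "(\<Sum>\<^sub>\<infinity>m\<in>layer 1. ray_term m) = (\<Sum>p\<in>P. u p * of_real (real p powr -\<sigma>) * Phi c y \<sigma> p)"
proof -
  let ?g = "\<lambda>p k. u p * of_real (real p powr -\<sigma>) * (c (k * p) * cmul y k * of_real (real k powr -\<sigma>))"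
  have eq: "ray_term (p * k) = ?g p k" if "p \<in> P" "k \<in> Sm" for p k
  proof -
    have pp: "prime p" using that P(2) by simp
    have "p > 0" "k > 0" using that(2) prime_gt_0_nat[OF pp] by (auto simp: smooth_over_def)
    hence "cmul (ray y u 1) (p * k) = u p * cmul y k"
      using cmul_mult[of p k "ray y u 1"] cmul_prime[OF pp] cmul_ray_S[OF that(2)] that(1) by (simp add: ray_def)
    moreover have "real (p * k) powr -\<sigma> = real p powr -\<sigma> * real k powr -\<sigma>" by (simp add: powr_mult)
    moreover have "c (p * k) = c (k * p)" by (simp add: mult.commute)
    ultimately show ?thesis by (simp only: of_real_mult mult_ac)
  qed
  have "((\<lambda>(p, k). ray_term (p * k)) summable_on P \<times> Sm) = (ray_term summable_on layer 1)"
    using summable_on_reindex_bij_betw[OF bij_layer_1, of ray_term] by (simp add: case_prod_unfold)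
  hence "(\<lambda>(p, k). ray_term (p * k)) summable_on P \<times> Sm" using ray_term_summable by simp
  also have "?this \<longleftrightarrow> (\<lambda>(p, k). ?g p k) summable_on P \<times> Sm"
  proof (rule summable_on_cong)
    fix z assume "z \<in> P \<times> Sm"
    then obtain p k where "z = (p, k)" "p \<in> P" "k \<in> Sm" by auto
    thus "(case z of (p, k) \<Rightarrow> ray_term (p * k)) = (case z of (p, k) \<Rightarrow> ?g p k)" using eq by simp
  qed
  finally have summ: "(\<lambda>(p, k). ?g p k) summable_on P \<times> Sm" .
  have "(\<Sum>\<^sub>\<infinity>m\<in>layer 1. ray_term m) = (\<Sum>\<^sub>\<infinity>(p, k)\<in>P \<times> Sm. ray_term (p * k))"
    using infsum_reindex_bij_betw[OF bij_layer_1, of ray_term] by (simp add: case_prod_unfold)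
  also have "\<dots> = (\<Sum>\<^sub>\<infinity>(p, k)\<in>P \<times> Sm. ?g p k)" 
  proof (rule infsum_cong)
    fix z assume "z \<in> P \<times> Sm"
    then obtain p k where "z = (p, k)" "p \<in> P" "k \<in> Sm" by auto
    thus "(case z of (p, k) \<Rightarrow> ray_term (p * k)) = (case z of (p, k) \<Rightarrow> ?g p k)" using eq by simp
  qed
  also have "\<dots> = (\<Sum>p\<in>P. \<Sum>\<^sub>\<infinity>k\<in>Sm. ?g p k)" by (rule infsum_finite_times[OF P(1) summ])
  also have "\<dots> = (\<Sum>p\<in>P. u p * of_real (real p powr -\<sigma>) * Phi c y \<sigma> p)"
    unfolding Phi_def by (intro sum.cong refl infsum_cmult_right')
  finally show ?thesis .
qed

text \<open>Doubling the sum over pairs p \<le> p' gives the full bilinear form plus its diagonal.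
  The sum over k is placed outside so that the bilinear estimate can be used for each k
  separately.\<close>

lemma sum_layer_2: "2 * (\<Sum>\<^sub>\<infinity>m\<in>layer 2. ray_term m) = (\<Sum>\<^sub>\<infinity>k\<in>Sm. cmul y k * of_real (real k powr -\<sigma>) *
     ((\<Sum>p\<in>P. \<Sum>p'\<in>P. u p * u p' * of_real (real (p * p') powr -\<sigma>) * c (k * (p * p'))) +
      (\<Sum>p\<in>P. u p * u p * of_real (real (p * p) powr -\<sigma>) * c (k * (p * p)))))"
proof -
  let ?h = "\<lambda>k p p'. u p * u p' * of_real (real (p * p') powr -\<sigma>) * c (k * (p * p'))"
  let ?g = "\<lambda>k (p, p'). cmul y k * of_real (real k powr -\<sigma>) * ?h k p p'"
  have eq: "ray_term (p * p' * k) = ?g k (p, p')" if "(p, p') \<in> pairs" "k \<in> Sm" for p p' k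
  proof -
    have pp: "prime p" "prime p'" "p \<in> P" "p' \<in> P" using that(1) P(2) by (auto simp: pairs_def)
    have pos: "p > 0" "p' > 0" "k > 0" using that(2) prime_gt_0_nat pp(1,2) by (auto simp: smooth_over_def)
    have "real (p * p' * k) powr -\<sigma> = real (p * p') powr -\<sigma> * real k powr -\<sigma>" by (simp add: powr_mult)
    moreover have "cmul (ray y u 1) (p * p' * k) = u p * u p' * cmul y k"
    proof -
      have "cmul (ray y u 1) (p * p' * k) = cmul (ray y u 1) p * cmul (ray y u 1) p' * cmul (ray y u 1) k"
        using pos by (simp only: cmul_mult mult_eq_0_iff neq0_conv de_Morgan_disj)
      thus ?thesis using cmul_prime[OF pp(1)] cmul_prime[OF pp(2)] cmul_ray_S[OF that(2)] pp(3,4) by (simp add: ray_def)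
    qed
    moreover have "c (p * p' * k) = c (k * (p * p'))" by (simp add: mult_ac)
    ultimately show ?thesis by (simp only: of_real_mult prod.case mult_ac)
  qed
  have "((\<lambda>((p, p'), k). ray_term (p * p' * k)) summable_on pairs \<times> Sm) = (ray_term summable_on layer 2)"
    using summable_on_reindex_bij_betw[OF bij_layer_2, of ray_term] by (simp add: case_prod_unfold)
  hence "(\<lambda>((p, p'), k). ray_term (p * p' * k)) summable_on pairs \<times> Sm" using ray_term_summable by simp
  also have "?this \<longleftrightarrow> (\<lambda>(x, k). ?g k x) summable_on pairs \<times> Sm"
  proof (rule summable_on_cong)
    fix z assume "z \<in> pairs \<times> Sm"
    then obtain p p' k where "z = ((p, p'), k)" "(p, p') \<in> pairs" "k \<in> Sm" by auto
    thus "(\<lambda>((p, p'), k). ray_term (p * p' * k)) z = (\<lambda>(x, k). ?g k x) z" using eq by simp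
  qed
  finally have summ: "(\<lambda>(x, k). ?g k x) summable_on pairs \<times> Sm" .
  have "(\<Sum>\<^sub>\<infinity>m\<in>layer 2. ray_term m) = (\<Sum>\<^sub>\<infinity>((p, p'), k)\<in>pairs \<times> Sm. ray_term (p * p' * k))"
    using infsum_reindex_bij_betw[OF bij_layer_2, of ray_term] by (simp add: case_prod_unfold)
  also have "\<dots> = (\<Sum>\<^sub>\<infinity>(x, k)\<in>pairs \<times> Sm. ?g k x)"
  proof (rule infsum_cong)
    fix z assume "z \<in> pairs \<times> Sm"
    then obtain p p' k where "z = ((p, p'), k)" "(p, p') \<in> pairs" "k \<in> Sm" by auto
    thus "(\<lambda>((p, p'), k). ray_term (p * p' * k)) z = (\<lambda>(x, k). ?g k x) z" using eq by simp
  qed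
  also have "\<dots> = (\<Sum>\<^sub>\<infinity>x\<in>pairs. \<Sum>\<^sub>\<infinity>k\<in>Sm. ?g k x)"
    by (rule infsum_Sigma'_banach[OF summ, symmetric])
  also have "\<dots> = (\<Sum>\<^sub>\<infinity>k\<in>Sm. \<Sum>\<^sub>\<infinity>x\<in>pairs. ?g k x)"
    by (rule infsum_swap_banach[OF summ])
  also have "\<dots> = (\<Sum>\<^sub>\<infinity>k\<in>Sm. \<Sum>x\<in>pairs. ?g k x)"
    using finite_pairs by (simp only: infsum_finite)
  finally have "2 * (\<Sum>\<^sub>\<infinity>m\<in>layer 2. ray_term m) = (\<Sum>\<^sub>\<infinity>k\<in>Sm. 2 * (\<Sum>x\<in>pairs. ?g k x))"
    by (simp only: infsum_cmult_right')
  also have "\<dots> = (\<Sum>\<^sub>\<infinity>k\<in>Sm. cmul y k * of_real (real k powr -\<sigma>) * ((\<Sum>p\<in>P. \<Sum>p'\<in>P. ?h k p p') + (\<Sum>p\<in>P. ?h k p p)))"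
  proof (rule infsum_cong)
    fix k
    have "2 * (\<Sum>(p, p')\<in>pairs. ?h k p p') = (\<Sum>p\<in>P. \<Sum>p'\<in>P. ?h k p p') + (\<Sum>p\<in>P. ?h k p p)"
      unfolding pairs_def by (rule sum_ordered_pairs[OF P(1)]) (simp add: mult_ac)
    hence "cmul y k * of_real (real k powr -\<sigma>) * ((\<Sum>p\<in>P. \<Sum>p'\<in>P. ?h k p p') + (\<Sum>p\<in>P. ?h k p p))
        = cmul y k * of_real (real k powr -\<sigma>) * (2 * (\<Sum>(p, p')\<in>pairs. ?h k p p'))" by (simp only:)
    also have "\<dots> = 2 * (cmul y k * of_real (real k powr -\<sigma>) * (\<Sum>(p, p')\<in>pairs. ?h k p p'))"
      by (rule mult.left_commute)
    also have "cmul y k * of_real (real k powr -\<sigma>) * (\<Sum>(p, p')\<in>pairs. ?h k p p') = (\<Sum>x\<in>pairs. ?g k x)"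
      by (simp only: sum_distrib_left case_prod_unfold)
    finally show "2 * (\<Sum>x\<in>pairs. ?g k x) = cmul y k * of_real (real k powr -\<sigma>) * ((\<Sum>p\<in>P. \<Sum>p'\<in>P. ?h k p p') + (\<Sum>p\<in>P. ?h k p p))" ..
  qed
  finally show ?thesis .
qed

lemma derivs_ray:
  defines "f \<equiv> \<lambda>w. dser c (ray y u w) \<sigma>"
  shows "f holomorphic_on ball 0 1" "f 0 = (\<Sum>\<^sub>\<infinity>m\<in>layer 0. ray_term m)" "deriv f 0 = (\<Sum>\<^sub>\<infinity>m\<in>layer 1. ray_term m)"
    "deriv (deriv f) 0 = 2 * (\<Sum>\<^sub>\<infinity>m\<in>layer 2. ray_term m)"
proof -
  note D = dser_disc[of c 1 P "\<lambda>p. if p \<le> P0 then y p else 0" u \<sigma>]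
  have y': "norm (if p \<le> P0 then y p else 0) \<le> 1" if "prime p" "p \<notin> P" for p
    using y[OF that(1)] by (cases "p \<le> P0") simp_all
  have u': "norm (u p) \<le> 1" if "prime p" "p \<in> P" for p using u[OF that(2)] .
  note prems = c y' u' \<sigma>
  have f: "f = (\<lambda>w. dser c (\<lambda>p. if p \<in> P then w * u p else if p \<le> P0 then y p else 0) \<sigma>)"
    unfolding f_def ray_alt ..
  have 1: "(\<lambda>p. if p \<in> P then u p else if p \<le> P0 then y p else 0) = ray y u 1" unfolding ray_alt by (simp only: mult_1)
  have 2: "(deriv ^^ j) f 0 = fact j * (\<Sum>\<^sub>\<infinity>m\<in>layer j. ray_term m)" for j
    unfolding f layer_sum[symmetric] using D(3)[OF prems, of j] unfolding 1 .
  show "f holomorphic_on ball 0 1" unfolding f by (rule D(2)[OF prems])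
  show "f 0 = (\<Sum>\<^sub>\<infinity>m\<in>layer 0. ray_term m)" using 2[of 0] by simp
  show "deriv f 0 = (\<Sum>\<^sub>\<infinity>m\<in>layer 1. ray_term m)" using 2[of 1] by simp
  show "deriv (deriv f) 0 = 2 * (\<Sum>\<^sub>\<infinity>m\<in>layer 2. ray_term m)" using 2[of 2] by (simp add: numeral_2_eq_2)
qed

end

end

lemma infsum_finite_sum:
  fixes f :: "'a \<Rightarrow> 'b \<Rightarrow> 'c :: banach"
  assumes "finite A" "\<And>x. x \<in> A \<Longrightarrow> f x summable_on B"
  shows "(\<Sum>\<^sub>\<infinity>k\<in>B. \<Sum>x\<in>A. f x k) = (\<Sum>x\<in>A. infsum (f x) B)"
proof -
  have "((\<lambda>k. \<Sum>x\<in>A. f x k) has_sum (\<Sum>x\<in>A. infsum (f x) B)) B"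
    using assms by (induction A rule: finite_induct) (auto intro!: has_sum_add has_sum_infsum)
  thus ?thesis by (rule infsumI)
qed

section \<open>The linear coefficient: upper bound on the torus and transfer to the polydisc\<close>

context prime_split
begin

definition weight :: "real \<Rightarrow> real" where
  "weight \<sigma> = (\<Sum>p\<in>P. real p powr -\<sigma>)"

text \<open>Taken at exponent 1 to be a majorant for all \<sigma> > 1; it depends on P0 only, not on
  P.\<close>

definition smooth_mass :: real where
  "smooth_mass = (\<Sum>\<^sub>\<infinity>k\<in>Sm. real k powr -1)"

lemma smooth_mass: "(\<lambda>k. real k powr -1) summable_on Sm" "smooth_mass \<ge> 0"
  using smooth_summable(1)[OF S(1,2), of 1] by (auto simp: smooth_mass_def intro!: infsum_nonneg)

text \<open>The source of the estimate O(W) for ln (sup |f|): the Euler product over S and P is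
  exponential in the weight of P, and the contribution of S is a constant.\<close>

lemma norm_dser_ray_le:
  assumes c: "\<And>m. norm (c m) \<le> 1" and y: "\<And>p. prime p \<Longrightarrow> p \<le> P0 \<Longrightarrow> norm (y p) \<le> 1"
    and u: "\<And>p. p \<in> P \<Longrightarrow> norm (u p) \<le> 1" and \<sigma>: "\<sigma> > 1" and w: "norm w \<le> 1"
  shows "norm (dser c (ray y u w) \<sigma>) \<le> exp (2 * ((\<Sum>p\<in>S. 1 / real p) + weight \<sigma>))"
proof -
  let ?T = "S \<union> P" and ?t = "\<lambda>m. c m * cmul (ray y u w) m * of_real (real m powr -\<sigma>)"
  have r: "norm (ray y u w p) \<le> 1" if "prime p" for p by (rule ray_le_1[OF c y u \<sigma> w that])
  have T: "finite ?T" "\<And>p. p \<in> ?T \<Longrightarrow> prime p" using S P by auto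
  have \<sigma>0: "\<sigma> > 0" using \<sigma> by simp
  have z: "?t m = 0" if "m \<notin> smooth_over ?T" for m
  proof (cases "m = 0")
    case False
    hence "\<not> prime_factors m \<subseteq> S \<union> P" using that by (simp add: smooth_over_def)
    then obtain p where p: "p \<in> prime_factors m" "p \<notin> S" "p \<notin> P" by blast
    have "prime p" using p(1) by (rule in_prime_factors_imp_prime)
    hence "ray y u w p = 0" using p by (simp add: ray_def S_def)
    from cmul_eq_0[OF p(1), of "ray y u w", OF this] show ?thesis by simp
  qed simp
  have "dser c (ray y u w) \<sigma> = infsum ?t (smooth_over ?T)"
    unfolding dser_def by (rule infsum_cong_neutral) (use z in auto)
  also have "norm \<dots> \<le> (\<Sum>\<^sub>\<infinity>m\<in>smooth_over ?T. real m powr -\<sigma>)"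
  proof (rule norm_infsum_le[OF has_sum_infsum has_sum_infsum])
    have "?t summable_on UNIV" by (rule dser_summable[of c 1 "ray y u w" \<sigma>, OF c r \<sigma>])
    thus "?t summable_on smooth_over ?T" by (rule summable_on_subset_banach) simp
    show "(\<lambda>m. real m powr -\<sigma>) summable_on smooth_over ?T" by (rule smooth_summable(1)[OF T \<sigma>0])
    show "norm (?t m) \<le> real m powr -\<sigma>" for m
      using dser_term_bound[of c m 1 "ray y u w" \<sigma>, OF c r] by simp
  qed
  also have "\<dots> \<le> (\<Prod>p\<in>?T. 1 / (1 - real p powr -\<sigma>))" by (rule smooth_summable(2)[OF T \<sigma>0])
  also have "\<dots> \<le> exp (2 * (\<Sum>p\<in>?T. real p powr -\<sigma>))" by (rule euler_factors_le_exp[OF T]) (use \<sigma> in auto)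
  also have "(\<Sum>p\<in>?T. real p powr -\<sigma>) = (\<Sum>p\<in>S. real p powr -\<sigma>) + weight \<sigma>"
    unfolding weight_def using S P(1) by (intro sum.union_disjoint) auto
  also have "(\<Sum>p\<in>S. real p powr -\<sigma>) \<le> (\<Sum>p\<in>S. 1 / real p)"
  proof (rule sum_mono)
    fix p assume "p \<in> S"
    hence "p > 0" using S(2) prime_gt_0_nat by blast
    thus "real p powr -\<sigma> \<le> 1 / real p" using \<sigma> powr_mono[of "-\<sigma>" "-1" "real p"] by (simp add: powr_minus inverse_eq_divide)
  qed
  finally show ?thesis by simp
qed

text \<open>In the second derivative, indices k \<le> K0 contribute a bilinear form of size at most
  1. For k > K0 the form is bounded trivially by the square of the weight, but those k carry total
  mass at most \<epsilon>. The diagonal costs one factor of the weight. The only quadratic term left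
  therefore has the factor \<epsilon>.\<close>

lemma linear_term_bound:
  assumes c: "\<And>m. norm (c m) \<le> 1" and y: "\<And>p. prime p \<Longrightarrow> p \<le> P0 \<Longrightarrow> norm (y p) = 1"
    and u: "\<And>p. p \<in> P \<Longrightarrow> norm (u p) \<le> 1" and \<sigma>: "\<sigma> > 1"
    and nz: "\<And>z. (\<And>p. prime p \<Longrightarrow> p \<le> P0 \<Longrightarrow> norm (z p) = 1) \<Longrightarrow>
        (\<And>p. prime p \<Longrightarrow> p > P0 \<Longrightarrow> norm (z p) \<le> 1) \<Longrightarrow> dser c z \<sigma> \<noteq> 0"
    and bilin: "\<And>k. 1 \<le> k \<Longrightarrow> k \<le> K0 \<Longrightarrow>
      norm (\<Sum>p\<in>P. \<Sum>p'\<in>P. u p * u p' * of_real (real (p * p') powr -\<sigma>) * c (k * (p * p'))) \<le> 1"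
    and tail: "(\<Sum>\<^sub>\<infinity>k\<in>Sm \<inter> {K0<..}. real k powr -1) \<le> \<epsilon>"
  defines "E \<equiv> smooth_mass"
  shows "norm (\<Sum>p\<in>P. u p * of_real (real p powr -\<sigma>) * Phi c y \<sigma> p) ^ 2
     \<le> E ^ 2 * (1 + weight \<sigma>) + E * \<epsilon> * weight \<sigma> ^ 2 + 64 * ((\<Sum>p\<in>S. 1 / real p) + weight \<sigma>) * E ^ 2 + 32 * E"
proof -
  let ?t = "\<lambda>m. c m * cmul (ray y u 1) m * of_real (real m powr -\<sigma>)"
  define s0 where "s0 = (\<Sum>p\<in>S. 1 / real p)"
  define W where "W = weight \<sigma>"
  have s0: "s0 \<ge> 0" "W \<ge> 0" by (auto simp: s0_def W_def weight_def intro!: sum_nonneg)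
  have E0: "E \<ge> 0" unfolding E_def by (rule smooth_mass(2))
  have y1: "norm (y p) \<le> 1" if "prime p" "p \<le> P0" for p using y[OF that] by simp
  define f where "f = (\<lambda>w. dser c (ray y u w) \<sigma>)"
  note D = derivs_ray[of c y u \<sigma>, OF c y1 u \<sigma>, folded f_def]
  have f0: "f 0 = Phi c y \<sigma> 1" unfolding f_def using D(2) sum_layer_0[of c y u \<sigma>, OF c y1 u \<sigma>] by simp
  have f1: "deriv f 0 = (\<Sum>p\<in>P. u p * of_real (real p powr -\<sigma>) * Phi c y \<sigma> p)"
    using D(3) sum_layer_1[of c y u \<sigma>, OF c y1 u \<sigma>] by simp
  define B where "B = (\<lambda>k. (\<Sum>p\<in>P. \<Sum>p'\<in>P. u p * u p' * of_real (real (p * p') powr -\<sigma>) * c (k * (p * p'))))"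
  define Dg where "Dg = (\<lambda>k. (\<Sum>p\<in>P. u p * u p * of_real (real (p * p) powr -\<sigma>) * c (k * (p * p))))"
  have f2: "deriv (deriv f) 0 = (\<Sum>\<^sub>\<infinity>k\<in>Sm. cmul y k * of_real (real k powr -\<sigma>) * (B k + Dg k))"
    unfolding B_def Dg_def by (rule trans[OF D(4) sum_layer_2[of c y u \<sigma>, OF c y1 u \<sigma>]])
  have fnz: "f w \<noteq> 0" if w: "norm w \<le> 1" for w
    unfolding f_def
  proof (rule nz)
    fix p :: nat assume p: "prime p"
    show "norm (ray y u w p) \<le> 1" by (rule ray_le_1[OF c y1 u \<sigma> w p])
    assume "p \<le> P0"
    hence "p \<notin> P" using P(3)[of p] by auto
    thus "norm (ray y u w p) = 1" using y[OF p \<open>p \<le> P0\<close>] \<open>p \<le> P0\<close> by (simp add: ray_def)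
  qed
  have powr1: "real k powr -\<sigma> \<le> real k powr -1" if "k \<in> Sm" for k
    using that \<sigma> by (intro powr_mono) (auto simp: smooth_over_def)
  have cm: "norm (cmul y k) \<le> 1" if "k \<in> Sm" for k
  proof -
    have "cmul y k = cmul (\<lambda>p. if p \<le> P0 then y p else 0) k" by (rule cmul_S_cong[OF that]) simp
    also have "norm \<dots> \<le> 1" by (rule norm_cmul_le_1) (use y1 in auto)
    finally show ?thesis .
  qed
  have E_sum: "((\<lambda>k. real k powr -1) has_sum E) Sm" unfolding E_def smooth_mass_def using smooth_mass(1) by (rule has_sum_infsum)
  have f0E: "norm (f 0) \<le> E"
  proof -
    have b: "norm (c (k * 1) * cmul y k * of_real (real k powr -\<sigma>)) \<le> real k powr -1" if "k \<in> Sm" for k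
    proof -
      have "norm (c (k * 1)) * norm (cmul y k) * real k powr -\<sigma> \<le> 1 * 1 * real k powr -1"
        using powr1[OF that] cm[OF that] c by (intro mult_mono) auto
      thus ?thesis by (simp add: norm_mult)
    qed
    have "(\<lambda>k. c (k * 1) * cmul y k * of_real (real k powr -\<sigma>)) summable_on Sm"
      by (rule abs_summable_summable, rule Infinite_Sum.abs_summable_on_comparison_test'[OF smooth_mass(1)]) (rule b)
    from norm_infsum_le[OF has_sum_infsum[OF this] E_sum b] show ?thesis unfolding f0 Phi_def by simp
  qed
  have f0nz: "norm (f 0) > 0" using fnz[of 0] by simp
  have f2E: "norm (deriv (deriv f) 0) \<le> E * (1 + W) + \<epsilon> * W ^ 2"
  proof -
    have a: "norm (u p * u p' * of_real (real (p * p') powr -\<sigma>) * c (k * (p * p'))) \<le> real p powr -\<sigma> * real p' powr -\<sigma>"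
      if "p \<in> P" "p' \<in> P" for p p' k
    proof -
      have "norm (u p) * norm (u p') * (real p powr -\<sigma> * real p' powr -\<sigma>) * norm (c (k * (p * p')))
          \<le> 1 * 1 * (real p powr -\<sigma> * real p' powr -\<sigma>) * 1"
        using u that c by (intro mult_mono) auto
      thus ?thesis by (simp add: norm_mult powr_mult)
    qed
    have B: "norm (B k) \<le> W ^ 2" for k
    proof -
      have "norm (B k) \<le> (\<Sum>p\<in>P. \<Sum>p'\<in>P. real p powr -\<sigma> * real p' powr -\<sigma>)"
        unfolding B_def by (intro sum_norm_le a)
      thus ?thesis by (simp add: W_def weight_def power2_eq_square sum_product)
    qed
    have Dg: "norm (Dg k) \<le> W" for k
    proof -
      have "norm (Dg k) \<le> (\<Sum>p\<in>P. real p powr -\<sigma>)"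
        unfolding Dg_def
      proof (rule sum_norm_le)
        fix p assume p: "p \<in> P"
        have "real p powr -\<sigma> \<le> real p powr 0" using P_pos[OF p] \<sigma> by (intro powr_mono) auto
        hence "real p powr -\<sigma> * real p powr -\<sigma> \<le> 1 * real p powr -\<sigma>" using P_pos[OF p] by (intro mult_right_mono) auto
        thus "norm (u p * u p * of_real (real (p * p) powr -\<sigma>) * c (k * (p * p))) \<le> real p powr -\<sigma>"
          using a[OF p p, of k] by linarith
      qed
      thus ?thesis by (simp add: W_def weight_def)
    qed
    let ?g = "\<lambda>k. real k powr -1 * (1 + W) + (if k > K0 then real k powr -1 * W ^ 2 else 0)"
    have dist: "1 * x * (v + (if b then v' else 0)) = x * v + (if b then x * v' else 0)" for x v v' :: real and b
      by (cases b) (simp_all add: distrib_left)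
    have b: "norm (cmul y k * of_real (real k powr -\<sigma>) * (B k + Dg k)) \<le> ?g k" if k: "k \<in> Sm" for k
    proof -
      have BD: "norm (B k + Dg k) \<le> (1 + W) + (if k > K0 then W ^ 2 else 0)"
      proof (cases "k > K0")
        case True
        thus ?thesis using norm_triangle_ineq[of "B k" "Dg k"] B[of k] Dg[of k] by simp
      next
        case False
        have "norm (B k) \<le> 1" unfolding B_def by (rule bilin) (use False k in \<open>auto simp: smooth_over_def\<close>)
        thus ?thesis using False norm_triangle_ineq[of "B k" "Dg k"] Dg[of k] by simp
      qed
      have "norm (cmul y k) * real k powr -\<sigma> * norm (B k + Dg k) \<le> 1 * real k powr -1 * ((1 + W) + (if k > K0 then W ^ 2 else 0))"
        using cm[OF k] powr1[OF k] BD by (intro mult_mono) auto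
      also have "\<dots> = ?g k" by (rule dist)
      finally show ?thesis by (simp add: norm_mult)
    qed
    have g1: "((\<lambda>k. real k powr -1 * (1 + W)) has_sum E * (1 + W)) Sm" by (rule has_sum_cmult_left[OF E_sum])
    have g2: "((\<lambda>k. if k > K0 then real k powr -1 * W ^ 2 else 0) has_sum
        (\<Sum>\<^sub>\<infinity>k\<in>Sm \<inter> {K0<..}. real k powr -1) * W ^ 2) Sm"
    proof -
      have "((\<lambda>k. real k powr -1 * W ^ 2) has_sum (\<Sum>\<^sub>\<infinity>k\<in>Sm \<inter> {K0<..}. real k powr -1) * W ^ 2) (Sm \<inter> {K0<..})"
        by (intro has_sum_cmult_left has_sum_infsum summable_on_subset_banach[OF smooth_mass(1)]) simp
      thus ?thesis by (subst has_sum_cong_neutral[where T = "Sm \<inter> {K0<..}" and g = "\<lambda>k. real k powr -1 * W ^ 2"]) auto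
    qed
    have "norm (deriv (deriv f) 0) \<le> E * (1 + W) + (\<Sum>\<^sub>\<infinity>k\<in>Sm \<inter> {K0<..}. real k powr -1) * W ^ 2"
      unfolding f2
    proof (rule norm_infsum_le[OF has_sum_infsum has_sum_add[OF g1 g2] b])
      show "(\<lambda>k. cmul y k * of_real (real k powr -\<sigma>) * (B k + Dg k)) summable_on Sm"
        by (rule abs_summable_summable, rule Infinite_Sum.abs_summable_on_comparison_test'[OF has_sum_imp_summable[OF has_sum_add[OF g1 g2]]]) (rule b)
    qed
    also have "\<dots> \<le> E * (1 + W) + \<epsilon> * W ^ 2" using tail by (intro add_left_mono mult_right_mono) auto
    finally show ?thesis .
  qed
  \<comment> \<open>No lower bound for |f 0| is available. The summand \<open>1 / norm (f 0)\<close>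
    ensures \<open>1 \<le> norm (f 0) * exp K\<close>, and since K is later multiplied by
    \<open>norm (f 0) ^ 2\<close>, it contributes only \<open>32 * norm (f 0)\<close>.\<close>
  define K where "K = 2 * (s0 + W) + 1 / norm (f 0)"
  have "norm (deriv f 0) ^ 2 \<le> norm (f 0) * norm (deriv (deriv f) 0) + 32 * K * norm (f 0) ^ 2"
  proof (rule second_coefficient_bound[OF D(1)])
    show "f w \<noteq> 0" if "w \<in> ball 0 1" for w using fnz[of w] that by simp
    show "K > 0" using s0 f0nz unfolding K_def by (intro add_nonneg_pos) auto
    fix w :: complex assume w: "w \<in> ball 0 1"
    have "norm (f w) \<le> exp (2 * (s0 + W))"
      unfolding f_def s0_def W_def using w by (intro norm_dser_ray_le[OF c y1 u \<sigma>]) auto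
    also have "\<dots> \<le> norm (f 0) * exp (1 / norm (f 0)) * exp (2 * (s0 + W))"
    proof -
      have "1 / norm (f 0) \<le> exp (1 / norm (f 0))" using exp_ge_add_one_self[of "1 / norm (f 0)"] by linarith
      hence "1 \<le> norm (f 0) * exp (1 / norm (f 0))" using f0nz by (simp add: field_simps)
      thus ?thesis using mult_right_mono[of 1 "norm (f 0) * exp (1 / norm (f 0))" "exp (2 * (s0 + W))"] by simp
    qed
    also have "\<dots> = norm (f 0) * exp K" by (simp add: K_def exp_add mult_ac)
    finally show "norm (f w) \<le> norm (f 0) * exp K" .
  qed
  also have "32 * K * norm (f 0) ^ 2 = 64 * (s0 + W) * norm (f 0) ^ 2 + 32 * norm (f 0)"
    using f0nz by (simp add: K_def power2_eq_square field_simps)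
  also have "\<dots> \<le> 64 * (s0 + W) * E ^ 2 + 32 * E"
    using f0E f0nz s0 by (intro add_mono mult_left_mono power_mono) auto
  also have "norm (f 0) * norm (deriv (deriv f) 0) \<le> E * (E * (1 + W) + \<epsilon> * W ^ 2)"
    using f0E f2E f0nz E0 by (intro mult_mono) auto
  finally show ?thesis unfolding f1 W_def[symmetric] s0_def[symmetric] by (simp add: algebra_simps power2_eq_square)
qed

text \<open>Writing the linear form as a single twisted series makes the results on holomorphy in
  each variable available to it.\<close>

lemma dser_Phi_sum:
  assumes c: "\<And>m. norm (c m) \<le> 1" and z: "\<And>p. prime p \<Longrightarrow> norm (z p) \<le> 1" and \<sigma>: "\<sigma> > 1"
  shows "dser (\<lambda>k. if k \<in> Sm then \<Sum>p\<in>P. u p * of_real (real p powr -\<sigma>) * c (k * p) else 0) z \<sigma>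
    = (\<Sum>p\<in>P. u p * of_real (real p powr -\<sigma>) * Phi c z \<sigma> p)"
proof -
  let ?h = "\<lambda>p k. u p * of_real (real p powr -\<sigma>) * (c (k * p) * cmul z k * of_real (real k powr -\<sigma>))"
  have summ: "?h p summable_on Sm" for p
    by (intro summable_on_cmult_right summable_on_subset_banach[OF dser_summable[of "\<lambda>k. c (k * p)" 1 z \<sigma>, OF c z \<sigma>]]; (assumption | rule subset_UNIV))
  have "dser (\<lambda>k. if k \<in> Sm then \<Sum>p\<in>P. u p * of_real (real p powr -\<sigma>) * c (k * p) else 0) z \<sigma>
      = (\<Sum>\<^sub>\<infinity>k\<in>Sm. \<Sum>p\<in>P. ?h p k)"
    unfolding dser_def
    by (rule infsum_cong_neutral) (simp_all add: sum_distrib_left sum_distrib_right mult_ac)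
  also have "\<dots> = (\<Sum>p\<in>P. infsum (?h p) Sm)" by (rule infsum_finite_sum[OF P(1) summ])
  also have "\<dots> = (\<Sum>p\<in>P. u p * of_real (real p powr -\<sigma>) * Phi c z \<sigma> p)"
    unfolding Phi_def by (intro sum.cong refl infsum_cmult_right')
  finally show ?thesis .
qed

text \<open>The upper bound for the linear form holds only for unimodular y, the lower bound only
  well inside the polydisc. The form is holomorphic in the variables z p with p \<le> P0, so the
  maximum principle connects the two.\<close>

lemma torus_max:
  assumes c: "\<And>m. norm (c m) \<le> 1" and u: "\<And>p. p \<in> P \<Longrightarrow> norm (u p) \<le> 1"
    and z: "\<And>p. prime p \<Longrightarrow> norm (z p) \<le> 1" and \<sigma>: "\<sigma> > 1"
  obtains y where "\<And>p. prime p \<Longrightarrow> p \<le> P0 \<Longrightarrow> norm (y p) = 1"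
    "norm (\<Sum>p\<in>P. u p * of_real (real p powr -\<sigma>) * Phi c z \<sigma> p)
      \<le> norm (\<Sum>p\<in>P. u p * of_real (real p powr -\<sigma>) * Phi c y \<sigma> p)"
proof -
  define b where "b = (\<lambda>k. if k \<in> Sm then \<Sum>p\<in>P. u p * of_real (real p powr -\<sigma>) * c (k * p) else 0)"
  have b: "norm (b k) \<le> weight \<sigma>" for k
  proof -
    have "norm (\<Sum>p\<in>P. u p * of_real (real p powr -\<sigma>) * c (k * p)) \<le> weight \<sigma>"
      unfolding weight_def
    proof (rule sum_norm_le)
      fix p assume "p \<in> P"
      hence "norm (u p) * real p powr -\<sigma> * norm (c (k * p)) \<le> 1 * real p powr -\<sigma> * 1"
        using u c by (intro mult_mono) auto
      thus "norm (u p * of_real (real p powr -\<sigma>) * c (k * p)) \<le> real p powr -\<sigma>" by (simp add: norm_mult)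
    qed
    moreover have "weight \<sigma> \<ge> 0" by (auto simp: weight_def intro!: sum_nonneg)
    ultimately show ?thesis by (simp add: b_def)
  qed
  define Z where "Z = {z :: nat \<Rightarrow> complex. \<forall>p. prime p \<longrightarrow> norm (z p) \<le> 1}"
  have Z: "norm (z p) \<le> 1" if "z \<in> Z" "prime p" for z p using that by (simp add: Z_def)
  obtain y where y: "y \<in> Z" "\<And>p. p \<in> S \<Longrightarrow> norm (y p) = 1" "norm (dser b z \<sigma>) \<le> norm (dser b y \<sigma>)"
  proof (rule max_modulus_polydisc[of S Z "\<lambda>z. dser b z \<sigma>" z])
    show "finite S" by (rule S(1))
    show "z \<in> Z" using z by (simp add: Z_def)
    show "z(p := w) \<in> Z" if "z \<in> Z" "p \<in> S" "norm w \<le> 1" for z p w using that by (simp add: Z_def)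
    show "continuous_on (cball 0 1) (\<lambda>w. dser b (z(p := w)) \<sigma>)" if "z \<in> Z" "p \<in> S" for z p
      by (rule dser_fun_upd(1)[of b, OF b Z[OF that(1)] \<sigma>])
    show "(\<lambda>w. dser b (z(p := w)) \<sigma>) holomorphic_on ball 0 1" if "z \<in> Z" "p \<in> S" for z p
      by (rule dser_fun_upd(2)[of b, OF b Z[OF that(1)] \<sigma>])
    show "norm (z p) \<le> 1" if "p \<in> S" for p using z S(2)[OF that] .
  qed blast
  show ?thesis
  proof (rule that[of y])
    show "norm (y p) = 1" if "prime p" "p \<le> P0" for p using y(2) that by (simp add: S_def)
    show "norm (\<Sum>p\<in>P. u p * of_real (real p powr -\<sigma>) * Phi c z \<sigma> p)
      \<le> norm (\<Sum>p\<in>P. u p * of_real (real p powr -\<sigma>) * Phi c y \<sigma> p)"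
      using y(3) dser_Phi_sum[of c z \<sigma> u, OF c z \<sigma>] dser_Phi_sum[of c y \<sigma> u, OF c Z[OF y(1)] \<sigma>] by (simp add: b_def)
  qed
qed

end

section \<open>The coefficients of the Lerch zeta function\<close>

text \<open>The condition m > 0 matters for a = q, where 0 lies in the residue class but not in the
  progression starting at a.\<close>

definition residue_coeff :: "nat \<Rightarrow> nat \<Rightarrow> real \<Rightarrow> nat \<Rightarrow> complex" where
  "residue_coeff a q \<beta> m = (if m > 0 \<and> m mod q = a mod q then unit_exp (\<beta> * real m) else 0)"

lemma norm_residue_coeff: "norm (residue_coeff a q \<beta> m) \<le> 1"
  by (simp add: residue_coeff_def)

lemma residue_class_form:
  fixes m k q :: nat
  assumes "m mod q = k mod q" "m > 0" "1 \<le> k" "k \<le> q"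
  obtains j where "m = k + j * q"
proof -
  have "k \<le> m"
  proof (rule ccontr)
    assume "\<not> k \<le> m"
    hence "m mod q = m" "m < k" using assms by auto
    thus False using assms by (cases "k = q") auto
  qed
  then obtain d where d: "m = k + d" using le_Suc_ex by blast
  have "int q dvd int m - int k" using assms(1) by (metis mod_eq_dvd_iff of_nat_mod)
  hence "q dvd d" by (simp add: d)
  then obtain j where "d = q * j" by blast
  thus ?thesis using d that[of j] by simp
qed

text \<open>Orthogonality of the additive characters modulo q: the coefficients become an average of
  q pure exponentials of frequencies \<beta> + j / q, for which \<open>prime_window\<close> gives
  bounds.\<close>

lemma residue_coeff_expansion:
  assumes "q \<ge> 1" "m > 0"
  shows "residue_coeff a q \<beta> m =
    (\<Sum>j<q. unit_exp (-(real j * real a / real q)) * unit_exp ((\<beta> + real j / real q) * real m)) / of_nat q"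
proof -
  define r where "r = unit_exp ((real m - real a) / real q)"
  have "unit_exp (-(real j * real a / real q)) * unit_exp ((\<beta> + real j / real q) * real m) = unit_exp (\<beta> * real m) * r ^ j" for j
  proof -
    have "-(real j * real a / real q) + (\<beta> + real j / real q) * real m = \<beta> * real m + real j * ((real m - real a) / real q)"
      using assms by (simp add: field_simps)
    thus ?thesis unfolding r_def unit_exp_power unit_exp_add[symmetric] by (simp only:)
  qed
  hence "(\<Sum>j<q. unit_exp (-(real j * real a / real q)) * unit_exp ((\<beta> + real j / real q) * real m))
      = unit_exp (\<beta> * real m) * (\<Sum>j<q. r ^ j)" by (simp add: sum_distrib_left)
  moreover have "(\<Sum>j<q. r ^ j) = (if m mod q = a mod q then of_nat q else 0)"
  proof (cases "m mod q = a mod q")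
    case True
    hence "int q dvd int m - int a" by (metis mod_eq_dvd_iff of_nat_mod)
    then obtain n where n: "int m - int a = int q * n" by blast
    have "real m - real a = real_of_int (int m - int a)" by simp
    also have "\<dots> = real q * of_int n" by (simp add: n)
    finally have "(real m - real a) / real q = of_int n" using assms by simp
    hence "r = 1" by (simp add: r_def)
    thus ?thesis using True by simp
  next
    case False
    have "norm (1 - r) \<ge> 2 * (1 / real q)" unfolding r_def
    proof (rule norm_one_minus_unit_exp_ge)
      fix n :: int
      have "int m - int a - n * int q \<noteq> 0"
      proof
        assume "int m - int a - n * int q = 0"
        hence "int q dvd int m - int a" by (metis dvd_triv_right eq_iff_diff_eq_0)
        hence "int m mod int q = int a mod int q" by (simp add: mod_eq_dvd_iff)
        thus False using False by (metis of_nat_eq_iff of_nat_mod)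
      qed
      hence "\<bar>int m - int a - n * int q\<bar> \<ge> 1" by linarith
      hence 1: "real_of_int \<bar>int m - int a - n * int q\<bar> \<ge> 1" by linarith
      have "(real m - real a) / real q - of_int n = of_int (int m - int a - n * int q) / real q"
        using assms by (simp add: field_simps)
      hence "\<bar>(real m - real a) / real q - of_int n\<bar> = of_int \<bar>int m - int a - n * int q\<bar> / real q" by (simp add: abs_divide)
      also have "\<dots> \<ge> 1 / real q" using 1 by (intro divide_right_mono) auto
      finally show "1 / real q \<le> \<bar>(real m - real a) / real q - of_int n\<bar>" .
    qed
    moreover have "2 * (1 / real q) > 0" using assms by simp
    ultimately have "r \<noteq> 1" by auto
    moreover have "r ^ q = 1"
    proof -
      have "real q * ((real m - real a) / real q) = of_int (int m - int a)" using assms by simp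
      thus ?thesis unfolding r_def unit_exp_power by (simp only: unit_exp_of_int)
    qed
    ultimately show ?thesis using False by (simp add: geometric_sum)
  qed
  ultimately show ?thesis using assms by (simp add: residue_coeff_def)
qed

lemma residue_bilinear:
  assumes q: "q \<ge> 1" and k: "k \<ge> 1" and P: "\<And>p. p \<in> P \<Longrightarrow> p > 0"
    and b: "\<And>j. norm (\<Sum>p\<in>P. \<Sum>p'\<in>P. u p * u p' * of_real (real (p * p') powr -\<sigma>) *
        unit_exp (real k * (\<beta> + real j / real q) * real (p * p'))) \<le> 1"
  shows "norm (\<Sum>p\<in>P. \<Sum>p'\<in>P. u p * u p' * of_real (real (p * p') powr -\<sigma>) * residue_coeff a q \<beta> (k * (p * p'))) \<le> 1"
proof -
  let ?v = "\<lambda>p p'. u p * u p' * of_real (real (p * p') powr -\<sigma>)"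
  let ?w = "\<lambda>j p p'. unit_exp (real k * (\<beta> + real j / real q) * real (p * p'))"
  let ?x = "\<lambda>j. unit_exp (-(real j * real a / real q))"
  have "(\<Sum>p\<in>P. \<Sum>p'\<in>P. ?v p p' * residue_coeff a q \<beta> (k * (p * p'))) =
      (\<Sum>p\<in>P. \<Sum>p'\<in>P. \<Sum>j<q. ?x j * (?v p p' * ?w j p p') / of_nat q)"
  proof (intro sum.cong refl)
    fix p p' assume "p \<in> P" "p' \<in> P"
    hence pos: "k * (p * p') > 0" using P k by auto
    have arg: "(\<beta> + real j / real q) * real (k * (p * p')) = real k * (\<beta> + real j / real q) * real (p * p')" for j by simp
    show "?v p p' * residue_coeff a q \<beta> (k * (p * p')) = (\<Sum>j<q. ?x j * (?v p p' * ?w j p p') / of_nat q)"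
      unfolding residue_coeff_expansion[OF q pos] arg sum_divide_distrib[symmetric]
      by (simp only: sum_distrib_left times_divide_eq_right mult.left_commute)
  qed
  also have "\<dots> = (\<Sum>p\<in>P. \<Sum>j<q. \<Sum>p'\<in>P. ?x j * (?v p p' * ?w j p p') / of_nat q)"
    by (intro sum.cong refl sum.swap)
  also have "\<dots> = (\<Sum>j<q. \<Sum>p\<in>P. \<Sum>p'\<in>P. ?x j * (?v p p' * ?w j p p') / of_nat q)" by (rule sum.swap)
  also have "\<dots> = (\<Sum>j<q. ?x j * (\<Sum>p\<in>P. \<Sum>p'\<in>P. ?v p p' * ?w j p p') / of_nat q)"
    by (simp only: sum_distrib_left sum_divide_distrib)
  also have "norm \<dots> \<le> (\<Sum>j<q. 1 / real q)"
  proof (rule sum_norm_le)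
    fix j
    have "norm (?x j * (\<Sum>p\<in>P. \<Sum>p'\<in>P. ?v p p' * ?w j p p') / of_nat q) = norm (\<Sum>p\<in>P. \<Sum>p'\<in>P. ?v p p' * ?w j p p') / real q"
      by (simp only: norm_mult norm_divide norm_unit_exp norm_of_nat mult_1)
    also have "\<dots> \<le> 1 / real q" by (intro divide_right_mono b) simp
    finally show "norm (?x j * (\<Sum>p\<in>P. \<Sum>p'\<in>P. ?v p p' * ?w j p p') / of_nat q) \<le> 1 / real q" .
  qed
  also have "\<dots> = 1" using q by simp
  finally show ?thesis .
qed

lemma residue_inverse:
  fixes p q a :: nat
  assumes "prime p" "p > q" "q \<ge> 1"
  obtains k where "1 \<le> k" "k \<le> q" "(k * p) mod q = a mod q"
proof (cases "q = 1")
  case True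
  thus ?thesis using that[of 1] by simp
next
  case False
  have "coprime p q" using assms by (intro prime_imp_coprime) (auto dest: dvd_imp_le)
  then obtain x y where xy: "p * x = q * y + 1" using coprime_bezout_strong[of p q] False by blast
  \<comment> \<open>The representatives are 1, ..., q, so q takes the place of 0.\<close>
  define k where "k = (if (x * a) mod q = 0 then q else (x * a) mod q)"
  have "k mod q = (x * a) mod q" by (simp add: k_def)
  hence "(k * p) mod q = (x * a * p) mod q" by (metis mod_mult_left_eq)
  also have "x * a * p = a + q * (y * a)"
  proof -
    have "x * a * p = (p * x) * a" by (simp add: mult_ac)
    thus ?thesis by (simp add: xy algebra_simps)
  qed
  also have "(a + q * (y * a)) mod q = a mod q" by simp
  finally have "(k * p) mod q = a mod q" .
  moreover have "1 \<le> k" "k \<le> q" using assms(3) by (auto simp: k_def Suc_le_eq less_imp_le)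
  ultimately show ?thesis using that by blast
qed

lemma lacunary_residue_coeff:
  assumes "1 \<le> a" "a \<le> q"
  shows "lacunary (residue_coeff a q \<beta>) a q"
proof
  show "norm (residue_coeff a q \<beta> m) \<le> 1" for m by (rule norm_residue_coeff)
  show "\<exists>j. m = a + j * q" if "residue_coeff a q \<beta> m \<noteq> 0" for m
    using that residue_class_form[of m q a] assms by (auto simp: residue_coeff_def split: if_splits)
qed (use assms in \<open>auto simp: residue_coeff_def\<close>)

context prime_split
begin

text \<open>The choice z p = \<open>p powr -2\<close> raises the exponent from \<sigma> to 2 +
  \<sigma> > 3, where the first term of a lacunary series dominates. As p is invertible modulo q,
  the m with m * p in the class of a form a progression starting at some k \<le> q. This k is smooth
  because q \<le> P0, and discarding the other indices outside \<open>Sm\<close> does no harm. The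
  bound does not depend on p or P: k \<le> q and 2 + \<sigma> \<le> 4.\<close>

lemma Phi_lower_bound:
  assumes q: "1 \<le> q" "q \<le> P0" and p: "p \<in> P" and \<sigma>: "1 < \<sigma>" "\<sigma> \<le> 2"
  shows "norm (Phi (residue_coeff a q \<beta>) (\<lambda>p. of_nat p powr (-2)) \<sigma> p) \<ge> real q powr (-4) / 2"
proof -
  let ?c = "residue_coeff a q \<beta>"
  have pp: "prime p" "p > q" "p > 0" using P(2,3)[OF p] q P_pos[OF p] by auto
  obtain k where k: "1 \<le> k" "k \<le> q" "(k * p) mod q = a mod q" using residue_inverse[OF pp(1,2) q(1)] by metis
  have kSm: "k \<in> Sm"
  proof -
    have "r \<in> S" if "r \<in> prime_factors k" for r
    proof -
      have "r dvd k" using that by (rule in_prime_factors_imp_dvd)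
      hence "r \<le> k" using k(1) by (intro dvd_imp_le) auto
      thus ?thesis using in_prime_factors_imp_prime[OF that] k(2) q(2) by (simp add: S_def)
    qed
    thus ?thesis using k(1) by (auto simp: smooth_over_def)
  qed
  define b where "b = (\<lambda>m. if m \<in> Sm then ?c (m * p) else 0)"
  interpret lacunary b k q
  proof
    show "norm (b m) \<le> 1" for m using norm_residue_coeff by (simp add: b_def)
    show "norm (b k) = 1" using k pp kSm by (simp add: b_def residue_coeff_def)
    show "\<exists>j. m = k + j * q" if "b m \<noteq> 0" for m
    proof -
      have m: "m > 0" "(m * p) mod q = (k * p) mod q"
        using that k by (auto simp: b_def residue_coeff_def split: if_splits)
      have "int q dvd int (m * p) - int (k * p)" using m(2) by (metis mod_eq_dvd_iff of_nat_mod)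
      hence "int q dvd (int m - int k) * int p" by (simp add: left_diff_distrib)
      moreover have "coprime (int q) (int p)"
        using pp q(1) by (auto simp: coprime_commute intro!: prime_imp_coprime dest: dvd_imp_le)
      ultimately have "int q dvd int m - int k" by (simp add: coprime_dvd_mult_left_iff)
      hence "int m mod int q = int k mod int q" by (simp add: mod_eq_dvd_iff)
      hence "m mod q = k mod q" by (metis of_nat_eq_iff of_nat_mod)
      from residue_class_form[OF this m(1) k(1,2)] show ?thesis by blast
    qed
  qed (use k in auto)
  have "Phi ?c (\<lambda>p. of_nat p powr (-2)) \<sigma> p = dirichlet b (of_real (2 + \<sigma>))"
    unfolding Phi_def dirichlet_def
  proof (rule infsum_cong_neutral)
    fix m assume "m \<in> Sm \<inter> UNIV"
    hence m: "m \<in> Sm" "m > 0" by (auto simp: smooth_over_def)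
    have "complex_of_real (real m powr -\<sigma>) = of_nat m powr of_real (-\<sigma>)"
      by (subst powr_of_real[symmetric]) auto
    moreover have "-of_real (2 + \<sigma>) = -2 + complex_of_real (-\<sigma>)" by simp
    ultimately show "?c (m * p) * cmul (\<lambda>p. of_nat p powr (-2)) m * of_real (real m powr -\<sigma>) = b m * of_nat m powr (-of_real (2 + \<sigma>))"
      using m by (simp only: cmul_powr powr_add b_def if_True mult.assoc)
  qed (auto simp: b_def)
  hence "norm (Phi ?c (\<lambda>p. of_nat p powr (-2)) \<sigma> p) \<ge> real k powr (-(2 + \<sigma>)) / 2"
    using norm_dirichlet_ge[of "of_real (2 + \<sigma>)"] \<sigma> by simp
  moreover have "real q powr (-4) \<le> real k powr (-(2 + \<sigma>))"
  proof -
    have "real q powr (-4) \<le> real q powr (-(2 + \<sigma>))" using q \<sigma> by (intro powr_mono) auto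
    also have "\<dots> \<le> real k powr (-(2 + \<sigma>))" using k \<sigma> by (intro powr_mono2') auto
    finally show ?thesis .
  qed
  ultimately show ?thesis by linarith
qed

end

text \<open>The choices are made in the order E, s0, \<kappa> (from P0 and q), then \<epsilon> and
  K0, then T, then P, and finally \<sigma>. The lower bound \<open>(\<kappa> * W)^2\<close> then
  exceeds the upper bound, whose quadratic part is only half as large.\<close>

lemma residue_dser_not_zero_free:
  assumes \<beta>: "\<beta> \<notin> \<rat>" and q: "1 \<le> q" "q \<le> P0" and \<sigma>0: "1 < \<sigma>0" "\<sigma>0 \<le> 2"
    and nz: "\<And>\<sigma> z. 1 < \<sigma> \<Longrightarrow> \<sigma> \<le> \<sigma>0 \<Longrightarrow> (\<And>p. prime p \<Longrightarrow> p \<le> P0 \<Longrightarrow> norm (z p) = 1) \<Longrightarrow>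
      (\<And>p. prime p \<Longrightarrow> p > P0 \<Longrightarrow> norm (z p) \<le> 1) \<Longrightarrow> dser (residue_coeff a q \<beta>) z \<sigma> \<noteq> 0"
  shows False
proof -
  let ?c = "residue_coeff a q \<beta>"
  define PS where "PS = {p. prime p \<and> p \<le> P0}"
  have PS: "finite PS" "\<And>p. p \<in> PS \<Longrightarrow> prime p"
    unfolding PS_def by (auto intro: finite_subset[of _ "{..P0}"])
  define E where "E = (\<Sum>\<^sub>\<infinity>k\<in>smooth_over PS. real k powr -1)"
  have Esum: "(\<lambda>k. real k powr -1) summable_on smooth_over PS" using smooth_summable(1)[OF PS, of 1] by simp
  have E1: "E \<ge> 1"
  proof -
    have "sum (\<lambda>k. real k powr -1) {1} \<le> E" unfolding E_def
      by (rule finite_sum_le_infsum[OF Esum]) (auto simp: smooth_over_def)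
    thus ?thesis by simp
  qed
  define s0 where "s0 = (\<Sum>p\<in>PS. 1 / real p)"
  have s0: "s0 \<ge> 0" by (auto simp: s0_def intro!: sum_nonneg)
  define \<kappa> where "\<kappa> = real q powr (-4) / 2"
  have \<kappa>: "\<kappa> > 0" using q by (simp add: \<kappa>_def)
  \<comment> \<open>Makes \<open>E * \<epsilon> * W^2\<close> half of
    \<open>\<kappa>^2 * W^2\<close>.\<close>
  define \<epsilon> where "\<epsilon> = \<kappa> ^ 2 / (2 * E)"
  have \<epsilon>: "\<epsilon> > 0" using \<kappa> E1 by (simp add: \<epsilon>_def)
  obtain K0 where K0: "(\<Sum>\<^sub>\<infinity>k\<in>smooth_over PS \<inter> {K0<..}. real k powr -1) < \<epsilon>"
    using nonneg_tail_small[OF Esum _ \<epsilon>] by auto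
  \<comment> \<open>A collects the terms without W. The linear terms add up to
    \<open>65 * E^2 * W\<close>, with 65 = 1 + 64, and T is large enough for
    \<open>\<kappa>^2 / 2 * T\<close> to exceed \<open>A + 65 * E^2\<close>.\<close>
  define A where "A = E ^ 2 + 64 * s0 * E ^ 2 + 32 * E"
  define T where "T = 1 + 2 * (A + 65 * E ^ 2) / \<kappa> ^ 2"
  have A: "A \<ge> 0" using E1 s0 by (simp add: A_def)
  obtain P where PP: "finite P" "\<And>p. p \<in> P \<Longrightarrow> prime p \<and> p > P0" "(\<Sum>p\<in>P. 1 / real p) \<ge> T + 1"
    and bil: "\<And>u \<sigma> k j. (\<And>p. p \<in> P \<Longrightarrow> norm (u p) \<le> 1) \<Longrightarrow> \<sigma> \<ge> 1 \<Longrightarrow> 1 \<le> k \<Longrightarrow> k \<le> K0 \<Longrightarrow>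
      norm (\<Sum>p\<in>P. \<Sum>p'\<in>P. u p * u p' * of_real (real (p * p') powr -\<sigma>) *
        unit_exp (real k * (\<beta> + real j / real q) * real (p * p'))) \<le> 1"
  proof (rule prime_window[OF \<beta> q(1), of P0 "T + 1" K0], goal_cases)
    case (1 P)
    show ?case by (rule 1(1)[OF 1(2) 1(3) 1(4) 1(5)])
  qed
  interpret prime_split P0 P
  proof
    show "finite P" by (rule PP(1))
    show "prime p" "P0 < p" if "p \<in> P" for p using PP(2)[OF that] by blast+
  qed
  have SS: "prime_split.S P0 = PS" by (simp only: S_def PS_def)
  \<comment> \<open>P is now fixed and finite, so its weight is continuous at \<sigma> = 1, where it
    is at least T + 1.\<close>
  obtain \<sigma> where \<sigma>: "1 < \<sigma>" "\<sigma> \<le> \<sigma>0" "weight \<sigma> > T"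
  proof -
    have "((\<lambda>\<sigma>. weight \<sigma>) \<longlongrightarrow> (\<Sum>p\<in>P. real p powr -1)) (at_right 1)"
      unfolding weight_def using P_pos by (intro tendsto_sum tendsto_powr tendsto_intros) auto
    moreover have "(\<Sum>p\<in>P. real p powr -1) > T" using PP(3) by (simp add: powr_minus inverse_eq_divide)
    ultimately have "\<forall>\<^sub>F \<sigma> in at_right 1. weight \<sigma> > T" by (rule order_tendstoD)
    moreover have "\<forall>\<^sub>F \<sigma> in at_right 1. \<sigma> \<in> {1<..<\<sigma>0}" using \<sigma>0 by (intro eventually_at_right_real)
    ultimately have "\<forall>\<^sub>F \<sigma> in at_right (1::real). 1 < \<sigma> \<and> \<sigma> \<le> \<sigma>0 \<and> weight \<sigma> > T" by eventually_elim auto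
    hence "\<exists>\<sigma>. 1 < \<sigma> \<and> \<sigma> \<le> \<sigma>0 \<and> weight \<sigma> > T" by (rule eventually_happens'[rotated]) simp
    thus ?thesis using that by blast
  qed
  define W where "W = weight \<sigma>"
  define y0 where "y0 = (\<lambda>p::nat. of_nat p powr (-2) :: complex)"
  have y0: "norm (y0 p) \<le> 1" if "prime p" for p
  proof -
    have "real p \<ge> 1" using prime_ge_1_nat[OF that] by simp
    hence "real p powr (-2) \<le> real p powr 0" by (intro powr_mono) auto
    thus ?thesis using \<open>real p \<ge> 1\<close> by (simp add: y0_def norm_nat_powr)
  qed
  \<comment> \<open>The phases that make every summand of the linear form a non-negative real
    number.\<close>
  define u where "u = (\<lambda>p. cnj (sgn (Phi ?c y0 \<sigma> p)))"
  have u: "norm (u p) \<le> 1" for p by (simp add: u_def norm_sgn)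
  have uPhi: "u p * Phi ?c y0 \<sigma> p = of_real (norm (Phi ?c y0 \<sigma> p))" for p
  proof (cases "Phi ?c y0 \<sigma> p = 0")
    case False
    have "cnj (Phi ?c y0 \<sigma> p) * Phi ?c y0 \<sigma> p = of_real (norm (Phi ?c y0 \<sigma> p)) ^ 2"
      using complex_norm_square[of "Phi ?c y0 \<sigma> p"] by (simp add: mult.commute)
    thus ?thesis using False by (simp add: u_def sgn_eq power2_eq_square field_simps)
  qed simp
  obtain y where y: "\<And>p. prime p \<Longrightarrow> p \<le> P0 \<Longrightarrow> norm (y p) = 1"
    "norm (\<Sum>p\<in>P. u p * of_real (real p powr -\<sigma>) * Phi ?c y0 \<sigma> p)
      \<le> norm (\<Sum>p\<in>P. u p * of_real (real p powr -\<sigma>) * Phi ?c y \<sigma> p)"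
  proof (rule torus_max[of ?c u y0 \<sigma>, OF norm_residue_coeff u y0 \<sigma>(1)], goal_cases)
    case (2 y)
    show ?case by (rule 2(1)[OF 2(2) 2(3)])
  qed
  have "\<kappa> * W \<le> (\<Sum>p\<in>P. real p powr -\<sigma> * norm (Phi ?c y0 \<sigma> p))"
    unfolding W_def weight_def sum_distrib_left
  proof (rule sum_mono)
    fix p assume "p \<in> P"
    hence "\<kappa> \<le> norm (Phi ?c y0 \<sigma> p)" unfolding \<kappa>_def y0_def
      using q \<sigma> \<sigma>0 by (intro Phi_lower_bound) auto
    from mult_left_mono[OF this, of "real p powr -\<sigma>"]
    show "\<kappa> * real p powr -\<sigma> \<le> real p powr -\<sigma> * norm (Phi ?c y0 \<sigma> p)" by (simp add: mult.commute)
  qed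
  also have "\<dots> = norm (\<Sum>p\<in>P. u p * of_real (real p powr -\<sigma>) * Phi ?c y0 \<sigma> p)"
  proof -
    have "(\<Sum>p\<in>P. u p * of_real (real p powr -\<sigma>) * Phi ?c y0 \<sigma> p) = (\<Sum>p\<in>P. of_real (real p powr -\<sigma>) * (u p * Phi ?c y0 \<sigma> p))"
      by (simp only: mult_ac)
    also have "\<dots> = of_real (\<Sum>p\<in>P. real p powr -\<sigma> * norm (Phi ?c y0 \<sigma> p))" by (simp add: uPhi)
    finally show ?thesis by (simp only: norm_of_real) (simp add: sum_nonneg)
  qed
  also note y(2)
  finally have "\<kappa> * W \<le> norm (\<Sum>p\<in>P. u p * of_real (real p powr -\<sigma>) * Phi ?c y \<sigma> p)" .
  moreover have W1: "W \<ge> T" "W > 0"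
  proof -
    have "2 * (A + 65 * E ^ 2) / \<kappa> ^ 2 \<ge> 0" using A by simp
    hence "T > 0" unfolding T_def by linarith
    thus "W \<ge> T" "W > 0" using \<sigma>(3) by (auto simp: W_def)
  qed
  ultimately have "(\<kappa> * W) ^ 2 \<le> norm (\<Sum>p\<in>P. u p * of_real (real p powr -\<sigma>) * Phi ?c y \<sigma> p) ^ 2"
    using \<kappa> by (intro power_mono) auto
  also have "\<dots> \<le> E ^ 2 * (1 + W) + E * \<epsilon> * W ^ 2 + 64 * (s0 + W) * E ^ 2 + 32 * E"
  proof -
    have nz': "dser ?c z \<sigma> \<noteq> 0" if "\<And>p. prime p \<Longrightarrow> p \<le> P0 \<Longrightarrow> norm (z p) = 1"
      "\<And>p. prime p \<Longrightarrow> p > P0 \<Longrightarrow> norm (z p) \<le> 1" for z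
      by (rule nz[OF \<sigma>(1,2)]) (use that in auto)
    have bil': "norm (\<Sum>p\<in>P. \<Sum>p'\<in>P. u p * u p' * of_real (real (p * p') powr -\<sigma>) * ?c (k * (p * p'))) \<le> 1"
      if k: "1 \<le> k" "k \<le> K0" for k
    proof (rule residue_bilinear[OF q(1) k(1) P_pos])
      show "norm (\<Sum>p\<in>P. \<Sum>p'\<in>P. u p * u p' * of_real (real (p * p') powr -\<sigma>) *
        unit_exp (real k * (\<beta> + real j / real q) * real (p * p'))) \<le> 1" for j
        by (rule bil) (use u \<sigma> k in auto)
    qed
    have tail: "(\<Sum>\<^sub>\<infinity>k\<in>smooth_over (prime_split.S P0) \<inter> {K0<..}. real k powr -1) \<le> \<epsilon>"
      unfolding SS using K0 by simp
    have mass: "smooth_mass = E" unfolding smooth_mass_def SS E_def ..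
    show ?thesis
      using linear_term_bound[of ?c y u \<sigma> K0 \<epsilon>, OF norm_residue_coeff y(1) u \<sigma>(1) nz' bil' tail]
      unfolding mass unfolding SS W_def[symmetric] s0_def[symmetric]
      by (simp only: imp_refl)
  qed
  also have "\<dots> = A + 65 * E ^ 2 * W + \<kappa> ^ 2 / 2 * W ^ 2"
    using E1 by (simp add: A_def \<epsilon>_def algebra_simps)
  finally have *: "\<kappa> ^ 2 / 2 * W ^ 2 \<le> A + 65 * E ^ 2 * W" by (simp add: power_mult_distrib algebra_simps)
  have "1 \<le> T" unfolding T_def using A by simp
  hence "W \<ge> 1" using W1 by simp
  have "\<kappa> ^ 2 / 2 * T = \<kappa> ^ 2 / 2 + (A + 65 * E ^ 2)" using \<kappa> by (simp add: T_def field_simps)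
  hence "A + 65 * E ^ 2 < \<kappa> ^ 2 / 2 * T" using \<kappa> by simp
  also have "\<kappa> ^ 2 / 2 * T \<le> \<kappa> ^ 2 / 2 * W" using W1(1) by (intro mult_left_mono) auto
  finally have "\<kappa> ^ 2 / 2 * W > A + 65 * E ^ 2" .
  hence "\<kappa> ^ 2 / 2 * W * W > (A + 65 * E ^ 2) * W" using W1 by simp
  moreover have "(A + 65 * E ^ 2) * W \<ge> A + 65 * E ^ 2 * W"
    using A \<open>W \<ge> 1\<close> mult_left_mono[of 1 W A] by (simp add: algebra_simps)
  ultimately show False using * by (simp add: power2_eq_square)
qed

section \<open>Return to the Lerch zeta function\<close>

lemma e_eq_unit_exp: "e (of_real x) = unit_exp x"
  by (simp add: e_def unit_exp_def cis_conv_exp mult_ac)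

text \<open>Substitute m = n * q + a: then n + a / q = m / q, and with \<beta> = lam / q the phase
  lam * n equals \<beta> * m - \<beta> * a.\<close>

lemma Lerch_zeta_eq_dirichlet:
  assumes a: "1 \<le> a" "a \<le> q" and s: "Re s > 1"
  shows "Lerch_zeta lam (real a / real q) s =
    unit_exp (-(lam / real q * real a)) * of_nat q powr s * dirichlet (residue_coeff a q (lam / real q)) s"
proof -
  let ?c = "residue_coeff a q (lam / real q)"
  let ?K = "unit_exp (-(lam / real q * real a)) * of_nat q powr s"
  have q: "q \<ge> 1" using a by simp
  have "((\<lambda>m. ?c m * of_nat m powr (-s)) has_sum dirichlet ?c s) UNIV"
    unfolding dirichlet_def by (intro has_sum_infsum dirichlet_summable norm_residue_coeff s)
  also have "?this \<longleftrightarrow> ((\<lambda>m. ?c m * of_nat m powr (-s)) has_sum dirichlet ?c s) (range (\<lambda>n. n * q + a))"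
  proof (rule has_sum_cong_neutral)
    fix m assume m: "m \<in> UNIV - range (\<lambda>n. n * q + a)"
    have "?c m = 0"
    proof (rule ccontr)
      assume "?c m \<noteq> 0"
      hence "m mod q = a mod q" "m > 0" by (auto simp: residue_coeff_def split: if_splits)
      from residue_class_form[OF this a] obtain j where "m = a + j * q" .
      thus False using m by (auto simp: image_iff)
    qed
    thus "?c m * of_nat m powr (-s) = 0" by simp
  qed auto
  also have "\<dots> \<longleftrightarrow> (((\<lambda>m. ?c m * of_nat m powr (-s)) \<circ> (\<lambda>n. n * q + a)) has_sum dirichlet ?c s) UNIV"
    using q by (intro has_sum_reindex) (auto simp: inj_on_def)
  finally have "((\<lambda>n. ?K * (?c (n * q + a) * of_nat (n * q + a) powr (-s))) has_sum ?K * dirichlet ?c s) UNIV"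
    unfolding o_def by (rule has_sum_cmult_right)
  also have "(\<lambda>n. ?K * (?c (n * q + a) * of_nat (n * q + a) powr (-s))) =
      (\<lambda>n. e (of_real lam * of_nat n) / (of_nat n + of_real (real a / real q)) powr s)"
  proof
    fix n
    let ?m = "n * q + a"
    have c: "?c ?m = unit_exp (lam / real q * real ?m)" using a by (simp add: residue_coeff_def)
    have arg: "-(lam / real q * real a) + lam / real q * real ?m = lam * real n" using q by (simp add: field_simps)
    have "e (of_real lam * of_nat n) = unit_exp (lam * real n)"
      using e_eq_unit_exp[of "lam * real n"] by simp
    also have "\<dots> = unit_exp (-(lam / real q * real a)) * ?c ?m" unfolding c unit_exp_add[symmetric] arg ..
    finally have E: "e (of_real lam * of_nat n) = unit_exp (-(lam / real q * real a)) * ?c ?m" .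
    have "complex_of_real (real ?m / real q) = of_nat n + of_real (real a / real q)" using q by (simp add: field_simps)
    moreover have "of_nat ?m powr s = (of_real (real q) * of_real (real ?m / real q)) powr s"
      using q by simp
    hence "of_nat ?m powr s = of_nat q powr s * (of_real (real ?m / real q)) powr s"
      by (subst (asm) powr_times_real) auto
    ultimately have M: "of_nat ?m powr s = of_nat q powr s * (of_nat n + of_real (real a / real q)) powr s" by simp
    have nz: "of_nat q powr s \<noteq> (0 :: complex)" using q by (simp add: powr_def)
    show "?K * (?c ?m * of_nat ?m powr (-s)) = e (of_real lam * of_nat n) / (of_nat n + of_real (real a / real q)) powr s"
      unfolding powr_minus M E using nz by (simp add: field_simps)
  qed
  finally have "(\<lambda>n. e (of_real lam * of_nat n) / (of_nat n + of_real (real a / real q)) powr s) sums (?K * dirichlet ?c s)"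
    by (rule has_sum_imp_sums)
  thus ?thesis unfolding Lerch_zeta_def by (rule sums_unique[symmetric])
qed

text \<open>The restriction \<eta> \<le> 1 keeps \<sigma>0 \<le> 2, as required for the constant in
  \<open>Phi_lower_bound\<close>.\<close>

lemma residue_dirichlet_zero_in_strip:
  assumes "\<beta> \<notin> \<rat>" "1 \<le> a" "a \<le> q" "0 < \<eta>" "\<eta> \<le> 1"
  shows "\<exists>s. 1 < Re s \<and> Re s < 1 + \<eta> \<and> dirichlet (residue_coeff a q \<beta>) s = 0"
proof (rule ccontr)
  let ?c = "residue_coeff a q \<beta>"
  assume "\<not> ?thesis"
  hence zf: "\<And>s. 1 < Re s \<Longrightarrow> Re s < 1 + \<eta> \<Longrightarrow> dirichlet ?c s \<noteq> 0" by blast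
  interpret lacunary ?c a q by (rule lacunary_residue_coeff) fact+
  define \<sigma>0 where "\<sigma>0 = 1 + \<eta> / 2"
  have \<sigma>0: "1 < \<sigma>0" "\<sigma>0 \<le> 2" "\<sigma>0 < 1 + \<eta>" using assms by (auto simp: \<sigma>0_def)
  have low: "\<exists>\<delta>>0. \<forall>\<sigma> z. \<sigma>1 \<le> \<sigma> \<longrightarrow> \<sigma> \<le> \<sigma>0 \<longrightarrow> (\<forall>p. prime p \<longrightarrow> norm (z p) = 1) \<longrightarrow> norm (dser ?c z \<sigma>) \<ge> \<delta>"
    if \<sigma>1: "1 < \<sigma>1" "\<sigma>1 \<le> \<sigma>0" for \<sigma>1
  proof -
    obtain \<delta> where \<delta>: "\<delta> > 0" "\<And>\<sigma> t. \<sigma>1 \<le> \<sigma> \<Longrightarrow> \<sigma> \<le> \<sigma>0 \<Longrightarrow> norm (dirichlet ?c (Complex \<sigma> t)) \<ge> \<delta>"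
    proof (rule zero_free_lower_bound[OF zf \<sigma>1 \<sigma>0(3)], goal_cases)
      case (3 \<delta>)
      show ?case by (rule 3(1)[OF 3(2) 3(3)])
    qed
    show ?thesis
    proof (intro exI[of _ \<delta>] conjI allI impI \<delta>(1))
      fix \<sigma> and z :: "nat \<Rightarrow> complex" assume "\<sigma>1 \<le> \<sigma>" "\<sigma> \<le> \<sigma>0" "\<forall>p. prime p \<longrightarrow> norm (z p) = 1"
      thus "norm (dser ?c z \<sigma>) \<ge> \<delta>" using \<delta>(2) \<sigma>1(1) by (intro torus_lower_bound) auto
    qed
  qed
  obtain P0 where P0: "P0 \<ge> q" "\<And>\<sigma> z. 1 < \<sigma> \<Longrightarrow> \<sigma> \<le> \<sigma>0 \<Longrightarrow> (\<And>p. prime p \<Longrightarrow> p \<le> P0 \<Longrightarrow> norm (z p) = 1) \<Longrightarrow>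
    (\<And>p. prime p \<Longrightarrow> p > P0 \<Longrightarrow> norm (z p) \<le> 1) \<Longrightarrow> dser ?c z \<sigma> \<noteq> 0"
  proof (rule polydisc_zero_free[where q = q, OF norm_residue_coeff \<sigma>0(1) low], goal_cases)
    case (3 P0)
    show ?case by (rule 3(1)[OF 3(2) 3(3)])
  qed
  show False
    by (rule residue_dser_not_zero_free[OF assms(1) _ P0(1) \<sigma>0(1,2) P0(2)]) (use assms in auto)
qed

theorem theorem1:
  fixes \<alpha> lam \<eta> :: real
  assumes "0 < \<alpha>" and "\<alpha> \<le> 1" and "0 < lam" and "lam \<le> 1"
    and "\<alpha> \<in> \<rat>" and "lam \<notin> \<rat>"
    and "\<eta> > 0"
  shows "infinite {s :: complex. 1 < Re s \<and> Re s < 1 + \<eta> \<and> Lerch_zeta lam \<alpha> s = 0}"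
proof
  define Z where "Z = {s :: complex. 1 < Re s \<and> Re s < 1 + \<eta> \<and> Lerch_zeta lam \<alpha> s = 0}"
  assume "finite {s :: complex. 1 < Re s \<and> Re s < 1 + \<eta> \<and> Lerch_zeta lam \<alpha> s = 0}"
  hence fin: "finite Z" by (simp add: Z_def)
  obtain a q :: nat where aq: "q \<noteq> 0" "\<alpha> = real a / real q"
    using Rats_abs_nat_div_natE[OF \<open>\<alpha> \<in> \<rat>\<close>] \<open>0 < \<alpha>\<close> by (metis abs_of_pos)
  have a: "1 \<le> a" "a \<le> q"
  proof -
    show "1 \<le> a" using aq(2) \<open>0 < \<alpha>\<close> by (cases "a = 0") simp_all
    have "real a = \<alpha> * real q" using aq by simp
    also have "\<dots> \<le> 1 * real q" using \<open>\<alpha> \<le> 1\<close> by (intro mult_right_mono) auto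
    finally show "a \<le> q" by simp
  qed
  have \<beta>: "lam / real q \<notin> \<rat>"
  proof
    assume "lam / real q \<in> \<rat>"
    hence "lam / real q * real q \<in> \<rat>" by (intro Rats_mult) auto
    thus False using aq \<open>lam \<notin> \<rat>\<close> by simp
  qed
  \<comment> \<open>If there were only finitely many zeros, m would be at most the real part of
    each. The strip 1 < Re s < m still contains a zero, to the left of all of them. The inserted
    value covers the empty case and keeps the width m - 1 at most 1.\<close>
  define m where "m = Min (insert (1 + min \<eta> 1) (Re ` Z))"
  have m: "m > 1" "m \<le> 1 + min \<eta> 1" "\<And>s. s \<in> Z \<Longrightarrow> m \<le> Re s"
    using fin \<open>\<eta> > 0\<close> by (auto simp: m_def Z_def)
  have "m - 1 \<le> 1" using m(2) min.cobounded2[of \<eta> 1] by linarith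
  then obtain s where s: "1 < Re s" "Re s < 1 + (m - 1)" "dirichlet (residue_coeff a q (lam / real q)) s = 0"
    using residue_dirichlet_zero_in_strip[OF \<beta> a, of "m - 1"] m(1) by auto
  have "Lerch_zeta lam \<alpha> s = 0" using Lerch_zeta_eq_dirichlet[OF a s(1), of lam] s(3) aq(2) by simp
  hence "s \<in> Z" using s m(2) by (simp add: Z_def)
  thus False using m(3)[of s] s(2) by simp
qed

end
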